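(* Let $d\ge 1$, let $S$ be a measurable space, and let $P$ and $Q$ be probability kernels from $S$ to $\mathbb{R}^d$ with finite first moments. Then: (i) $P_\theta \le_{\mathrm{cx}} Q_\theta$ for all $\theta\in S$ if and only if $P$ and $Q$ admit a pointwise coupling $R$ such that $R_\theta \in \mathcal{M}_2(\mathbb{R}^d)$ for all $\theta\in S$; (ii) $P_\theta \le_{\mathrm{icx}} Q_\theta$ for all $\theta\in S$ if and only if $P$ and $Q$ admit a pointwise coupling $R$ such that $R_\theta \in \mathcal{M}^*_2(\mathbb{R}^d)$ for all $\theta\in S$.
   Context: $\mathbb{R}^d$ carries its Borel sigma-algebra, and $\mathbb{R}_+=[0,\infty)$. A probability kernel from $S$ to $\mathbb{R}^d$ is a map $P:(\theta,B)\mapsto P_\theta(B)$ such that $P_\theta$ is a probability measure on $\mathbb{R}^d$ for every $\theta\in S$, and $\theta\mapsto P_\theta(B)$ is measurable for every Borel set $B\subset\mathbb{R}^d$ (similarly for kernels to $\mathbb{R}^d\times\mathbb{R}^d$). $P$ has finite first moments if $\int |x|\,P_\theta(dx)<\infty$ for all $\theta$. For probability measures $\mu,\nu$ on $\mathbb{R}^d$: $\mu\le_{\mathrm{cx}}\nu$ means $\int\phi\,d\mu\le\int\phi\,d\nu$ for all convex $\phi:\mathbb{R}^d\to\mathbb{R}_+$; $\mu\le_{\mathrm{icx}}\nu$ means the same inequality for all convex $\phi:\mathbb{R}^d\to\mathbb{R}_+$ that are increasing, i.e. $\phi(x)\le\phi(y)$ whenever $x\le y$ coordinatewise. A coupling of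 $\mu$ and $\nu$ is a probability measure on $\mathbb{R}^d\times\mathbb{R}^d$ with first marginal $\mu$ and second marginal $\nu$. A probability kernel $R$ from $S$ to $\mathbb{R}^d\times\mathbb{R}^d$ is a pointwise coupling of $P$ and $Q$ if $R_\theta$ is a coupling of $P_\theta$ and $Q_\theta$ for every $\theta\in S$. $\mathcal{M}_2(\mathbb{R}^d)$ (resp. $\mathcal{M}_2^*(\mathbb{R}^d)$) is the set of probability measures on $\mathbb{R}^d\times\mathbb{R}^d$ that are the joint distribution of some $\mathbb{R}^d$-valued martingale (resp. submartingale) $(X_1,X_2)$, i.e. $X_1,X_2$ are integrable and $E[X_2\mid X_1]=X_1$ (resp. $E[X_2\mid X_1]\ge X_1$ coordinatewise) almost surely. *)

theory Defs
  imports "HOL-Probability.Probability"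
begin

text \<open>
  A probability kernel from \<open>S\<close> to \<open>N\<close> is an element of \<open>S \<rightarrow>\<^sub>M prob_algebra N\<close>; this is
  what the phrase unfolds to:
\<close>

lemma prob_kernel_iff:
  "P \<in> S \<rightarrow>\<^sub>M prob_algebra N \<longleftrightarrow>
     (\<forall>\<theta>\<in>space S. prob_space (P \<theta>) \<and> sets (P \<theta>) = sets N) \<and>
     (\<forall>B\<in>sets N. (\<lambda>\<theta>. emeasure (P \<theta>) B) \<in> borel_measurable S)"
  (is "?L \<longleftrightarrow> ?R")
proof
  assume P: ?L
  then have "P \<in> S \<rightarrow>\<^sub>M subprob_algebra N"
    by (rule measurable_prob_algebraD)
  then have "\<forall>B\<in>sets N. (\<lambda>\<theta>. emeasure (P \<theta>) B) \<in> borel_measurable S"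
    using measurable_compose[OF _ measurable_emeasure_subprob_algebra] by blast
  moreover have "prob_space (P \<theta>) \<and> sets (P \<theta>) = sets N" if "\<theta> \<in> space S" for \<theta>
    using measurable_space[OF P that] by (simp add: space_prob_algebra)
  ultimately show ?R by blast
next
  assume R: ?R
  have "P \<in> S \<rightarrow>\<^sub>M subprob_algebra N"
    by (rule measurable_subprob_algebra) (use R in \<open>auto intro: prob_space_imp_subprob_space\<close>)
  with R show ?L
    by (intro measurable_prob_algebraI) auto
qed

definition finite_first_moments ::
    "'s measure \<Rightarrow> ('s \<Rightarrow> (real ^ 'n) measure) \<Rightarrow> bool" where
  "finite_first_moments S P \<longleftrightarrow> (\<forall>\<theta>\<in>space S. (\<integral>\<^sup>+ x. ennreal (norm x) \<partial>P \<theta>) < \<infinity>)"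

text \<open>
  Both orders compare integrals with values in \<open>[0, \<infinity>]\<close>. Finite convex functions on the whole
  space are continuous, so no measurability is required of \<open>\<phi>\<close>. The order on \<open>real ^ 'n\<close> is the
  coordinatewise one, so \<open>mono\<close> is monotonicity with respect to it.
\<close>

definition cx_le :: "(real ^ 'n) measure \<Rightarrow> (real ^ 'n) measure \<Rightarrow> bool" where
  "cx_le \<mu> \<nu> \<longleftrightarrow>
     (\<forall>\<phi> :: real ^ 'n \<Rightarrow> real. convex_on UNIV \<phi> \<and> (\<forall>x. 0 \<le> \<phi> x) \<longrightarrow>
        (\<integral>\<^sup>+ x. ennreal (\<phi> x) \<partial>\<mu>) \<le> (\<integral>\<^sup>+ x. ennreal (\<phi> x) \<partial>\<nu>))"

definition icx_le :: "(real ^ 'n) measure \<Rightarrow> (real ^ 'n) measure \<Rightarrow> bool" where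
  "icx_le \<mu> \<nu> \<longleftrightarrow>
     (\<forall>\<phi> :: real ^ 'n \<Rightarrow> real. convex_on UNIV \<phi> \<and> (\<forall>x. 0 \<le> \<phi> x) \<and> mono \<phi> \<longrightarrow>
        (\<integral>\<^sup>+ x. ennreal (\<phi> x) \<partial>\<mu>) \<le> (\<integral>\<^sup>+ x. ennreal (\<phi> x) \<partial>\<nu>))"

definition coupling ::
    "(real ^ 'n) measure \<Rightarrow> (real ^ 'n) measure \<Rightarrow> ((real ^ 'n) \<times> (real ^ 'n)) measure \<Rightarrow> bool" where
  "coupling \<mu> \<nu> \<pi> \<longleftrightarrow>
     prob_space \<pi> \<and> sets \<pi> = sets (borel \<Otimes>\<^sub>M borel) \<and>
     distr \<pi> borel fst = \<mu> \<and> distr \<pi> borel snd = \<nu>"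

definition pointwise_coupling ::
    "'s measure \<Rightarrow> ('s \<Rightarrow> (real ^ 'n) measure) \<Rightarrow> ('s \<Rightarrow> (real ^ 'n) measure) \<Rightarrow>
     ('s \<Rightarrow> ((real ^ 'n) \<times> (real ^ 'n)) measure) \<Rightarrow> bool" where
  "pointwise_coupling S P Q R \<longleftrightarrow>
     R \<in> S \<rightarrow>\<^sub>M prob_algebra (borel \<Otimes>\<^sub>M borel) \<and>
     (\<forall>\<theta>\<in>space S. coupling (P \<theta>) (Q \<theta>) (R \<theta>))"

text \<open>
  The \<open>i\<close>-th coordinate of \<open>E[Y | X]\<close>, where \<open>\<sigma>(X)\<close> is \<open>vimage_algebra (space M) X borel\<close>.
\<close>

definition cond_exp_coord ::
    "'w measure \<Rightarrow> ('w \<Rightarrow> real ^ 'n) \<Rightarrow> ('w \<Rightarrow> real ^ 'n) \<Rightarrow> 'n \<Rightarrow> 'w \<Rightarrow> real" where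
  "cond_exp_coord M X Y i =
     real_cond_exp M (vimage_algebra (space M) X borel) (\<lambda>\<omega>. Y \<omega> $ i)"

definition martingale_pair ::
    "'w measure \<Rightarrow> ('w \<Rightarrow> real ^ 'n) \<Rightarrow> ('w \<Rightarrow> real ^ 'n) \<Rightarrow> bool" where
  "martingale_pair M X\<^sub>1 X\<^sub>2 \<longleftrightarrow>
     prob_space M \<and> integrable M X\<^sub>1 \<and> integrable M X\<^sub>2 \<and>
     (AE \<omega> in M. \<forall>i. cond_exp_coord M X\<^sub>1 X\<^sub>2 i \<omega> = X\<^sub>1 \<omega> $ i)"

definition submartingale_pair ::
    "'w measure \<Rightarrow> ('w \<Rightarrow> real ^ 'n) \<Rightarrow> ('w \<Rightarrow> real ^ 'n) \<Rightarrow> bool" where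
  "submartingale_pair M X\<^sub>1 X\<^sub>2 \<longleftrightarrow>
     prob_space M \<and> integrable M X\<^sub>1 \<and> integrable M X\<^sub>2 \<and>
     (AE \<omega> in M. \<forall>i. cond_exp_coord M X\<^sub>1 X\<^sub>2 i \<omega> \<ge> X\<^sub>1 \<omega> $ i)"

text \<open>
  The sets \<open>\<M>\<^sub>2\<close> and \<open>\<M>\<^sub>2\<^sup>*\<close> of joint laws. The existential quantifier over probability spaces has
  to fix their type; \<open>(real ^ 'n) \<times> (real ^ 'n)\<close> is enough, as the two membership lemmas at the end of
  the theory show: they produce a member from a (sub)martingale on a space of any type.
\<close>

definition martingale_laws :: "((real ^ 'n) \<times> (real ^ 'n)) measure set" where
  "martingale_laws =
     {distr M (borel \<Otimes>\<^sub>M borel) (\<lambda>\<omega>. (X\<^sub>1 \<omega>, X\<^sub>2 \<omega>)) |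
        (M :: ((real ^ 'n) \<times> (real ^ 'n)) measure) X\<^sub>1 X\<^sub>2. martingale_pair M X\<^sub>1 X\<^sub>2}"

definition submartingale_laws :: "((real ^ 'n) \<times> (real ^ 'n)) measure set" where
  "submartingale_laws =
     {distr M (borel \<Otimes>\<^sub>M borel) (\<lambda>\<omega>. (X\<^sub>1 \<omega>, X\<^sub>2 \<omega>)) |
        (M :: ((real ^ 'n) \<times> (real ^ 'n)) measure) X\<^sub>1 X\<^sub>2. submartingale_pair M X\<^sub>1 X\<^sub>2}"

lemma sigma_finite_subalgebra_vimage:
  assumes "prob_space M" and "X \<in> M \<rightarrow>\<^sub>M N"
  shows "sigma_finite_subalgebra M (vimage_algebra (space M) X N)"
proof -
  interpret prob_space M by fact
  have "subalgebra M (vimage_algebra (space M) X N)"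
    using assms(2) by (auto simp: subalgebra_def sets_vimage_algebra2 measurable_def)
  then have "finite_measure_subalgebra M (vimage_algebra (space M) X N)"
    by unfold_locales
  then show ?thesis
    by (rule finite_measure_subalgebra_is_sigma_finite)
qed

lemma cond_exp_coord_distr:
  fixes X Y :: "'w \<Rightarrow> real ^ 'n"
  assumes "prob_space M" and X: "integrable M X" and Y: "integrable M Y"
  defines "L \<equiv> distr M (borel \<Otimes>\<^sub>M borel) (\<lambda>\<omega>. (X \<omega>, Y \<omega>))"
  shows "AE \<omega> in M. cond_exp_coord M X Y i \<omega> = cond_exp_coord L fst snd i (X \<omega>, Y \<omega>)"
proof -
  interpret prob_space M by fact
  have XM [measurable]: "X \<in> borel_measurable M" and YM [measurable]: "Y \<in> borel_measurable M"
    using X Y by auto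
  have Z [measurable]: "(\<lambda>\<omega>. (X \<omega>, Y \<omega>)) \<in> M \<rightarrow>\<^sub>M borel \<Otimes>\<^sub>M borel" by measurable
  have L: "prob_space L" unfolding L_def by (rule prob_space_distr) measurable
  have setsL [measurable_cong]: "sets L = sets (borel \<Otimes>\<^sub>M borel)" by (simp add: L_def)
  have spaceL: "space L = UNIV" by (simp add: L_def space_pair_measure)
  let ?F = "vimage_algebra (space M) X borel"
  let ?G = "vimage_algebra (space L) fst borel"
  define h where "h = real_cond_exp L ?G (\<lambda>p. snd p $ i)"
  interpret F: sigma_finite_subalgebra M ?F
    by (rule sigma_finite_subalgebra_vimage) (use \<open>prob_space M\<close> in auto)
  interpret G: sigma_finite_subalgebra L ?G
    by (rule sigma_finite_subalgebra_vimage) (use L in \<open>auto simp: setsL cong: measurable_cong_sets\<close>)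
  have Yi: "integrable M (\<lambda>\<omega>. Y \<omega> $ i)"
    using integrable_bounded_linear[OF bounded_linear_vec_nth Y] .
  have comp: "(\<lambda>x :: real ^ 'n. x $ i) \<in> borel_measurable borel"
    by (intro borel_measurable_continuous_onI continuous_intros)
  have snd_i [measurable]:
    "(\<lambda>p :: (real ^ 'n) \<times> (real ^ 'n). snd p $ i) \<in> borel_measurable (borel \<Otimes>\<^sub>M borel)"
    by (rule measurable_compose[OF measurable_snd comp])
  have sndL: "integrable L (\<lambda>p. snd p $ i)"
    unfolding L_def by (subst integrable_distr_eq) (use Yi in \<open>auto simp: snd_i\<close>)
  have hL: "integrable L h" and hG: "h \<in> borel_measurable ?G"
    unfolding h_def using G.real_cond_exp_int(1)[OF sndL] by auto
  have hm [measurable]: "h \<in> borel_measurable (borel \<Otimes>\<^sub>M borel)"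
    using hL borel_measurable_integrable[OF hL] by (simp add: setsL cong: measurable_cong_sets)
  have "AE \<omega> in M. real_cond_exp M ?F (\<lambda>\<omega>. Y \<omega> $ i) \<omega> = h (X \<omega>, Y \<omega>)"
  proof (rule F.real_cond_exp_charact)
    show "integrable M (\<lambda>\<omega>. Y \<omega> $ i)" by fact
    show "integrable M (\<lambda>\<omega>. h (X \<omega>, Y \<omega>))"
      using hL unfolding L_def by (subst (asm) integrable_distr_eq) auto
    have "(\<lambda>\<omega>. (X \<omega>, Y \<omega>)) \<in> ?F \<rightarrow>\<^sub>M ?G"
      by (rule measurable_vimage_algebra2)
        (auto simp: spaceL intro!: measurable_vimage_algebra1)
    then show "(\<lambda>\<omega>. h (X \<omega>, Y \<omega>)) \<in> borel_measurable ?F"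
      using hG by (rule measurable_compose)
  next
    fix A assume "A \<in> sets ?F"
    then obtain B where B: "B \<in> sets borel" and A: "A = X -` B \<inter> space M"
      by (auto simp: sets_vimage_algebra2)
    let ?B = "fst -` B \<inter> space L :: ((real ^ 'n) \<times> (real ^ 'n)) set"
    have BG: "?B \<in> sets ?G"
      using B by (auto simp: sets_vimage_algebra2)
    have BL [measurable]: "?B \<in> sets (borel \<Otimes>\<^sub>M borel)"
      using BG G.subalg setsL by (auto simp: subalgebra_def)
    have tr: "(\<integral>\<omega>\<in>A. f (X \<omega>, Y \<omega>) \<partial>M) = (\<integral>p\<in>?B. f p \<partial>L)"
      if [measurable]: "f \<in> borel_measurable (borel \<Otimes>\<^sub>M borel)"
      for f :: "(real ^ 'n) \<times> (real ^ 'n) \<Rightarrow> real"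
    proof -
      have "(\<integral>p\<in>?B. f p \<partial>L) = (\<integral>\<omega>. indicator ?B (X \<omega>, Y \<omega>) *\<^sub>R f (X \<omega>, Y \<omega>) \<partial>M)"
        unfolding set_lebesgue_integral_def L_def
        by (rule integral_distr) (use BL in \<open>auto simp: L_def\<close>)
      also have "\<dots> = (\<integral>\<omega>\<in>A. f (X \<omega>, Y \<omega>) \<partial>M)"
        unfolding set_lebesgue_integral_def
        by (rule Bochner_Integration.integral_cong) (auto simp: A spaceL indicator_def)
      finally show ?thesis ..
    qed
    show "(\<integral>\<omega>\<in>A. Y \<omega> $ i \<partial>M) = (\<integral>\<omega>\<in>A. h (X \<omega>, Y \<omega>) \<partial>M)"
      using G.real_cond_exp_intA[OF sndL BG] tr[OF snd_i] tr[OF hm] by (simp add: h_def)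
  qed
  then show ?thesis
    by (simp add: cond_exp_coord_def h_def)
qed

lemma integrable_coordinates_law:
  fixes X Y :: "'w \<Rightarrow> real ^ 'n"
  assumes "prob_space M" and X: "integrable M X" and Y: "integrable M Y"
  defines "L \<equiv> distr M (borel \<Otimes>\<^sub>M borel) (\<lambda>\<omega>. (X \<omega>, Y \<omega>))"
  shows "prob_space L" "integrable L fst" "integrable L snd"
    and "\<And>i. cond_exp_coord L fst snd i \<in> borel_measurable (borel \<Otimes>\<^sub>M borel)"
    and "distr L (borel \<Otimes>\<^sub>M borel) (\<lambda>p. (fst p, snd p)) = L"
proof -
  interpret prob_space M by fact
  have [measurable]: "X \<in> borel_measurable M" "Y \<in> borel_measurable M"
    using X Y by auto
  have setsL: "sets L = sets (borel \<Otimes>\<^sub>M borel)" by (simp add: L_def)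
  show "prob_space L" unfolding L_def by (rule prob_space_distr) measurable
  show "integrable L fst" "integrable L snd"
    unfolding L_def using X Y by (subst integrable_distr_eq; simp)+
  show "cond_exp_coord L fst snd i \<in> borel_measurable (borel \<Otimes>\<^sub>M borel)" for i
    using borel_measurable_cond_exp2[of L "vimage_algebra (space L) fst borel" "\<lambda>p. snd p $ i"]
    by (simp add: cond_exp_coord_def setsL cong: measurable_cong_sets)
  show "distr L (borel \<Otimes>\<^sub>M borel) (\<lambda>p. (fst p, snd p)) = L"
    by (simp add: distr_id2 setsL)
qed

lemma martingale_laws_I:
  fixes X Y :: "'w \<Rightarrow> real ^ 'n"
  assumes mart: "martingale_pair M X Y"
  shows "distr M (borel \<Otimes>\<^sub>M borel) (\<lambda>\<omega>. (X \<omega>, Y \<omega>)) \<in> martingale_laws"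
proof -
  let ?L = "distr M (borel \<Otimes>\<^sub>M borel) (\<lambda>\<omega>. (X \<omega>, Y \<omega>))"
  have M: "prob_space M" "integrable M X" "integrable M Y"
    and eq: "AE \<omega> in M. \<forall>i. cond_exp_coord M X Y i \<omega> = X \<omega> $ i"
    using mart by (auto simp: martingale_pair_def)
  note L = integrable_coordinates_law[OF M]
  have [measurable]: "X \<in> borel_measurable M" "Y \<in> borel_measurable M" using M by auto
  have "AE p in ?L. \<forall>i. cond_exp_coord ?L fst snd i p = fst p $ i"
  proof (subst AE_all_countable, rule allI)
    fix i
    have [measurable]: "(\<lambda>p :: (real ^ 'n) \<times> (real ^ 'n). fst p $ i) \<in> borel_measurable (borel \<Otimes>\<^sub>M borel)"
      by (rule measurable_compose[OF measurable_fst])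
        (intro borel_measurable_continuous_onI continuous_intros)
    note [measurable] = L(4)[of i]
    have "AE \<omega> in M. cond_exp_coord ?L fst snd i (X \<omega>, Y \<omega>) = X \<omega> $ i"
      using cond_exp_coord_distr[OF M, of i] eq by eventually_elim simp
    then show "AE p in ?L. cond_exp_coord ?L fst snd i p = fst p $ i"
      by (subst AE_distr_iff) auto
  qed
  with L have "martingale_pair ?L fst snd" by (simp add: martingale_pair_def)
  moreover have "?L = distr ?L (borel \<Otimes>\<^sub>M borel) (\<lambda>p. (fst p, snd p))"
    using L(5) by (rule sym)
  ultimately show ?thesis
    unfolding martingale_laws_def by blast
qed

lemma submartingale_laws_I:
  fixes X Y :: "'w \<Rightarrow> real ^ 'n"
  assumes mart: "submartingale_pair M X Y"
  shows "distr M (borel \<Otimes>\<^sub>M borel) (\<lambda>\<omega>. (X \<omega>, Y \<omega>)) \<in> submartingale_laws"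
proof -
  let ?L = "distr M (borel \<Otimes>\<^sub>M borel) (\<lambda>\<omega>. (X \<omega>, Y \<omega>))"
  have M: "prob_space M" "integrable M X" "integrable M Y"
    and eq: "AE \<omega> in M. \<forall>i. cond_exp_coord M X Y i \<omega> \<ge> X \<omega> $ i"
    using mart by (auto simp: submartingale_pair_def)
  note L = integrable_coordinates_law[OF M]
  have [measurable]: "X \<in> borel_measurable M" "Y \<in> borel_measurable M" using M by auto
  have "AE p in ?L. \<forall>i. cond_exp_coord ?L fst snd i p \<ge> fst p $ i"
  proof (subst AE_all_countable, rule allI)
    fix i
    have [measurable]: "(\<lambda>p :: (real ^ 'n) \<times> (real ^ 'n). fst p $ i) \<in> borel_measurable (borel \<Otimes>\<^sub>M borel)"
      by (rule measurable_compose[OF measurable_fst])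
        (intro borel_measurable_continuous_onI continuous_intros)
    note [measurable] = L(4)[of i]
    have "AE \<omega> in M. cond_exp_coord ?L fst snd i (X \<omega>, Y \<omega>) \<ge> X \<omega> $ i"
      using cond_exp_coord_distr[OF M, of i] eq by eventually_elim metis
    then show "AE p in ?L. cond_exp_coord ?L fst snd i p \<ge> fst p $ i"
      by (subst AE_distr_iff) auto
  qed
  with L have "submartingale_pair ?L fst snd" by (simp add: submartingale_pair_def)
  moreover have "?L = distr ?L (borel \<Otimes>\<^sub>M borel) (\<lambda>p. (fst p, snd p))"
    using L(5) by (rule sym)
  ultimately show ?thesis
    unfolding submartingale_laws_def by blast
qed

end

theory Submission
  imports Defs
begin

text \<open>
  Both statements are instances of one about a convex cone \<open>C\<close>: the drift \<open>E[Y - X | X]\<close> of a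
  coupling lies in \<open>C\<close> (\<open>C = {0}\<close> for martingales, the nonnegative orthant for submartingales), and
  the order tests convex \<open>\<phi> \<ge> 0\<close> that increase in the directions of \<open>C\<close>.

  A coupling with drift in \<open>C\<close> gives the order because \<open>\<phi>\<close> is a countable supremum of affine
  functions, whose slopes lie in the dual cone.

  Conversely, let \<open>X\<close> move to \<open>X + V\<close>, where \<open>V\<close> has finite support and mean in \<open>C\<close>. Countably many
  such laws of \<open>V\<close> are dense, and a countable family of kernels \<open>T\<close> built from them is enough: among
  finitely many moves, take the one that is best for a rational combination of test functions, and
  average such kernels. If no \<open>P T\<close> were close to \<open>Q\<close> on the first test functions, a separating
  combination \<open>g\<close> would exist; its supremum \<open>G\<close> over all moves is concave, so that
  \<open>\<integral> G dP \<ge> \<integral> G dQ \<ge> \<integral> g dQ\<close> contradicts the separation. The norm is one of the test functions,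
  which makes the second marginals uniformly integrable.

  Because the family of kernels does not depend on \<open>\<theta>\<close>, the first sufficiently good kernel is a
  measurable choice. A measurable choice of cluster points of the integrals of countably many
  functions, together with Prokhorov's theorem, then gives a measurable limit.
\<close>

section \<open>Separation and measurable cluster points\<close>

text \<open>The obstacle is measurability in \<theta>: compactness yields subsequences that depend
  on \<theta> in an uncontrolled way. Therefore only numbers are selected measurably. The integrals
  of countably many test functions determine a probability measure; once their limits are fixed as
  measurable functions of \<theta>, the subsequence and the limit measure may be chosen arbitrarily
  for each \<theta>, and the result is still a kernel.

  A countable family of kernels cannot be convex. It is closed under averages of two members, so the
  separation is carried out for sets closed under midpoints only.

  The norm, the one unbounded test function, is treated one-sidedly: its integral under the
  approximating second marginal is bounded from above only. Fatou's lemma makes this enough in the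
  limit. On the dual side it fixes the sign of the coefficient of the norm in \<open>g\<close>, so
  that \<open>g \<le> c\<close> for a constant \<open>c\<close> and \<open>c - G\<close> is a
  finite, nonnegative, convex function that increases along \<open>C\<close>, hence a test function
  of the order.\<close>

lemma countable_dense_subset:
  fixes S :: "'a::second_countable_topology set"
  obtains T where "countable T" "T \<subseteq> S" "\<And>U. open U \<Longrightarrow> U \<inter> S \<noteq> {} \<Longrightarrow> U \<inter> T \<noteq> {}"
proof -
  obtain B :: "'a set set" where B: "countable B" "topological_basis B"
    using ex_countable_basis by blast
  define f where "f b = (SOME x. x \<in> b \<inter> S)" for b
  have f: "f b \<in> b \<inter> S" if "b \<inter> S \<noteq> {}" for b
    using that unfolding f_def by (metis all_not_in_conv someI_ex)
  show thesis
  proof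
    show "countable (f ` {b \<in> B. b \<inter> S \<noteq> {}})" using B by auto
    show "f ` {b \<in> B. b \<inter> S \<noteq> {}} \<subseteq> S" using f by auto
    fix U assume U: "open U" "U \<inter> S \<noteq> {}"
    then obtain x where x: "x \<in> U" "x \<in> S" by blast
    then obtain b where "b \<in> B" "x \<in> b" "b \<subseteq> U"
      using topological_basisE[OF B(2) U(1)] by metis
    then show "U \<inter> f ` {b \<in> B. b \<inter> S \<noteq> {}} \<noteq> {}" using f x by blast
  qed
qed

text \<open>Projection onto a closed convex set, done by hand: a minimizing sequence for the
  distance to \<open>q\<close> converges in the first \<open>n\<close> coordinates to a nearest
  point \<open>p\<close> of the closure, and \<open>l = q - p\<close> is the normal. The gap is the
  squared distance, hence at least \<open>e\<close>. Coordinates from \<open>n\<close> on are never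
  compared.\<close>

lemma separate_midpoint_family:
  fixes X :: "(nat \<Rightarrow> real) set" and q :: "nat \<Rightarrow> real"
  assumes ne: "X \<noteq> {}"
    and mid: "\<And>v w. v \<in> X \<Longrightarrow> w \<in> X \<Longrightarrow> (\<lambda>j. (v j + w j) / 2) \<in> X"
    and far: "\<And>v. v \<in> X \<Longrightarrow> e \<le> (\<Sum>j<n. (v j - q j)\<^sup>2)"
  obtains l where "\<And>v. v \<in> X \<Longrightarrow> (\<Sum>j<n. l j * v j) \<le> (\<Sum>j<n. l j * q j) - e"
proof -
  define D where "D v = (\<Sum>j<n. (v j - q j)\<^sup>2)" for v :: "nat \<Rightarrow> real"
  define d where "d = Inf (D ` X)"
  have bdd: "bdd_below (D ` X)" using far unfolding D_def by (auto intro!: bdd_belowI2)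
  have dle: "d \<le> D v" if "v \<in> X" for v unfolding d_def using bdd that by (auto intro: cINF_lower)
  have ed: "e \<le> d" unfolding d_def using far ne by (auto simp: D_def intro!: cINF_greatest)
  have "\<exists>v\<in>X. D v < d + 1 / real (Suc k)" for k
    using cInf_lessD[of "D ` X" "d + 1 / real (Suc k)"] ne by (auto simp: d_def)
  then obtain s where s: "\<And>k. s k \<in> X" "\<And>k. D (s k) < d + 1 / real (Suc k)" by metis
  \<comment> \<open>Parallelogram identity; the midpoint of \<open>s k\<close> and
    \<open>s m\<close> lies in \<open>X\<close>, so its squared distance is at least
    \<open>d\<close>. Hence minimizing sequences are Cauchy.\<close>
  have par: "(\<Sum>j<n. (s k j - s m j)\<^sup>2) \<le> 2 / real (Suc k) + 2 / real (Suc m)" for k m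
  proof -
    have "(\<Sum>j<n. (s k j - s m j)\<^sup>2)
        = 2 * D (s k) + 2 * D (s m) - 4 * D (\<lambda>j. (s k j + s m j) / 2)"
      unfolding D_def sum_distrib_left sum.distrib[symmetric] sum_subtractf[symmetric]
      by (intro sum.cong) (auto simp: power2_eq_square field_simps)
    then show ?thesis using dle[OF mid[OF s(1)[of k] s(1)[of m]]] s(2)[of k] s(2)[of m] by simp
  qed
  have "Cauchy (\<lambda>k. s k j)" if j: "j < n" for j
  proof (rule metric_CauchyI)
    fix r :: real assume r: "0 < r"
    obtain N where N: "4 / r\<^sup>2 < real N" using reals_Archimedean2 by blast
    have N': "2 / real (Suc k) < r\<^sup>2 / 2" if "N \<le> k" for k
    proof -
      have "4 < real N * r\<^sup>2" using N r by (simp add: field_simps)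
      also have "\<dots> \<le> real (Suc k) * r\<^sup>2" using that by (intro mult_right_mono) auto
      finally show ?thesis by (simp add: field_simps)
    qed
    have "dist (s k j) (s m j) < r" if "N \<le> k" "N \<le> m" for k m
    proof -
      have "(s k j - s m j)\<^sup>2 \<le> (\<Sum>j<n. (s k j - s m j)\<^sup>2)"
        using j by (intro member_le_sum) auto
      then have "(s k j - s m j)\<^sup>2 < r\<^sup>2"
        using par[of k m] N'[OF that(1)] N'[OF that(2)] by linarith
      then have "\<bar>s k j - s m j\<bar>\<^sup>2 < r\<^sup>2" by simp
      then show ?thesis using r power2_less_imp_less unfolding dist_real_def by fastforce
    qed
    then show "\<exists>M. \<forall>m\<ge>M. \<forall>k\<ge>M. dist (s m j) (s k j) < r" by blast
  qed
  then have "\<forall>j. \<exists>p. j < n \<longrightarrow> (\<lambda>k. s k j) \<longlonglongrightarrow> p"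
    by (metis Cauchy_convergent convergent_def)
  then obtain p where p: "\<And>j. j < n \<Longrightarrow> (\<lambda>k. s k j) \<longlonglongrightarrow> p j" by metis
  have Dlim: "(\<lambda>k. D (s k)) \<longlonglongrightarrow> D p"
    unfolding D_def by (intro tendsto_sum tendsto_power tendsto_diff p tendsto_const) auto
  have "(\<lambda>k. D (s k)) \<longlonglongrightarrow> d"
  proof (rule tendsto_sandwich[OF _ _ tendsto_const])
    show "(\<lambda>k. d + 1 / real (Suc k)) \<longlonglongrightarrow> d"
      using tendsto_add[OF tendsto_const LIMSEQ_Suc[OF lim_1_over_n], of d] by simp
  qed (use s(1) dle in \<open>auto intro!: always_eventually less_imp_le s(2) simp del: of_nat_Suc\<close>)
  with Dlim have Dp: "D p = d" using LIMSEQ_unique by blast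
  define l where "l j = q j - p j" for j
  show thesis
  proof
    fix w assume w: "w \<in> X"
    \<comment> \<open>Repeated halving towards \<open>s k\<close>: midpoints give the fractions
      \<open>1 / 2 ^ i\<close> of the segment, and these suffice for a derivative at 0.\<close>
    have X: "(\<lambda>j. s k j + (w j - s k j) / 2 ^ i) \<in> X" for k i
    proof (induction i)
      case (Suc i)
      have "(\<lambda>j. (s k j + (s k j + (w j - s k j) / 2 ^ i)) / 2) \<in> X" by (rule mid[OF s(1) Suc])
      then show ?case by (simp add: field_simps)
    qed (simp add: w)
    \<comment> \<open>Minimality of \<open>p\<close> along the segment to \<open>w\<close>, expanded
      to second order in \<open>t = (1/2) ^ i\<close> and divided by \<open>t\<close>. Letting
      \<open>i\<close> grow leaves the first-order condition.\<close>
    have step: "0 \<le> 2 * (\<Sum>j<n. (p j - q j) * (w j - p j)) + (\<Sum>j<n. (w j - p j)\<^sup>2) * (1/2) ^ i" for i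
    proof -
      define t where "t = (1/2::real) ^ i"
      have t: "0 < t" by (simp add: t_def)
      have "(\<lambda>k. D (\<lambda>j. s k j + (w j - s k j) / 2 ^ i)) \<longlonglongrightarrow> D (\<lambda>j. p j + (w j - p j) / 2 ^ i)"
        unfolding D_def by (intro tendsto_intros p) auto
      then have "d \<le> D (\<lambda>j. p j + (w j - p j) / 2 ^ i)"
        by (rule LIMSEQ_le_const) (use dle X in blast)
      also have "\<dots> = D p + t * (2 * (\<Sum>j<n. (p j - q j) * (w j - p j)) + (\<Sum>j<n. (w j - p j)\<^sup>2) * t)"
        unfolding D_def sum_distrib_left sum_distrib_right sum.distrib[symmetric]
        by (intro sum.cong) (auto simp: t_def power2_eq_square power_one_over field_simps)
      finally have "0 \<le> t * (2 * (\<Sum>j<n. (p j - q j) * (w j - p j)) + (\<Sum>j<n. (w j - p j)\<^sup>2) * t)"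
        using Dp by simp
      then show ?thesis using t unfolding t_def by (simp only: zero_le_mult_iff) linarith
    qed
    have lim: "(\<lambda>i. 2 * (\<Sum>j<n. (p j - q j) * (w j - p j)) + (\<Sum>j<n. (w j - p j)\<^sup>2) * (1/2) ^ i)
      \<longlonglongrightarrow> 2 * (\<Sum>j<n. (p j - q j) * (w j - p j)) + (\<Sum>j<n. (w j - p j)\<^sup>2) * 0"
      by (intro tendsto_intros LIMSEQ_power_zero) auto
    have "0 \<le> 2 * (\<Sum>j<n. (p j - q j) * (w j - p j)) + (\<Sum>j<n. (w j - p j)\<^sup>2) * 0"
      by (rule LIMSEQ_le_const[OF lim]) (use step in blast)
    then have "0 \<le> (\<Sum>j<n. (p j - q j) * (w j - p j))" by simp
    \<comment> \<open>Since \<open>l = q - p\<close>, the left side is \<open>l . p - l . w\<close>,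
      and \<open>l . p = l . q - D p\<close>.\<close>
    moreover have "(\<Sum>j<n. (p j - q j) * (w j - p j)) = (\<Sum>j<n. l j * q j) - D p - (\<Sum>j<n. l j * w j)"
      unfolding D_def l_def sum_subtractf[symmetric]
      by (intro sum.cong) (auto simp: power2_eq_square algebra_simps)
    ultimately show "(\<Sum>j<n. l j * w j) \<le> (\<Sum>j<n. l j * q j) - e" using Dp ed by linarith
  qed
qed

text \<open>
  Stage \<open>k\<close> keeps the indices whose \<open>k\<close>-th code is the least one that occurs infinitely often among
  the indices kept so far. This selects a cluster point by countable operations only.
\<close>

primrec nested_cell :: "(nat \<Rightarrow> nat \<Rightarrow> 's \<Rightarrow> nat) \<Rightarrow> nat \<Rightarrow> nat \<Rightarrow> 's \<Rightarrow> bool" where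
  "nested_cell code 0 n \<theta> = True"
| "nested_cell code (Suc k) n \<theta> =
     (nested_cell code k n \<theta> \<and>
      code k n \<theta> = (LEAST c. \<forall>N. \<exists>m\<ge>N. nested_cell code k m \<theta> \<and> code k m \<theta> = c))"

text \<open>Stage \<open>prod_encode (l, r)\<close> rounds \<open>x l\<close> to the grid of mesh
  \<open>1 / Suc r\<close>. All indices kept there have \<open>x l\<close> within
  \<open>1 / Suc r\<close> of the grid value \<open>\<eta> l r\<close>, so any increasing sequence
  that runs through the stages converges, and its limit equals that of \<open>\<eta> l r\<close> as
  \<open>r\<close> grows. The latter is a limit of measurable functions, whatever the sequence of
  indices is.\<close>

lemma measurable_cluster_point:
  fixes x :: "nat \<Rightarrow> nat \<Rightarrow> 's \<Rightarrow> real"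
  assumes meas [measurable]: "\<And>l n. x l n \<in> borel_measurable S"
    and x01: "\<And>l n \<theta>. \<theta> \<in> space S \<Longrightarrow> 0 \<le> x l n \<theta> \<and> x l n \<theta> \<le> 1"
  obtains \<xi> where "\<And>l::nat. \<xi> l \<in> borel_measurable S"
    and "\<And>\<theta>. \<theta> \<in> space S \<Longrightarrow> \<exists>r. strict_mono r \<and> (\<forall>l. (\<lambda>k. x l (r k) \<theta>) \<longlonglongrightarrow> \<xi> l \<theta>)"
proof -
  define code where
    "code i n \<theta> = nat \<lfloor>x (fst (prod_decode i)) n \<theta> * real (Suc (snd (prod_decode i)))\<rfloor>" for i n \<theta>
  define A where "A = nested_cell code"
  define c where "c k \<theta> = (LEAST c. \<forall>N. \<exists>m\<ge>N. A k m \<theta> \<and> code k m \<theta> = c)" for k \<theta>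
  have A_Suc: "A (Suc k) n \<theta> \<longleftrightarrow> A k n \<theta> \<and> code k n \<theta> = c k \<theta>" for k n \<theta>
    by (simp add: A_def c_def)
  have [measurable]: "code i n \<in> S \<rightarrow>\<^sub>M count_space UNIV" for i n
    unfolding code_def by measurable
  have cA [measurable]: "Measurable.pred S (A k n)" for k n
  proof (induction k arbitrary: n)
    case (Suc k)
    note Suc[measurable]
    have [measurable]: "c k \<in> S \<rightarrow>\<^sub>M count_space UNIV"
      unfolding c_def by measurable
    \<comment> \<open>The equality of two functions with values in \<open>nat\<close> is written as
      a countable union over the common value, which shows its measurability.\<close>
    have eq: "A (Suc k) n = (\<lambda>\<theta>. A k n \<theta> \<and> (\<exists>v. code k n \<theta> = v \<and> c k \<theta> = v))"
      by (auto simp: fun_eq_iff A_Suc)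
    show ?case unfolding eq by measurable
  next
    case 0
    have "A 0 n = (\<lambda>_. True)" by (simp add: A_def fun_eq_iff)
    then show ?case by simp
  qed
  have [measurable]: "c k \<in> S \<rightarrow>\<^sub>M count_space UNIV" for k
    unfolding c_def by measurable
  \<comment> \<open>Values in \<open>[0, 1]\<close> have finitely many codes, so by the pigeonhole
    principle some code recurs infinitely often. Thus the \<open>LEAST\<close> in \<open>c\<close>
    is attained and no stage runs empty.\<close>
  have inf: "\<exists>m\<ge>N. A k m \<theta>" if \<theta>: "\<theta> \<in> space S" for N k \<theta>
  proof (induction k arbitrary: N)
    case (Suc k)
    have "infinite {m. A k m \<theta>}"
      unfolding infinite_nat_iff_unbounded_le using Suc by auto
    moreover have "finite ((\<lambda>m. code k m \<theta>) ` {m. A k m \<theta>})"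
    proof (rule finite_subset)
      show "(\<lambda>m. code k m \<theta>) ` {m. A k m \<theta>} \<subseteq> {..Suc (snd (prod_decode k))}"
      proof safe
        fix m
        have "x (fst (prod_decode k)) m \<theta> * real (Suc (snd (prod_decode k)))
            \<le> 1 * real (Suc (snd (prod_decode k)))"
          using x01[OF \<theta>] by (intro mult_right_mono) auto
        then have "nat \<lfloor>x (fst (prod_decode k)) m \<theta> * real (Suc (snd (prod_decode k)))\<rfloor>
            \<le> nat \<lfloor>real (Suc (snd (prod_decode k)))\<rfloor>"
          by (intro nat_mono floor_mono) simp
        then show "code k m \<theta> \<le> Suc (snd (prod_decode k))" by (simp add: code_def)
      qed
    qed simp
    ultimately obtain c0 where "infinite {m \<in> {m. A k m \<theta>}. code k m \<theta> = c0}"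
      using pigeonhole_infinite[of "{m. A k m \<theta>}" "\<lambda>m. code k m \<theta>"] by auto
    then have "\<forall>N. \<exists>m\<ge>N. A k m \<theta> \<and> code k m \<theta> = c0"
      unfolding infinite_nat_iff_unbounded_le by auto
    then have "\<forall>N. \<exists>m\<ge>N. A k m \<theta> \<and> code k m \<theta> = c k \<theta>"
      unfolding c_def by (rule LeastI)
    then show ?case by (auto simp: A_Suc)
  qed (auto simp: A_def)
  have A_mono: "A k' n \<theta> \<Longrightarrow> k \<le> k' \<Longrightarrow> A k n \<theta>" for k k' n \<theta>
    by (induction k') (auto simp: A_Suc le_Suc_eq)
  define \<eta> where "\<eta> l r \<theta> = real (c (prod_encode (l, r)) \<theta>) / real (Suc r)" for l r \<theta>
  define \<xi> where "\<xi> l \<theta> = lim (\<lambda>r. \<eta> l r \<theta>)" for l \<theta>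
  have close: "\<bar>x l n \<theta> - \<eta> l r \<theta>\<bar> \<le> 1 / real (Suc r)"
    if \<theta>: "\<theta> \<in> space S" and n: "A (Suc (prod_encode (l, r))) n \<theta>" for l r n \<theta>
  proof -
    define y where "y = x l n \<theta> * real (Suc r)"
    have "0 \<le> y" using x01[OF \<theta>, of l n] by (simp add: y_def)
    have "real (c (prod_encode (l, r)) \<theta>) = real (nat \<lfloor>y\<rfloor>)"
      using n by (simp add: A_Suc code_def y_def)
    also have "\<dots> = of_int \<lfloor>y\<rfloor>" using \<open>0 \<le> y\<close> by simp
    finally have "\<bar>y - real (c (prod_encode (l, r)) \<theta>)\<bar> \<le> 1" by linarith
    moreover have "x l n \<theta> - \<eta> l r \<theta> = (y - real (c (prod_encode (l, r)) \<theta>)) / real (Suc r)"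
      by (simp add: \<eta>_def y_def field_simps del: of_nat_Suc)
    ultimately show ?thesis by (simp add: abs_divide divide_right_mono del: of_nat_Suc)
  qed
  show thesis
  proof
    show "\<xi> l \<in> borel_measurable S" for l
      unfolding \<xi>_def \<eta>_def by measurable
    fix \<theta> assume \<theta>: "\<theta> \<in> space S"
    define g where "g k N = (SOME m. N \<le> m \<and> A k m \<theta>)" for k N
    have g: "N \<le> g k N" "A k (g k N) \<theta>" for k N
      using someI_ex[OF inf[OF \<theta>, of N k, unfolded Bex_def]] by (auto simp: g_def)
    \<comment> \<open>Diagonal sequence: \<open>r k\<close> lies in stage \<open>k\<close>, hence in
      all earlier stages.\<close>
    define r where "r = rec_nat (g 0 0) (\<lambda>k rk. g (Suc k) (Suc rk))"
    have r: "r (Suc k) = g (Suc k) (Suc (r k))" for k by (simp add: r_def)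
    have sm: "strict_mono r"
      unfolding strict_mono_Suc_iff r using g(1) Suc_le_lessD by blast
    have rA: "A k (r k) \<theta>" for k by (cases k) (auto simp: r g, simp add: r_def g)
    have cl: "\<bar>x l (r k) \<theta> - \<eta> l i \<theta>\<bar> \<le> 1 / real (Suc i)" if "Suc (prod_encode (l, i)) \<le> k" for l i k
      using close[OF \<theta>] A_mono[OF rA that] by blast
    have Cau: "Cauchy (\<lambda>k. x l (r k) \<theta>)" for l
    proof (rule metric_CauchyI)
      fix e :: real assume "0 < e"
      then obtain i where i: "1 / real (Suc i) < e / 2"
        using reals_Archimedean[of "e/2"] by (auto simp: inverse_eq_divide)
      show "\<exists>M. \<forall>m\<ge>M. \<forall>n\<ge>M. dist (x l (r m) \<theta>) (x l (r n) \<theta>) < e"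
      proof (intro exI allI impI)
        fix m n assume "Suc (prod_encode (l, i)) \<le> m" "Suc (prod_encode (l, i)) \<le> n"
        then show "dist (x l (r m) \<theta>) (x l (r n) \<theta>) < e"
          using cl[of l i m] cl[of l i n] i unfolding dist_real_def by linarith
      qed
    qed
    have "(\<lambda>k. x l (r k) \<theta>) \<longlonglongrightarrow> \<xi> l \<theta>" for l
    proof -
      obtain L where L: "(\<lambda>k. x l (r k) \<theta>) \<longlonglongrightarrow> L"
        using Cau[of l] Cauchy_convergent convergent_def by blast
      have le: "\<bar>L - \<eta> l i \<theta>\<bar> \<le> 1 / real (Suc i)" for i
      proof (rule LIMSEQ_le_const2)
        show "(\<lambda>k. \<bar>x l (r k) \<theta> - \<eta> l i \<theta>\<bar>) \<longlonglongrightarrow> \<bar>L - \<eta> l i \<theta>\<bar>"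
          by (intro tendsto_intros L)
      qed (use cl in blast)
      have "(\<lambda>i. \<eta> l i \<theta> - L) \<longlonglongrightarrow> 0"
      proof (rule Lim_null_comparison)
        show "(\<lambda>i. 1 / real (Suc i)) \<longlonglongrightarrow> 0" by (fact LIMSEQ_Suc[OF lim_1_over_n])
        show "\<forall>\<^sub>F i in sequentially. norm (\<eta> l i \<theta> - L) \<le> 1 / real (Suc i)"
          by (rule always_eventually) (use le in \<open>simp add: abs_minus_commute[of L] del: of_nat_Suc\<close>)
      qed
      then have "(\<lambda>i. \<eta> l i \<theta>) \<longlonglongrightarrow> L" by (rule LIM_zero_cancel)
      then show ?thesis using L by (simp add: \<xi>_def limI)
    qed
    then show "\<exists>r. strict_mono r \<and> (\<forall>l. (\<lambda>k. x l (r k) \<theta>) \<longlonglongrightarrow> \<xi> l \<theta>)" using sm by blast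
  qed
qed

section \<open>Countable families of test functions\<close>

text \<open>Continuous functions that tend to the indicator of an open \<open>U\<close>. The case
  \<open>UNIV\<close> is separate because \<open>infdist\<close> to the empty set is 0.\<close>

definition bump :: "'a::metric_space set \<Rightarrow> nat \<Rightarrow> 'a \<Rightarrow> real" where
  "bump U k z = (if U = UNIV then 1 else min 1 (real k * infdist z (- U)))"

lemma bump_range: "0 \<le> bump U k z" "bump U k z \<le> 1"
  by (auto simp: bump_def infdist_nonneg)

lemma continuous_on_bump [continuous_intros]: "continuous_on A (bump U k)"
  unfolding bump_def[abs_def] by (cases "U = UNIV") (auto intro!: continuous_intros)

lemma measurable_bump [measurable]:
  "bump (U :: 'a::metric_space set) k \<in> borel_measurable borel"
  by (intro borel_measurable_continuous_onI continuous_on_bump)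

lemma tendsto_bump:
  assumes "open U"
  shows "(\<lambda>k. bump U k z) \<longlonglongrightarrow> indicator U z"
proof (cases "U = UNIV \<or> z \<notin> U")
  case True
  then have "bump U k z = indicator U z" for k by (auto simp: bump_def)
  then show ?thesis by simp
next
  case False
  then have "closed (- U)" "- U \<noteq> {}" "z \<notin> - U" using assms by auto
  then have pos: "0 < infdist z (- U)"
    by (rule infdist_pos_not_in_closed)
  obtain N where "1 / infdist z (- U) < real N" using reals_Archimedean2 by blast
  then have "1 \<le> real k * infdist z (- U)" if "N \<le> k" for k
  proof -
    have "1 \<le> real N * infdist z (- U)"
      using \<open>1 / infdist z (- U) < real N\<close> pos by (simp add: field_simps)
    also have "\<dots> \<le> real k * infdist z (- U)" using that pos by (intro mult_right_mono) auto
    finally show ?thesis .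
  qed
  then have "bump U k z = indicator U z" if "N \<le> k" for k
    using False that by (auto simp: bump_def)
  then have "eventually (\<lambda>k. bump U k z = indicator U z) sequentially"
    by (auto simp: eventually_sequentially)
  then show ?thesis by (rule tendsto_eventually)
qed

lemma integral_bump_tendsto:
  fixes M :: "'a::metric_space measure"
  assumes "prob_space M" "sets M = sets borel" "open U"
  shows "(\<lambda>k. \<integral>z. bump U k z \<partial>M) \<longlonglongrightarrow> measure M U"
proof -
  interpret prob_space M by fact
  note assms(2)[measurable_cong]
  have [measurable]: "U \<in> sets borel" using assms by auto
  have "(\<lambda>k. \<integral>z. bump U k z \<partial>M) \<longlonglongrightarrow> (\<integral>z. indicator U z \<partial>M)"
    by (rule integral_dominated_convergence[where w="\<lambda>_. 1"])
      (auto simp: tendsto_bump assms bump_range)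
  also have "(\<integral>z. indicator U z \<partial>M) = measure M U"
    using assms by simp
  finally show ?thesis .
qed

text \<open>Finite intersections of a countable basis. The empty intersection contributes
  \<open>UNIV\<close>, which the uniqueness theorem for measures needs as an exhausting set.\<close>

lemma Int_stable_open_generator:
  obtains U :: "nat \<Rightarrow> 'a::second_countable_topology set"
  where "\<And>i. open (U i)" "Int_stable (range U)" "sets borel = sigma_sets UNIV (range U)"
    "UNIV \<in> range U"
proof -
  obtain B :: "'a set set" where B: "countable B" "topological_basis B"
    using ex_countable_basis by blast
  define G where "G = Inter ` {F. finite F \<and> F \<subseteq> B}"
  have "countable G" unfolding G_def
    using countable_Collect_finite_subset[OF B(1)] by (auto simp: conj_commute)
  moreover have ne: "UNIV \<in> G" unfolding G_def by (rule image_eqI[of _ _ "{}"]) auto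
  ultimately have "range (from_nat_into G) = G" by (intro range_from_nat_into) auto
  then obtain U :: "nat \<Rightarrow> 'a set" where U: "range U = G" by (rule that)
  have op: "open g" if "g \<in> G" for g
    using that topological_basis_open[OF B(2)] unfolding G_def by (auto intro!: open_Inter)
  have BG: "B \<subseteq> G"
  proof
    fix b assume "b \<in> B"
    then show "b \<in> G" unfolding G_def by (intro image_eqI[of _ _ "{b}"]) auto
  qed
  show thesis
  proof
    show "open (U i)" for i using op U by blast
    show "Int_stable (range U)" unfolding U
    proof (rule Int_stableI)
      fix a b assume "a \<in> G" "b \<in> G"
      then obtain E F where "finite E" "E \<subseteq> B" "finite F" "F \<subseteq> B" "a = \<Inter>E" "b = \<Inter>F"
        unfolding G_def by auto
      then show "a \<inter> b \<in> G" unfolding G_def by (intro image_eqI[of _ _ "E \<union> F"]) auto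
    qed
    show "sets borel = sigma_sets UNIV (range U)"
    proof
      have "sets (borel :: 'a measure) = sigma_sets UNIV B"
        by (subst borel_eq_countable_basis[OF B]) simp
      also have "\<dots> \<subseteq> sigma_sets UNIV G" by (rule sigma_sets_mono') (use BG in auto)
      finally show "sets borel \<subseteq> sigma_sets UNIV (range U)" using U by simp
      have "sigma_sets (space borel) (range U) \<subseteq> sets borel"
        by (rule sets.sigma_sets_subset) (use op U in auto)
      then show "sigma_sets UNIV (range U) \<subseteq> sets borel" by simp
    qed
    show "UNIV \<in> range U" using ne U by simp
  qed
qed

text \<open>The integrals of the bumps converge to the measures of the sets of a countable generator
  closed under intersections. These values fix the measure, and their measurability in \<theta>
  makes a family of measures a kernel. The first property later identifies the marginals of a limit,
  the second certifies the measurability of the coupling.\<close>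

lemma test_functions:
  obtains t :: "nat \<Rightarrow> 'a::{metric_space, second_countable_topology} \<Rightarrow> real"
  where "\<And>l. continuous_on UNIV (t l)" "\<And>l z. 0 \<le> t l z" "\<And>l z. t l z \<le> 1"
    and "\<forall>M N. prob_space M \<longrightarrow> prob_space N \<longrightarrow> sets M = sets borel \<longrightarrow> sets N = sets borel \<longrightarrow>
           (\<forall>l. (\<integral>z. t l z \<partial>M) = (\<integral>z. t l z \<partial>N)) \<longrightarrow> M = N"
    and "\<forall>(S :: 's measure) K. (\<forall>\<theta>\<in>space S. prob_space (K \<theta>) \<and> sets (K \<theta>) = sets borel) \<longrightarrow>
           (\<forall>l. (\<lambda>\<theta>. \<integral>z. t l z \<partial>K \<theta>) \<in> borel_measurable S) \<longrightarrow> K \<in> S \<rightarrow>\<^sub>M prob_algebra borel"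
proof -
  obtain U :: "nat \<Rightarrow> 'a set" where U: "\<And>i. open (U i)" "Int_stable (range U)"
    "sets borel = sigma_sets UNIV (range U)" "UNIV \<in> range U"
    using Int_stable_open_generator by blast
  define t where "t l = bump (U (fst (prod_decode l))) (snd (prod_decode l))" for l
  have t: "bump (U i) k = t (prod_encode (i, k))" for i k by (simp add: t_def)
  show thesis
  proof
    show "continuous_on UNIV (t l)" "0 \<le> t l z" "t l z \<le> 1" for l z
      by (auto simp: t_def bump_range continuous_intros)
    have "M = N" if M: "prob_space M" "prob_space N" "sets M = sets borel" "sets N = sets borel"
      and eq: "\<And>l. (\<integral>z. t l z \<partial>M) = (\<integral>z. t l z \<partial>N)" for M N
    proof (rule measure_eqI_generator_eq[OF U(2), of UNIV])
      interpret M: prob_space M by fact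
      interpret N: prob_space N by fact
      have "measure M (U i) = measure N (U i)" for i
        using integral_bump_tendsto[OF M(1,3) U(1), of i] integral_bump_tendsto[OF M(2,4) U(1), of i]
        unfolding t eq by (rule LIMSEQ_unique)
      then show "emeasure M X = emeasure N X" if "X \<in> range U" for X
        using that by (auto simp: M.emeasure_eq_measure N.emeasure_eq_measure)
      show "range (\<lambda>_::nat. UNIV) \<subseteq> range U" using U(4) by auto
      show "emeasure M UNIV \<noteq> \<infinity>" for i :: nat by (simp add: M.emeasure_eq_measure)
    qed (use M U(3) in auto)
    then show "\<forall>M N. prob_space M \<longrightarrow> prob_space N \<longrightarrow> sets M = sets borel \<longrightarrow> sets N = sets borel \<longrightarrow>
        (\<forall>l. (\<integral>z. t l z \<partial>M) = (\<integral>z. t l z \<partial>N)) \<longrightarrow> M = N" by blast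
    have "K \<in> S \<rightarrow>\<^sub>M prob_algebra borel"
      if K: "\<And>\<theta>. \<theta> \<in> space S \<Longrightarrow> prob_space (K \<theta>) \<and> sets (K \<theta>) = sets borel"
        and m [measurable]: "\<And>l. (\<lambda>\<theta>. \<integral>z. t l z \<partial>K \<theta>) \<in> borel_measurable S"
      for S :: "'s measure" and K
    proof (rule measurable_prob_algebraI)
      have Ui: "(\<lambda>\<theta>. emeasure (K \<theta>) (U i)) \<in> borel_measurable S" for i
      proof -
        have "(\<lambda>\<theta>. measure (K \<theta>) (U i)) \<in> borel_measurable S"
          by (rule borel_measurable_LIMSEQ_real[where u="\<lambda>k \<theta>. \<integral>z. bump (U i) k z \<partial>K \<theta>"])
            (use K U(1) in \<open>auto simp: t[symmetric] intro!: integral_bump_tendsto, auto simp: t\<close>)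
        then have "(\<lambda>\<theta>. ennreal (measure (K \<theta>) (U i))) \<in> borel_measurable S" by simp
        also have "?this \<longleftrightarrow> ?thesis"
          by (intro measurable_cong)
            (use K in \<open>auto simp: finite_measure.emeasure_eq_measure prob_space.finite_measure\<close>)
        finally show ?thesis .
      qed
      show "K \<in> S \<rightarrow>\<^sub>M subprob_algebra borel"
      proof (rule measurable_subprob_algebra_generated[OF U(3) U(2)])
        show "(\<lambda>\<theta>. emeasure (K \<theta>) UNIV) \<in> borel_measurable S"
          using U(4) Ui by (metis imageE)
      qed (use K Ui in \<open>auto intro: prob_space_imp_subprob_space\<close>)
    qed (use K in auto)
    then show "\<forall>(S :: 's measure) K. (\<forall>\<theta>\<in>space S. prob_space (K \<theta>) \<and> sets (K \<theta>) = sets borel) \<longrightarrow>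
        (\<forall>l. (\<lambda>\<theta>. \<integral>z. t l z \<partial>K \<theta>) \<in> borel_measurable S) \<longrightarrow> K \<in> S \<rightarrow>\<^sub>M prob_algebra borel" by blast
  qed
qed

section \<open>Prokhorov's theorem under a moment bound\<close>

text \<open>The digits will be 0 or 1, in base 4 rather than 2: a tail then sums to at most a third
  of the unit, which leaves gaps between the values.\<close>

lemma quaternary_expansion:
  fixes b :: "nat \<Rightarrow> real"
  assumes b: "\<And>j. b j \<in> {0..1}"
  shows "summable (\<lambda>j. b j * (1/4) ^ Suc j)" "(\<Sum>j. b j * (1/4) ^ Suc j) \<in> {0..1/3}"
    "(\<Sum>j. b j * (1/4) ^ Suc j) = b 0 / 4 + (\<Sum>j. b (Suc j) * (1/4) ^ Suc j) / 4"
proof -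
  have g: "(\<lambda>j. (1/4::real) ^ Suc j) sums (1/3)"
    using geometric_sums[of "1/4::real", THEN sums_mult[of _ _ "1/4"]] by simp
  show s: "summable (\<lambda>j. b j * (1/4) ^ Suc j)"
    by (rule summable_comparison_test'[OF sums_summable[OF g]])
      (use b in \<open>auto simp: abs_mult intro!: mult_left_le_one_le\<close>)
  have "(\<Sum>j. b j * (1/4) ^ Suc j) \<le> 1/3"
    unfolding sums_unique[OF g]
    by (intro suminf_le s sums_summable[OF g]) (use b in \<open>auto intro!: mult_left_le_one_le\<close>)
  moreover have "0 \<le> (\<Sum>j. b j * (1/4) ^ Suc j)" using b by (intro suminf_nonneg s) auto
  ultimately show "(\<Sum>j. b j * (1/4) ^ Suc j) \<in> {0..1/3}" by simp
  show "(\<Sum>j. b j * (1/4) ^ Suc j) = b 0 / 4 + (\<Sum>j. b (Suc j) * (1/4) ^ Suc j) / 4"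
  proof -
    have "summable (\<lambda>j. b (Suc j) * (1/4) ^ Suc j)"
      by (rule summable_comparison_test'[OF sums_summable[OF g]])
        (use b in \<open>auto simp: abs_mult intro!: mult_left_le_one_le\<close>)
    from suminf_divide[OF this, of 4] suminf_split_head[OF s] show ?thesis by simp
  qed
qed

text \<open>If the leading digits differ, the sums are at least \<open>1/4 - 1/12 = 1/6\<close>
  apart. Otherwise the leading digits cancel, and multiplication by 4 passes to the shifted
  sequences. Base 2 has no such gap.\<close>

lemma quaternary_expansion_agree:
  fixes b b' :: "nat \<Rightarrow> real"
  assumes "\<And>j. b j \<in> {0, 1}" "\<And>j. b' j \<in> {0, 1}"
    and "\<bar>(\<Sum>j. b j * (1/4) ^ Suc j) - (\<Sum>j. b' j * (1/4) ^ Suc j)\<bar> < 1/6 * (1/4) ^ J"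
    and "j \<le> J"
  shows "b j = b' j"
  using assms
proof (induction J arbitrary: b b' j)
  case 0
  have b: "b j \<in> {0..1}" "b' j \<in> {0..1}" for j
    using 0(1)[of j] 0(2)[of j] by auto
  then have b': "\<And>j. b (Suc j) \<in> {0..1}" "\<And>j. b' (Suc j) \<in> {0..1}" by blast+
  define u where "u = (\<Sum>j. b (Suc j) * (1/4) ^ Suc j)"
  define u' where "u' = (\<Sum>j. b' (Suc j) * (1/4) ^ Suc j)"
  have u: "u \<in> {0..1/3}" "u' \<in> {0..1/3}"
    unfolding u_def u'_def by (rule quaternary_expansion(2), rule b')+
  have "\<bar>(b 0 / 4 + u / 4) - (b' 0 / 4 + u' / 4)\<bar> < 1/6 * (1/4) ^ 0"
    using 0(3) quaternary_expansion(3)[of b, OF b(1), folded u_def]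
      quaternary_expansion(3)[of b', OF b(2), folded u'_def] by (simp only:)
  moreover have "b 0 = 0 \<or> b 0 = 1" "b' 0 = 0 \<or> b' 0 = 1" using 0(1)[of 0] 0(2)[of 0] by simp_all
  ultimately have "b 0 = b' 0" using u by auto
  then show ?case using 0(4) by simp
next
  case (Suc J)
  have b: "b j \<in> {0..1}" "b' j \<in> {0..1}" for j
    using Suc.prems(1)[of j] Suc.prems(2)[of j] by auto
  then have b': "\<And>j. b (Suc j) \<in> {0..1}" "\<And>j. b' (Suc j) \<in> {0..1}" by blast+
  define u where "u = (\<Sum>j. b (Suc j) * (1/4) ^ Suc j)"
  define u' where "u' = (\<Sum>j. b' (Suc j) * (1/4) ^ Suc j)"
  have u: "u \<in> {0..1/3}" "u' \<in> {0..1/3}"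
    unfolding u_def u'_def by (rule quaternary_expansion(2), rule b')+
  have d: "\<bar>(b 0 / 4 + u / 4) - (b' 0 / 4 + u' / 4)\<bar> < 1/6 * (1/4) ^ Suc J"
    using Suc.prems(3) quaternary_expansion(3)[of b, OF b(1), folded u_def]
      quaternary_expansion(3)[of b', OF b(2), folded u'_def] by (simp only:)
  have "(1/4::real) ^ Suc J \<le> 1" by (rule power_le_one) auto
  with d have "\<bar>(b 0 / 4 + u / 4) - (b' 0 / 4 + u' / 4)\<bar> < 1/6" by linarith
  moreover have "b 0 = 0 \<or> b 0 = 1" "b' 0 = 0 \<or> b' 0 = 1"
    using Suc.prems(1)[of 0] Suc.prems(2)[of 0] by simp_all
  ultimately have b0: "b 0 = b' 0" using u by auto
  show ?case
  proof (cases j)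
    case (Suc i)
    have "\<bar>u / 4 - u' / 4\<bar> = \<bar>u - u'\<bar> / 4" by (simp flip: diff_divide_distrib)
    then have "\<bar>u - u'\<bar> < 1/6 * (1/4) ^ J" using d b0 by simp
    then show ?thesis
      using Suc.IH[of "\<lambda>j. b (Suc j)" "\<lambda>j. b' (Suc j)" i] Suc.prems \<open>j = Suc i\<close>
      unfolding u_def u'_def by auto
  qed (use b0 in simp)
qed

text \<open>
  The last property makes the inverse of the code continuous, so that tightness and almost sure
  convergence transfer between the Euclidean space and the real line. The integer part of the code
  is \<open>\<lfloor>norm z\<rfloor>\<close>; its fractional part records which balls of a countable family contain \<open>z\<close>.
\<close>

lemma euclidean_code:
  obtains enc :: "'a::euclidean_space \<Rightarrow> real"
  where "enc \<in> borel_measurable borel" "\<And>z. 0 \<le> enc z" "\<And>z. enc z \<le> norm z + 1" "\<And>z. norm z \<le> enc z + 1"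
    and "\<And>r e. 0 < e \<Longrightarrow> \<exists>d>0. \<forall>z z'. norm z \<le> r \<longrightarrow> \<bar>enc z - enc z'\<bar> < d \<longrightarrow> dist z z' < e"
proof -
  obtain D :: "'a set" where D: "countable D" "\<And>X. open X \<Longrightarrow> X \<noteq> {} \<Longrightarrow> \<exists>d\<in>D. d \<in> X"
    using countable_dense_setE by blast
  then have "D \<noteq> {}" using open_UNIV by blast
  then have rD: "range (from_nat_into D) = D" using D(1) by (rule range_from_nat_into)
  define w where "w = from_nat_into D"
  define B where "B j = ball (w (fst (prod_decode j))) (1 / real (Suc (snd (prod_decode j))))" for j
  have [measurable]: "B j \<in> sets borel" for j by (simp add: B_def)
  define s where "s z = (\<Sum>j. indicator (B j) z * (1/4::real) ^ Suc j)" for z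
  define enc where "enc z = real (nat \<lfloor>norm z\<rfloor>) + s z" for z
  have s: "s z \<in> {0..1/3}" for z
    unfolding s_def by (rule quaternary_expansion) (auto simp: indicator_def)
  have fl: "norm z - 1 < real (nat \<lfloor>norm z\<rfloor>)" "real (nat \<lfloor>norm z\<rfloor>) \<le> norm z" for z :: 'a
    using norm_ge_zero[of z] by linarith+
  show thesis
  proof
    show "enc \<in> borel_measurable borel" unfolding enc_def s_def by measurable
    show "0 \<le> enc z" "enc z \<le> norm z + 1" "norm z \<le> enc z + 1" for z
      using s[of z] fl[of z] norm_ge_zero[of z] unfolding enc_def atLeastAtMost_iff by linarith+
    fix r e :: real assume e: "0 < e"
    obtain k where k: "2 / real (Suc k) < e"
      using reals_Archimedean[of "e/2"] e by (auto simp: inverse_eq_divide)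
    have "cball 0 r \<subseteq> (\<Union>i. ball (w i) (1 / real (Suc k)))"
    proof
      fix z :: 'a
      obtain d where "d \<in> D" "d \<in> ball z (1 / real (Suc k))"
        using D(2)[of "ball z (1 / real (Suc k))"] by fastforce
      moreover then obtain i where "d = w i" using rD by (auto simp: w_def)
      ultimately show "z \<in> (\<Union>i. ball (w i) (1 / real (Suc k)))" by (auto simp: dist_commute)
    qed
    then obtain I where I: "finite I" "cball 0 r \<subseteq> (\<Union>i\<in>I. ball (w i) (1 / real (Suc k)))"
      using compactE_image[OF compact_cball, of UNIV "\<lambda>i. ball (w i) (1 / real (Suc k))" 0 r] by auto
    \<comment> \<open>\<open>J\<close> bounds the digit positions of a finite cover of
      \<open>cball 0 r\<close> by balls of radius \<open>1 / Suc k\<close>. Agreement of the digits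
      up to \<open>J\<close> puts \<open>z'\<close> into a ball of the cover that contains
      \<open>z\<close>, so \<open>dist z z' < 2 / Suc k < e\<close>.\<close>
    define J where "J = Max (insert 0 ((\<lambda>i. prod_encode (i, k)) ` I))"
    have J: "prod_encode (i, k) \<le> J" if "i \<in> I" for i
      unfolding J_def using I(1) that by (intro Max_ge) auto
    show "\<exists>d>0. \<forall>z z'. norm z \<le> r \<longrightarrow> \<bar>enc z - enc z'\<bar> < d \<longrightarrow> dist z z' < e"
    proof (intro exI[of _ "1/6 * (1/4) ^ J"] conjI allI impI)
      fix z z' :: 'a assume z: "norm z \<le> r" and d: "\<bar>enc z - enc z'\<bar> < 1/6 * (1/4) ^ J"
      have "(1/4::real) ^ J \<le> 1" by (rule power_le_one) auto
      with d have "\<bar>enc z - enc z'\<bar> < 1/6" by linarith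
      \<comment> \<open>The fractional parts lie in \<open>[0, 1/3]\<close>, so codes closer than
        1/6 have integer parts at distance below \<open>1/6 + 1/3\<close>.\<close>
      then have "\<bar>real (nat \<lfloor>norm z\<rfloor>) - real (nat \<lfloor>norm z'\<rfloor>)\<bar> < 1"
        using s[of z] s[of z'] unfolding enc_def atLeastAtMost_iff by linarith
      then have "nat \<lfloor>norm z\<rfloor> = nat \<lfloor>norm z'\<rfloor>" by linarith
      with d have "\<bar>s z - s z'\<bar> < 1/6 * (1/4) ^ J" by (simp add: enc_def)
      then have agree: "indicator (B j) z = (indicator (B j) z' :: real)" if "j \<le> J" for j
        unfolding s_def by (rule quaternary_expansion_agree[rotated 2, OF _ that]) (auto simp: indicator_def)
      obtain i where i: "i \<in> I" "z \<in> ball (w i) (1 / real (Suc k))" using I(2) z by force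
      have "B (prod_encode (i, k)) = ball (w i) (1 / real (Suc k))" by (simp add: B_def)
      then have "z' \<in> ball (w i) (1 / real (Suc k))"
        using agree[OF J[OF i(1)]] i(2) by (auto simp: indicator_def split: if_splits)
      then have "dist z z' < 1 / real (Suc k) + 1 / real (Suc k)"
        using i(2) dist_triangle3[of z z' "w i"] by (auto simp: mem_ball)
      then show "dist z z' < e" using k by simp
    qed simp
  qed
qed

text \<open>\<open>dec\<close> is a pointwise limit of functions with countably many values: at
  accuracy \<open>1 / Suc J\<close> take the first point of a countable family whose code is that
  close. On codes the limit exists by the modulus of continuity \<open>U\<close>; at the remaining
  points \<open>lim\<close> may be arbitrary, but \<open>dec\<close> is Borel on the whole
  line.\<close>

lemma measurable_left_inverse_of_code:
  fixes enc :: "'a::euclidean_space \<Rightarrow> real"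
  assumes U: "\<And>r e. 0 < e \<Longrightarrow> \<exists>d>0. \<forall>z z'. norm z \<le> r \<longrightarrow> \<bar>enc z - enc z'\<bar> < d \<longrightarrow> dist z z' < e"
  obtains dec where "dec \<in> borel_measurable borel" "\<And>z. dec (enc z) = z"
proof -
  obtain T where T: "T \<subseteq> range enc" "countable T" "range enc \<subseteq> closure T"
    using separable by metis
  then have "T \<noteq> {}" by auto
  define v where "v i = inv enc (from_nat_into T i)" for i
  have ev: "enc (v i) = from_nat_into T i" for i
    unfolding v_def by (rule f_inv_into_f) (rule subsetD[OF T(1) from_nat_into[OF \<open>T \<noteq> {}\<close>]])
  define near where "near J t i \<longleftrightarrow> \<bar>enc (v i) - t\<bar> < 1 / real (Suc J)" for J t i
  define dec where "dec t = lim (\<lambda>J. v (LEAST i. near J t i))" for t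
  have near_ex: "\<exists>i. near J (enc z) i" for J z
  proof -
    have "enc z \<in> closure T" using T by auto
    then obtain y where "y \<in> T" "dist y (enc z) < 1 / real (Suc J)"
      by (metis closure_approachable of_nat_0_less_iff zero_less_Suc zero_less_divide_1_iff)
    moreover from this obtain i where "y = enc (v i)"
      using T(2) \<open>T \<noteq> {}\<close> ev from_nat_into_surj by metis
    ultimately show ?thesis by (auto simp: near_def dist_real_def)
  qed
  have "(\<lambda>J. v (LEAST i. near J (enc z) i)) \<longlonglongrightarrow> z" for z
  proof (rule metric_LIMSEQ_I)
    fix e :: real assume "0 < e"
    then obtain d where d: "0 < d" "\<And>z'. \<bar>enc z - enc z'\<bar> < d \<Longrightarrow> dist z z' < e"
      using U[of e "norm z"] by blast
    obtain N where N: "1 / real (Suc N) < d"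
      using reals_Archimedean[OF d(1)] by (auto simp: inverse_eq_divide)
    have "dist (v (LEAST i. near J (enc z) i)) z < e" if "N \<le> J" for J
    proof -
      have "near J (enc z) (LEAST i. near J (enc z) i)" using near_ex by (metis LeastI)
      then have "\<bar>enc z - enc (v (LEAST i. near J (enc z) i))\<bar> < 1 / real (Suc J)"
        by (simp add: near_def abs_minus_commute)
      also have "\<dots> \<le> 1 / real (Suc N)" using that by (simp add: frac_le)
      finally show ?thesis using d(2) N by (metis dist_commute less_trans)
    qed
    then show "\<exists>no. \<forall>n\<ge>no. dist (v (LEAST i. near n (enc z) i)) z < e" by blast
  qed
  then have "dec (enc z) = z" for z unfolding dec_def by (rule limI)
  moreover have "dec \<in> borel_measurable borel"
    unfolding dec_def
  proof (rule borel_measurable_lim_metric)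
    fix J
    have "(\<lambda>t. LEAST i. near J t i) \<in> borel \<rightarrow>\<^sub>M count_space UNIV"
      unfolding near_def by measurable
    then show "(\<lambda>t. v (LEAST i. near J t i)) \<in> borel_measurable borel"
      by (rule measurable_compose) simp
  qed
  ultimately show thesis using that by blast
qed

text \<open>The code carries the problem to the real line, where tightness gives a weakly convergent
  subsequence and Skorohod's theorem an almost surely convergent representation, which is then
  decoded. The conclusion is stated as Fatou's inequality because it also covers unbounded
  \<open>F\<close>; for bounded functions convergence follows by applying it to \<open>g\<close> and
  \<open>1 - g\<close>.\<close>

theorem prokhorov_moment:
  fixes M :: "nat \<Rightarrow> 'a::euclidean_space measure"
  assumes M: "\<And>n. prob_space (M n)" and setsM [measurable_cong]: "\<And>n. sets (M n) = sets borel"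
    and B: "\<And>n. (\<integral>\<^sup>+z. ennreal (norm z) \<partial>M n) \<le> ennreal B"
  obtains r R where "strict_mono r" "prob_space R" "sets R = sets borel"
    "\<And>F. continuous_on UNIV F \<Longrightarrow> (\<And>z. 0 \<le> F z) \<Longrightarrow>
       (\<integral>\<^sup>+z. ennreal (F z) \<partial>R) \<le> liminf (\<lambda>k. \<integral>\<^sup>+z. ennreal (F z) \<partial>M (r k))"
proof -
  obtain enc :: "'a \<Rightarrow> real" where enc: "enc \<in> borel_measurable borel" "\<And>z. 0 \<le> enc z"
    "\<And>z. enc z \<le> norm z + 1" "\<And>z. norm z \<le> enc z + 1"
    and U: "\<And>r e. 0 < e \<Longrightarrow> \<exists>d>0. \<forall>z z'. norm z \<le> r \<longrightarrow> \<bar>enc z - enc z'\<bar> < d \<longrightarrow> dist z z' < e"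
    using euclidean_code by blast
  obtain dec where dec: "dec \<in> borel_measurable borel" "\<And>z. dec (enc z) = z"
    using measurable_left_inverse_of_code[OF U] by blast
  note [measurable] = enc(1) dec(1)
  define \<mu> where "\<mu> n = distr (M n) borel enc" for n
  have \<mu>: "real_distribution (\<mu> n)" for n
    unfolding \<mu>_def by (intro real_distribution.intro prob_space.prob_space_distr M)
      (auto simp: real_distribution_axioms_def)
  have "tight \<mu>"
    unfolding tight_def
  proof (intro conjI allI impI \<mu>)
    fix e :: real assume e: "0 < e"
    \<comment> \<open>Threshold for Markov's inequality: \<open>c * e > B\<close> makes the mass of
      \<open>c \<le> norm z\<close> smaller than \<open>e\<close>. The interval below contains the
      codes of all other points, as \<open>0 \<le> enc z \<le> norm z + 1\<close>.\<close>
    define c where "c = max 1 ((B + 1) / e)"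
    have c: "0 < c" "0 < max B 0 + 1" "B < c * e" using e by (auto simp: c_def field_simps max_def)
    have "1 - e < measure (\<mu> n) {-1<..c + 1}" for n
    proof -
      interpret prob_space "M n" by (rule M)
      have "emeasure (M n) {z \<in> space (M n). 1 \<le> ennreal (1/c) * ennreal (norm z)}
          \<le> ennreal (1/c) * (\<integral>\<^sup>+z. ennreal (norm z) * indicator (space (M n)) z \<partial>M n)"
        by (rule nn_integral_Markov_inequality) auto
      also have "(\<integral>\<^sup>+z. ennreal (norm z) * indicator (space (M n)) z \<partial>M n) = (\<integral>\<^sup>+z. ennreal (norm z) \<partial>M n)"
        by (intro nn_integral_cong) auto
      also have "ennreal (1/c) * \<dots> \<le> ennreal (1/c) * ennreal B" by (intro mult_left_mono B) auto
      also have "\<dots> = ennreal (B / c)" using c by (simp add: ennreal_mult'[symmetric])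
      also have "\<dots> < ennreal e" using c e by (simp add: ennreal_less_iff field_simps ennreal_lessI)
      finally have "emeasure (M n) {z \<in> space (M n). 1 \<le> ennreal (1/c) * ennreal (norm z)} < ennreal e" .
      also have "{z \<in> space (M n). 1 \<le> ennreal (1/c) * ennreal (norm z)} = {z \<in> space (M n). c \<le> norm z}"
        using c by (auto simp: ennreal_mult'[symmetric] field_simps)
      finally have small: "prob {z \<in> space (M n). c \<le> norm z} < e"
        using e by (simp add: emeasure_eq_measure ennreal_less_iff)
      have "1 - prob {z \<in> space (M n). c \<le> norm z} = prob (space (M n) - {z \<in> space (M n). c \<le> norm z})"
        by (rule prob_compl[symmetric]) measurable
      also have "\<dots> \<le> prob (enc -` {-1<..c + 1} \<inter> space (M n))"
      proof (rule finite_measure_mono)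
        show "space (M n) - {z \<in> space (M n). c \<le> norm z} \<subseteq> enc -` {-1<..c + 1} \<inter> space (M n)"
        proof
          fix z assume "z \<in> space (M n) - {z \<in> space (M n). c \<le> norm z}"
          then show "z \<in> enc -` {-1<..c + 1} \<inter> space (M n)" using enc(2)[of z] enc(3)[of z] by auto
        qed
      qed measurable
      also have "\<dots> = measure (\<mu> n) {-1<..c + 1}" unfolding \<mu>_def by (subst measure_distr) auto
      finally show ?thesis using small by linarith
    qed
    then show "\<exists>a b. a < b \<and> (\<forall>n. 1 - e < measure (\<mu> n) {a<..b})"
      using c(1) by (intro exI[of _ "-1"] exI[of _ "c + 1"]) auto
  qed
  then obtain r L where r: "strict_mono (r :: nat \<Rightarrow> nat)" and L: "real_distribution L"
    and conv: "weak_conv_m (\<mu> \<circ> id \<circ> r) L"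
    using tight_imp_convergent_subsubsequence[of \<mu> id] by (auto simp: strict_mono_id)
  have conv': "weak_conv_m (\<lambda>n. \<mu> (r n)) L" using conv by (simp add: comp_def)
  obtain \<Omega> :: "real measure" and Y Yl where \<Omega>: "prob_space \<Omega>"
    and Y [measurable]: "\<And>n. Y n \<in> borel_measurable \<Omega>" and dY: "\<And>n. distr \<Omega> borel (Y n) = \<mu> (r n)"
    and YY: "\<And>x. x \<in> space \<Omega> \<Longrightarrow> (\<lambda>n. Y n x) \<longlonglongrightarrow> Yl x"
    using Skorohod[OF \<mu> L conv'] by blast
  interpret \<Omega>: prob_space \<Omega> by fact
  define Z where "Z n x = dec (Y n x)" for n x
  define Zl where "Zl x = lim (\<lambda>n. Z n x)" for x
  have [measurable]: "Z n \<in> borel_measurable \<Omega>" for n unfolding Z_def by measurable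
  have [measurable]: "Zl \<in> borel_measurable \<Omega>"
    unfolding Zl_def by (rule borel_measurable_lim_metric) measurable
  have dZ: "distr \<Omega> borel (Z n) = M (r n)" for n
  proof -
    have "distr \<Omega> borel (Z n) = distr (distr \<Omega> borel (Y n)) borel dec"
      by (subst distr_distr) (auto simp: Z_def[abs_def] comp_def)
    also have "\<dots> = distr (M (r n)) borel (\<lambda>z. z)"
      unfolding dY \<mu>_def by (subst distr_distr) (auto simp: comp_def dec)
    also have "\<dots> = M (r n)" by (rule distr_id2) (simp add: setsM)
    finally show ?thesis .
  qed
  \<comment> \<open>The law of \<open>Y n\<close> is an image under \<open>enc\<close>, so
    \<open>Y n\<close> is almost surely a code, and there \<open>enc\<close> also inverts
    \<open>dec\<close> from the other side.\<close>
  have "AE x in \<Omega>. enc (Z n x) = Y n x" for n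
  proof -
    have "AE t in \<mu> (r n). enc (dec t) = t"
      unfolding \<mu>_def by (subst AE_distr_iff) (auto simp: dec)
    then show ?thesis unfolding dY[symmetric] Z_def by (subst (asm) AE_distr_iff) auto
  qed
  then have "AE x in \<Omega>. \<forall>n. enc (Z n x) = Y n x" by (simp add: AE_all_countable)
  \<comment> \<open>The limit \<open>Yl x\<close> of the codes need not be a code, so
    \<open>Zl\<close> is not obtained by decoding it. Instead, convergent codes are bounded, hence
    so are the points, and on bounded sets \<open>U\<close> turns Cauchy codes into Cauchy
    points.\<close>
  with AE_space have ZZ: "AE x in \<Omega>. (\<lambda>n. Z n x) \<longlonglongrightarrow> Zl x"
  proof eventually_elim
    fix x assume "x \<in> space \<Omega>" and eq: "\<forall>n. enc (Z n x) = Y n x"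
    then have c: "convergent (\<lambda>n. Y n x)" using YY by (auto simp: convergent_def)
    then obtain b where b: "\<And>n. norm (Y n x) \<le> b"
      using convergent_imp_Bseq Bseq_def by metis
    have bz: "norm (Z n x) \<le> b + 1" for n
      using enc(4)[of "Z n x"] eq b[of n] by auto
    have "Cauchy (\<lambda>n. Z n x)"
    proof (rule metric_CauchyI)
      fix e :: real assume "0 < e"
      then obtain d where d: "0 < d" "\<And>z z'. norm z \<le> b + 1 \<Longrightarrow> \<bar>enc z - enc z'\<bar> < d \<Longrightarrow> dist z z' < e"
        using U[of e "b + 1"] by blast
      obtain N where "\<And>m n. N \<le> m \<Longrightarrow> N \<le> n \<Longrightarrow> dist (Y m x) (Y n x) < d"
        using metric_CauchyD[OF convergent_Cauchy[OF c] d(1)] by blast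
      then have "dist (Z m x) (Z n x) < e" if "N \<le> m" "N \<le> n" for m n
        using that d(2)[OF bz] eq by (simp add: dist_real_def)
      then show "\<exists>N. \<forall>m\<ge>N. \<forall>n\<ge>N. dist (Z m x) (Z n x) < e" by blast
    qed
    then show "(\<lambda>n. Z n x) \<longlonglongrightarrow> Zl x"
      unfolding Zl_def by (metis Cauchy_convergent convergent_LIMSEQ_iff)
  qed
  show thesis
  proof (rule that[OF r])
    show "prob_space (distr \<Omega> borel Zl)" by (rule \<Omega>.prob_space_distr) measurable
    fix F :: "'a \<Rightarrow> real" assume F: "continuous_on UNIV F" "\<And>z. 0 \<le> F z"
    have [measurable]: "F \<in> borel_measurable borel" using F(1) by (rule borel_measurable_continuous_onI)
    have "(\<integral>\<^sup>+z. ennreal (F z) \<partial>distr \<Omega> borel Zl) = (\<integral>\<^sup>+x. ennreal (F (Zl x)) \<partial>\<Omega>)"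
      by (subst nn_integral_distr) auto
    also have "\<dots> = (\<integral>\<^sup>+x. liminf (\<lambda>n. ennreal (F (Z n x))) \<partial>\<Omega>)"
    proof (rule nn_integral_cong_AE)
      show "AE x in \<Omega>. ennreal (F (Zl x)) = liminf (\<lambda>n. ennreal (F (Z n x)))"
        using ZZ
      proof eventually_elim
        case (elim x)
        have "(\<lambda>n. F (Z n x)) \<longlonglongrightarrow> F (Zl x)"
          using continuous_on_tendsto_compose[OF F(1) elim] by auto
        then have "(\<lambda>n. ennreal (F (Z n x))) \<longlonglongrightarrow> ennreal (F (Zl x))" by (rule tendsto_ennrealI)
        then show ?case using lim_imp_Liminf by (metis sequentially_bot)
      qed
    qed
    also have "\<dots> \<le> liminf (\<lambda>n. \<integral>\<^sup>+x. ennreal (F (Z n x)) \<partial>\<Omega>)"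
      by (rule nn_integral_liminf) measurable
    also have "(\<lambda>n. \<integral>\<^sup>+x. ennreal (F (Z n x)) \<partial>\<Omega>) = (\<lambda>n. \<integral>\<^sup>+z. ennreal (F z) \<partial>M (r n))"
      unfolding dZ[symmetric] by (subst nn_integral_distr) auto
    finally show "(\<integral>\<^sup>+z. ennreal (F z) \<partial>distr \<Omega> borel Zl) \<le> liminf (\<lambda>k. \<integral>\<^sup>+z. ennreal (F z) \<partial>M (r k))" .
  qed simp
qed

section \<open>Drift in a cone and the convex order\<close>

definition cone_le :: "'a::euclidean_space set \<Rightarrow> 'a measure \<Rightarrow> 'a measure \<Rightarrow> bool" where
  "cone_le C \<mu> \<nu> \<longleftrightarrow>
     (\<forall>\<phi>. convex_on UNIV \<phi> \<and> (\<forall>x. 0 \<le> \<phi> x) \<and> (\<forall>x. \<forall>c\<in>C. \<phi> x \<le> \<phi> (x + c)) \<longrightarrow>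
        (\<integral>\<^sup>+ x. ennreal (\<phi> x) \<partial>\<mu>) \<le> (\<integral>\<^sup>+ x. ennreal (\<phi> x) \<partial>\<nu>))"

text \<open>The condition \<open>E[a \<bullet> (Y - X) | X] \<ge> 0\<close> for all \<open>a\<close>
  in the dual cone of \<open>C\<close>, tested on the events \<open>X \<in> A\<close>. In this form
  it involves integrals only and passes to limits. Bochner integrals of nonintegrable functions are
  0, so it is informative only together with first moments.\<close>

definition cone_drift :: "'a::euclidean_space set \<Rightarrow> ('a \<times> 'a) measure \<Rightarrow> bool" where
  "cone_drift C R \<longleftrightarrow>
     (\<forall>a. (\<forall>c\<in>C. 0 \<le> a \<bullet> c) \<longrightarrow>
        (\<forall>A\<in>sets borel. 0 \<le> (\<integral>z. indicator A (fst z) * (a \<bullet> (snd z - fst z)) \<partial>R)))"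

text \<open>Separate \<open>(x, \<phi> x - e)\<close> from the epigraph, which is closed because
  finite convex functions are continuous. The separating hyperplane is not vertical, since the point
  \<open>(x, \<phi> x)\<close> of the epigraph lies straight above; hence one can divide by
  \<open>s\<close>.\<close>

lemma convex_on_affine_minorant:
  fixes \<phi> :: "'a::euclidean_space \<Rightarrow> real"
  assumes \<phi>: "convex_on UNIV \<phi>" and e: "0 < e"
  obtains a b where "\<And>y. a \<bullet> y + b \<le> \<phi> y" "\<phi> x - e < a \<bullet> x + b"
proof -
  have cont: "continuous_on UNIV \<phi>" by (rule convex_on_continuous) (use \<phi> in auto)
  have "convex (epigraph UNIV \<phi>)" using \<phi> by (simp add: convex_epigraph)
  moreover have "epigraph UNIV \<phi> = {p. \<phi> (fst p) \<le> snd p}" by (auto simp: epigraph_def)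
  then have "closed (epigraph UNIV \<phi>)"
    by (simp, intro closed_Collect_le continuous_intros continuous_on_compose2[OF cont]) auto
  moreover have "(x, \<phi> x - e) \<notin> epigraph UNIV \<phi>" using e by (simp add: epigraph_def)
  ultimately have "\<exists>p c. p \<bullet> (x, \<phi> x - e) < c \<and> (\<forall>q\<in>epigraph UNIV \<phi>. c < p \<bullet> q)"
    by (rule separating_hyperplane_closed_point)
  then obtain p c where p: "p \<bullet> (x, \<phi> x - e) < c" "\<And>q. q \<in> epigraph UNIV \<phi> \<Longrightarrow> c < p \<bullet> q"
    by blast
  obtain u s where us: "p = (u, s)" by (cases p)
  have less: "c < u \<bullet> y + s * \<phi> y" for y using p(2)[of "(y, \<phi> y)"] by (simp add: us epigraph_def)
  have x: "u \<bullet> x + s * (\<phi> x - e) < c" using p(1) by (simp add: us)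
  have "0 < s * e" using less[of x] x by (simp add: algebra_simps)
  then have s: "0 < s" using e by (simp add: zero_less_mult_iff)
  show thesis
  proof
    show "(- u /\<^sub>R s) \<bullet> y + c / s \<le> \<phi> y" for y
      using less[of y] s by (simp add: field_simps)
    show "\<phi> x - e < (- u /\<^sub>R s) \<bullet> x + c / s"
      using x s by (simp add: field_simps)
  qed
qed

text \<open>For fixed \<open>x\<close>, exceeding \<open>\<phi> x - e\<close> at \<open>x\<close> is
  an open condition on the pair of slope and constant, so a countable dense set of minorants has the
  same supremum.\<close>

lemma convex_on_countable_affine_minorants:
  fixes \<phi> :: "'a::euclidean_space \<Rightarrow> real"
  assumes \<phi>: "convex_on UNIV \<phi>"
  obtains a :: "nat \<Rightarrow> 'a" and b :: "nat \<Rightarrow> real"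
  where "\<And>k y. a k \<bullet> y + b k \<le> \<phi> y" "\<And>x e. 0 < e \<Longrightarrow> \<exists>k. \<phi> x - e < a k \<bullet> x + b k"
proof -
  define S where "S = {p. \<forall>y. fst p \<bullet> y + snd p \<le> \<phi> y}"
  obtain T where T: "countable T" "T \<subseteq> S" "\<And>U. open U \<Longrightarrow> U \<inter> S \<noteq> {} \<Longrightarrow> U \<inter> T \<noteq> {}"
    using countable_dense_subset[of S] by blast
  have ex: "\<exists>p\<in>T. \<phi> x - e < fst p \<bullet> x + snd p" if e: "0 < e" for x e
  proof -
    obtain a b where ab: "\<And>y. a \<bullet> y + b \<le> \<phi> y" "\<phi> x - e < a \<bullet> x + b"
      using convex_on_affine_minorant[OF \<phi> e] by blast
    have "open {p. \<phi> x - e < fst p \<bullet> x + snd p}" by (intro open_Collect_less continuous_intros)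
    moreover have "(a, b) \<in> {p. \<phi> x - e < fst p \<bullet> x + snd p} \<inter> S" using ab by (simp add: S_def)
    ultimately show ?thesis using T(3) by blast
  qed
  have "T \<noteq> {}" using ex[of 1] by fastforce
  then have rT: "range (from_nat_into T) = T" using T(1) by (rule range_from_nat_into)
  show thesis
  proof
    show "fst (from_nat_into T k) \<bullet> y + snd (from_nat_into T k) \<le> \<phi> y" for k y
      using T(2) from_nat_into[OF \<open>T \<noteq> {}\<close>, of k] by (auto simp: S_def)
    show "\<exists>k. \<phi> x - e < fst (from_nat_into T k) \<bullet> x + snd (from_nat_into T k)" if "0 < e" for x e
      using ex[OF that, of x] rT by (metis imageE)
  qed
qed

text \<open>Conditional Jensen inequality without conditional expectations: it is proved for finite
  maxima of affine minorants, where all integrals are finite, and extended by monotone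
  convergence.\<close>

theorem cone_drift_imp_cone_le:
  fixes R :: "('a::euclidean_space \<times> 'a) measure"
  assumes "prob_space R" and setsR [measurable_cong]: "sets R = sets (borel \<Otimes>\<^sub>M borel)"
    and int: "integrable R fst" "integrable R snd"
    and C: "convex_cone C" and drift: "cone_drift C R"
  shows "cone_le C (distr R borel fst) (distr R borel snd)"
  unfolding cone_le_def
proof (intro allI impI, elim conjE)
  interpret prob_space R by fact
  fix \<phi> :: "'a \<Rightarrow> real"
  assume \<phi>: "convex_on UNIV \<phi>" and nonneg: "\<forall>x. 0 \<le> \<phi> x"
    and mono: "\<forall>x. \<forall>c\<in>C. \<phi> x \<le> \<phi> (x + c)"
  obtain a :: "nat \<Rightarrow> 'a" and b :: "nat \<Rightarrow> real"
    where ab: "\<And>k y. a k \<bullet> y + b k \<le> \<phi> y" "\<And>x e. 0 < e \<Longrightarrow> \<exists>k. \<phi> x - e < a k \<bullet> x + b k"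
    using convex_on_countable_affine_minorants[OF \<phi>] by blast
  \<comment> \<open>Along \<open>-c\<close> the function \<open>\<phi>\<close> does not increase,
    whereas an affine minorant with \<open>a k \<bullet> c < 0\<close> grows without bound;
    \<open>t\<close> is just large enough to push it above \<open>\<phi> 0\<close>.\<close>
  have dual: "0 \<le> a k \<bullet> c" if c: "c \<in> C" for k c
  proof (rule ccontr)
    assume neg: "\<not> 0 \<le> a k \<bullet> c"
    define t where "t = (\<bar>\<phi> 0 - b k\<bar> + 1) / (- (a k \<bullet> c))"
    have t: "0 \<le> t" unfolding t_def by (rule divide_nonneg_pos) (use neg in auto)
    have "t *\<^sub>R c \<in> C" by (rule convex_cone_scaleR[OF C t c])
    then have "\<phi> (- (t *\<^sub>R c)) \<le> \<phi> 0" using mono by (metis add.left_inverse)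
    then have "a k \<bullet> (- (t *\<^sub>R c)) + b k \<le> \<phi> 0" using ab(1) order_trans by blast
    moreover have "a k \<bullet> (- (t *\<^sub>R c)) = \<bar>\<phi> 0 - b k\<bar> + 1"
      using neg by (simp add: t_def)
    ultimately show False by linarith
  qed
  \<comment> \<open>Starting from 0 is possible because \<open>\<phi> \<ge> 0\<close>, and it makes
    every \<open>F n\<close> nonnegative.\<close>
  define F where "F = rec_nat (\<lambda>_. 0) (\<lambda>n f x. max (f x) (a n \<bullet> x + b n))"
  have F0: "F 0 x = 0" and FSuc: "F (Suc n) x = max (F n x) (a n \<bullet> x + b n)" for n x
    by (simp_all add: F_def)
  have Fm [measurable]: "F n \<in> borel_measurable borel" for n
  proof (induction n)
    case (Suc n)
    note Suc[measurable]
    show ?case unfolding FSuc[abs_def] by measurable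
  qed (simp add: F0[abs_def])
  have F_nonneg: "0 \<le> F n x" for n x by (induction n) (simp_all add: F0 FSuc le_max_iff_disj)
  have F_le: "F n x \<le> \<phi> x" for n x by (induction n) (simp_all add: F0 FSuc nonneg ab(1))
  have intF: "integrable R (\<lambda>z. F n (fst z))" "integrable R (\<lambda>z. F n (snd z))" for n
  proof (induction n)
    case (Suc n)
    { case 1 show ?case unfolding FSuc
        by (intro integrable_max Suc Bochner_Integration.integrable_add integrable_inner_right int) auto }
    { case 2 show ?case unfolding FSuc
        by (intro integrable_max Suc Bochner_Integration.integrable_add integrable_inner_right int) auto }
  qed (simp_all add: F0)
  \<comment> \<open>On \<open>B\<close> the new affine function is the maximum at
    \<open>fst z\<close> and a lower bound for it at \<open>snd z\<close>; on \<open>A - B\<close>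
    the same holds for \<open>F n\<close>. So the increment of \<open>F (Suc n)\<close> dominates an
    affine drift on \<open>B\<close> and the inductive one on \<open>A - B\<close>. The statement is
    over all \<open>A\<close> since the induction needs \<open>A - B\<close>.\<close>
  have sub: "0 \<le> (\<integral>z. indicator A (fst z) * (F n (snd z) - F n (fst z)) \<partial>R)"
    if "A \<in> sets borel" for A n
    using that
  proof (induction n arbitrary: A)
    case (Suc n)
    note [measurable] = Suc.prems
    define B where "B = {x \<in> A. F n x < a n \<bullet> x + b n}"
    have [measurable]: "B \<in> sets borel" "A - B \<in> sets borel" unfolding B_def by measurable
    have i1: "integrable R (\<lambda>z. indicator B (fst z) * (a n \<bullet> (snd z - fst z)))"
      by (rule Bochner_Integration.integrable_bound[OF Bochner_Integration.integrable_norm[OF integrable_inner_right[OF Bochner_Integration.integrable_diff[OF int(2,1)], of "a n"]]])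
        (measurable, auto simp: indicator_def)
    have i2: "integrable R (\<lambda>z. indicator D (fst z) * (F m (snd z) - F m (fst z)))"
      if [measurable]: "D \<in> sets borel" for m D
      by (rule Bochner_Integration.integrable_bound[OF Bochner_Integration.integrable_norm[OF Bochner_Integration.integrable_diff[OF intF(2)[of m] intF(1)[of m]]]])
        (measurable, auto simp: indicator_def)
    have "0 \<le> (\<integral>z. indicator B (fst z) * (a n \<bullet> (snd z - fst z)) \<partial>R)"
      using drift dual by (auto simp: cone_drift_def)
    moreover have "0 \<le> (\<integral>z. indicator (A - B) (fst z) * (F n (snd z) - F n (fst z)) \<partial>R)"
      by (rule Suc.IH) measurable
    moreover have "(\<integral>z. indicator B (fst z) * (a n \<bullet> (snd z - fst z)) \<partial>R) +
        (\<integral>z. indicator (A - B) (fst z) * (F n (snd z) - F n (fst z)) \<partial>R)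
      = (\<integral>z. indicator B (fst z) * (a n \<bullet> (snd z - fst z)) +
          indicator (A - B) (fst z) * (F n (snd z) - F n (fst z)) \<partial>R)"
      by (rule Bochner_Integration.integral_add[symmetric]) (intro i1 i2; measurable)+
    moreover have i3: "integrable R (\<lambda>z. indicator B (fst z) * (a n \<bullet> (snd z - fst z)) +
          indicator (A - B) (fst z) * (F n (snd z) - F n (fst z)))"
      by (intro Bochner_Integration.integrable_add i1 i2) measurable
    moreover have "(\<integral>z. indicator B (fst z) * (a n \<bullet> (snd z - fst z)) +
          indicator (A - B) (fst z) * (F n (snd z) - F n (fst z)) \<partial>R) \<le> (\<integral>z. indicator A (fst z) * (F (Suc n) (snd z) - F (Suc n) (fst z)) \<partial>R)"
    proof (rule integral_mono)
      show "integrable R (\<lambda>z. indicator A (fst z) * (F (Suc n) (snd z) - F (Suc n) (fst z)))"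
        by (rule i2) measurable
    next
      fix z
      show "indicator B (fst z) * (a n \<bullet> (snd z - fst z)) +
          indicator (A - B) (fst z) * (F n (snd z) - F n (fst z))
        \<le> indicator A (fst z) * (F (Suc n) (snd z) - F (Suc n) (fst z))"
        by (auto simp: B_def indicator_def FSuc inner_diff_right)
    qed (rule i3)
    ultimately show ?case by linarith
  qed (simp add: F0)
  have le: "(\<integral>\<^sup>+x. ennreal (F n x) \<partial>distr R borel fst) \<le> (\<integral>\<^sup>+x. ennreal (\<phi> x) \<partial>distr R borel snd)" for n
  proof -
    have "(\<integral>z. F n (fst z) \<partial>R) \<le> (\<integral>z. F n (snd z) \<partial>R)"
      using sub[of UNIV n] by (simp add: Bochner_Integration.integral_diff intF)
    then have "(\<integral>\<^sup>+z. ennreal (F n (fst z)) \<partial>R) \<le> (\<integral>\<^sup>+z. ennreal (F n (snd z)) \<partial>R)"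
      by (simp add: nn_integral_eq_integral intF F_nonneg ennreal_leI)
    also have "\<dots> = (\<integral>\<^sup>+x. ennreal (F n x) \<partial>distr R borel snd)"
      by (subst nn_integral_distr) auto
    also have "\<dots> \<le> (\<integral>\<^sup>+x. ennreal (\<phi> x) \<partial>distr R borel snd)"
      by (intro nn_integral_mono ennreal_leI F_le)
    finally show ?thesis by (subst nn_integral_distr) auto
  qed
  have inc: "incseq (\<lambda>n x. ennreal (F n x))"
    by (intro incseq_SucI le_funI ennreal_leI) (simp add: FSuc)
  have "(SUP n. ennreal (F n x)) = ennreal (\<phi> x)" for x
  proof (rule antisym)
    show "(SUP n. ennreal (F n x)) \<le> ennreal (\<phi> x)" by (intro SUP_least ennreal_leI F_le)
    show "ennreal (\<phi> x) \<le> (SUP n. ennreal (F n x))"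
    proof (rule ennreal_le_epsilon)
      fix e :: real assume "0 < e"
      then obtain k where "\<phi> x - e < a k \<bullet> x + b k" using ab(2) by blast
      then have "\<phi> x \<le> F (Suc k) x + e" by (simp add: FSuc)
      then have "ennreal (\<phi> x) \<le> ennreal (F (Suc k) x) + ennreal e"
        using \<open>0 < e\<close> F_nonneg by (simp add: ennreal_plus[symmetric] ennreal_leI del: ennreal_plus)
      also have "\<dots> \<le> (SUP n. ennreal (F n x)) + ennreal e" by (intro add_right_mono SUP_upper) auto
      finally show "ennreal (\<phi> x) \<le> (SUP n. ennreal (F n x)) + ennreal e" .
    qed
  qed
  then have "(\<integral>\<^sup>+x. ennreal (\<phi> x) \<partial>distr R borel fst) = (\<integral>\<^sup>+x. (SUP n. ennreal (F n x)) \<partial>distr R borel fst)"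
    by simp
  also have "\<dots> = (SUP n. \<integral>\<^sup>+x. ennreal (F n x) \<partial>distr R borel fst)"
    by (rule nn_integral_monotone_convergence_SUP[OF inc]) measurable
  also have "\<dots> \<le> (\<integral>\<^sup>+x. ennreal (\<phi> x) \<partial>distr R borel snd)" by (intro SUP_least le)
  finally show "(\<integral>\<^sup>+x. ennreal (\<phi> x) \<partial>distr R borel fst) \<le> (\<integral>\<^sup>+x. ennreal (\<phi> x) \<partial>distr R borel snd)" .
qed

section \<open>Drift of martingale laws\<close>

text \<open>Test on the set where the conditional expectation is negative: its integral there is
  nonnegative by hypothesis, so the set is null.\<close>

lemma AE_nonneg_real_cond_exp:
  assumes "sigma_finite_subalgebra M F" and W: "integrable M W"
    and pos: "\<And>A. A \<in> sets F \<Longrightarrow> 0 \<le> (\<integral>x\<in>A. W x \<partial>M)"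
  shows "AE x in M. 0 \<le> real_cond_exp M F W x"
proof -
  interpret sigma_finite_subalgebra M F by fact
  define h where "h = real_cond_exp M F W"
  have hF [measurable]: "h \<in> borel_measurable F" and hM [measurable]: "h \<in> borel_measurable M"
    unfolding h_def by auto
  have hi: "integrable M h" unfolding h_def by (rule real_cond_exp_int(1)[OF W])
  define B where "B = {x \<in> space F. h x < 0}"
  have B: "B \<in> sets F" unfolding B_def by measurable
  have sp: "space F = space M" using subalg by (simp add: subalgebra_def)
  have BM [measurable]: "B \<in> sets M" using B subalg by (auto simp: subalgebra_def)
  have "(\<integral>x\<in>B. W x \<partial>M) = (\<integral>x\<in>B. h x \<partial>M)"
    unfolding h_def by (rule real_cond_exp_intA[OF W B])
  then have "0 \<le> (\<integral>x. indicator B x * h x \<partial>M)"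
    using pos[OF B] by (simp add: set_lebesgue_integral_def)
  moreover have int: "integrable M (\<lambda>x. indicator B x * h x)"
    using integrable_mult_indicator[OF BM hi] by simp
  moreover have "0 \<le> (\<integral>x. - (indicator B x * h x) \<partial>M)"
    by (rule integral_nonneg_AE) (auto simp: B_def indicator_def)
  ultimately have "(\<integral>x. - (indicator B x * h x) \<partial>M) = 0"
    by simp
  then have "AE x in M. - (indicator B x * h x) = 0"
    by (subst (asm) integral_nonneg_eq_0_iff_AE) (use int in \<open>auto simp: B_def indicator_def\<close>)
  with AE_space show ?thesis
    unfolding h_def[symmetric] by eventually_elim (auto simp: B_def indicator_def sp split: if_splits)
qed

lemma coordinate_drift:
  fixes X Y :: "'w \<Rightarrow> real ^ 'n"
  assumes "prob_space M" and X: "integrable M X" and Y: "integrable M Y"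
    and A: "A \<in> sets borel"
  shows "(\<integral>\<omega>. indicator A (X \<omega>) * (Y \<omega> $ i - X \<omega> $ i) \<partial>M)
    = (\<integral>\<omega>. indicator A (X \<omega>) * (cond_exp_coord M X Y i \<omega> - X \<omega> $ i) \<partial>M)"
    and "integrable M (\<lambda>\<omega>. indicator A (X \<omega>) * (Y \<omega> $ i - X \<omega> $ i))"
proof -
  interpret prob_space M by fact
  note [measurable] = borel_measurable_integrable[OF X] borel_measurable_integrable[OF Y] A
  let ?F = "vimage_algebra (space M) X borel"
  interpret F: sigma_finite_subalgebra M ?F
    by (rule sigma_finite_subalgebra_vimage) (use \<open>prob_space M\<close> in auto)
  have Xi: "integrable M (\<lambda>\<omega>. X \<omega> $ i)" and Yi: "integrable M (\<lambda>\<omega>. Y \<omega> $ i)"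
    by (rule integrable_bounded_linear[OF bounded_linear_vec_nth], fact)+
  have AF: "X -` A \<inter> space M \<in> sets ?F" using A by (auto simp: sets_vimage_algebra2)
  have AM: "X -` A \<inter> space M \<in> sets M" by measurable
  have ind: "(\<integral>\<omega>. indicator A (X \<omega>) * f \<omega> \<partial>M) = (\<integral>\<omega>\<in>X -` A \<inter> space M. f \<omega> \<partial>M)" for f :: "'w \<Rightarrow> real"
    unfolding set_lebesgue_integral_def
    by (rule Bochner_Integration.integral_cong) (auto simp: indicator_def)
  have ii: "integrable M (\<lambda>\<omega>. indicator A (X \<omega>) * f \<omega>)" if "integrable M f" for f :: "'w \<Rightarrow> real"
    using integrable_mult_indicator[OF AM that]
    by (rule Bochner_Integration.integrable_cong[THEN iffD1, rotated 2]) (auto simp: indicator_def)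
  show "integrable M (\<lambda>\<omega>. indicator A (X \<omega>) * (Y \<omega> $ i - X \<omega> $ i))"
    by (intro ii Bochner_Integration.integrable_diff Xi Yi)
  have Ei: "integrable M (cond_exp_coord M X Y i)"
    unfolding cond_exp_coord_def by (rule F.real_cond_exp_int(1)[OF Yi])
  have "(\<integral>\<omega>. indicator A (X \<omega>) * (Y \<omega> $ i) \<partial>M)
    = (\<integral>\<omega>. indicator A (X \<omega>) * (cond_exp_coord M X Y i \<omega>) \<partial>M)"
    unfolding ind cond_exp_coord_def by (rule F.real_cond_exp_intA[OF Yi AF])
  then show "(\<integral>\<omega>. indicator A (X \<omega>) * (Y \<omega> $ i - X \<omega> $ i) \<partial>M)
    = (\<integral>\<omega>. indicator A (X \<omega>) * (cond_exp_coord M X Y i \<omega> - X \<omega> $ i) \<partial>M)"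
    by (simp add: right_diff_distrib Bochner_Integration.integral_diff ii Xi Yi Ei)
qed

text \<open>The set \<open>A\<close> pulls back to an event of \<open>\<sigma>(X)\<close>, so each
  coordinate of \<open>Y\<close> may be replaced by its conditional expectation.\<close>

lemma cone_drift_law:
  fixes X Y :: "'w \<Rightarrow> real ^ 'n"
  assumes "prob_space M" and X: "integrable M X" and Y: "integrable M Y"
  shows "cone_drift C (distr M (borel \<Otimes>\<^sub>M borel) (\<lambda>\<omega>. (X \<omega>, Y \<omega>))) \<longleftrightarrow>
    (\<forall>a. (\<forall>c\<in>C. 0 \<le> a \<bullet> c) \<longrightarrow> (\<forall>A\<in>sets borel.
      0 \<le> (\<Sum>i\<in>UNIV. a $ i * (\<integral>\<omega>. indicator A (X \<omega>) * (cond_exp_coord M X Y i \<omega> - X \<omega> $ i) \<partial>M))))"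
proof -
  note [measurable] = borel_measurable_integrable[OF X] borel_measurable_integrable[OF Y]
  have "(\<integral>z. indicator A (fst z) * (a \<bullet> (snd z - fst z)) \<partial>distr M (borel \<Otimes>\<^sub>M borel) (\<lambda>\<omega>. (X \<omega>, Y \<omega>)))
    = (\<Sum>i\<in>UNIV. a $ i * (\<integral>\<omega>. indicator A (X \<omega>) * (cond_exp_coord M X Y i \<omega> - X \<omega> $ i) \<partial>M))"
    if A [measurable]: "A \<in> sets borel" for A and a :: "real ^ 'n"
  proof -
    have "(\<integral>z. indicator A (fst z) * (a \<bullet> (snd z - fst z)) \<partial>distr M (borel \<Otimes>\<^sub>M borel) (\<lambda>\<omega>. (X \<omega>, Y \<omega>)))
      = (\<integral>\<omega>. indicator A (X \<omega>) * (a \<bullet> (Y \<omega> - X \<omega>)) \<partial>M)"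
      by (subst integral_distr) auto
    also have "\<dots> = (\<integral>\<omega>. (\<Sum>i\<in>UNIV. a $ i * (indicator A (X \<omega>) * (Y \<omega> $ i - X \<omega> $ i))) \<partial>M)"
      by (intro Bochner_Integration.integral_cong refl)
        (simp add: inner_vec_def sum_distrib_left mult_ac)
    also have "\<dots> = (\<Sum>i\<in>UNIV. a $ i * (\<integral>\<omega>. indicator A (X \<omega>) * (Y \<omega> $ i - X \<omega> $ i) \<partial>M))"
      by (simp add: Bochner_Integration.integral_sum coordinate_drift(2)[OF assms A])
    finally show ?thesis by (simp only: coordinate_drift(1)[OF assms A])
  qed
  then show ?thesis by (simp add: cone_drift_def)
qed

lemma martingale_pair_imp_cone_drift:
  fixes X Y :: "'w \<Rightarrow> real ^ 'n"
  assumes "martingale_pair M X Y"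
  shows "cone_drift {0} (distr M (borel \<Otimes>\<^sub>M borel) (\<lambda>\<omega>. (X \<omega>, Y \<omega>)))"
proof -
  have M: "prob_space M" "integrable M X" "integrable M Y"
    and eq: "AE \<omega> in M. \<forall>i. cond_exp_coord M X Y i \<omega> = X \<omega> $ i"
    using assms by (auto simp: martingale_pair_def)
  have "(\<integral>\<omega>. indicator A (X \<omega>) * (cond_exp_coord M X Y i \<omega> - X \<omega> $ i) \<partial>M) = 0" for A i
    by (rule integral_eq_zero_AE) (use eq in \<open>auto elim: eventually_mono\<close>)
  then show ?thesis unfolding cone_drift_law[OF M] by simp
qed

lemma submartingale_pair_imp_cone_drift:
  fixes X Y :: "'w \<Rightarrow> real ^ 'n"
  assumes "submartingale_pair M X Y"
  shows "cone_drift {c. 0 \<le> c} (distr M (borel \<Otimes>\<^sub>M borel) (\<lambda>\<omega>. (X \<omega>, Y \<omega>)))"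
proof -
  have M: "prob_space M" "integrable M X" "integrable M Y"
    and le: "AE \<omega> in M. \<forall>i. cond_exp_coord M X Y i \<omega> \<ge> X \<omega> $ i"
    using assms by (auto simp: submartingale_pair_def)
  have 1: "0 \<le> (\<integral>\<omega>. indicator A (X \<omega>) * (cond_exp_coord M X Y i \<omega> - X \<omega> $ i) \<partial>M)" for A i
    by (rule integral_nonneg_AE) (use le in \<open>auto elim: eventually_mono\<close>)
  \<comment> \<open>The dual of the nonnegative orthant is the orthant itself: test with unit
    vectors.\<close>
  have 2: "0 \<le> a $ i" if "\<forall>c\<in>{c. 0 \<le> c}. 0 \<le> a \<bullet> c" for a :: "real ^ 'n" and i
    using that[rule_format, of "axis i 1"] by (auto simp: less_eq_vec_def axis_def inner_axis[unfolded axis_def])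
  show ?thesis unfolding cone_drift_law[OF M]
    using 1 2 by (intro allI impI ballI sum_nonneg mult_nonneg_nonneg) auto
qed

text \<open>\<open>s\<close> serves as a sign: \<open>axis i s\<close> lies in the dual cone of
  \<open>C\<close>. For the orthant only \<open>s = 1\<close> is admissible and gives one
  inequality; for \<open>{0}\<close> both signs are, which gives equality.\<close>

lemma cone_drift_imp_cond_exp_ge:
  fixes R :: "((real ^ 'n) \<times> (real ^ 'n)) measure"
  assumes "prob_space R" and setsR: "sets R = sets (borel \<Otimes>\<^sub>M borel)"
    and int: "integrable R fst" "integrable R snd"
    and drift: "cone_drift C R" and a: "\<And>c. c \<in> C \<Longrightarrow> 0 \<le> s * c $ i"
  shows "AE z in R. 0 \<le> s * (cond_exp_coord R fst snd i z - fst z $ i)"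
proof -
  interpret prob_space R by fact
  let ?F = "vimage_algebra (space R) fst borel"
  interpret F: sigma_finite_subalgebra R ?F
    by (rule sigma_finite_subalgebra_vimage) (use \<open>prob_space R\<close> in \<open>auto simp: setsR cong: measurable_cong_sets\<close>)
  have X: "integrable R (\<lambda>z. fst z $ i)" and Y: "integrable R (\<lambda>z. snd z $ i)"
    by (rule integrable_bounded_linear[OF bounded_linear_vec_nth], fact)+
  define W where "W z = s * (snd z $ i - fst z $ i)" for z :: "(real ^ 'n) \<times> (real ^ 'n)"
  have W: "integrable R W" unfolding W_def by (intro integrable_mult_right Bochner_Integration.integrable_diff X Y)
  have "AE z in R. 0 \<le> real_cond_exp R ?F W z"
  proof (rule AE_nonneg_real_cond_exp[OF _ W])
    show "sigma_finite_subalgebra R ?F" by unfold_locales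
    fix A assume "A \<in> sets ?F"
    then obtain B where B: "B \<in> sets borel" and A: "A = fst -` B \<inter> space R"
      by (auto simp: sets_vimage_algebra2)
    have "(\<integral>z\<in>A. W z \<partial>R) = (\<integral>z. indicator B (fst z) * (axis i s \<bullet> (snd z - fst z)) \<partial>R)"
      unfolding set_lebesgue_integral_def
      by (intro Bochner_Integration.integral_cong refl) (auto simp: A W_def indicator_def inner_axis' )
    also have "0 \<le> \<dots>" using drift[unfolded cone_drift_def, rule_format, of "axis i s" B] B a
      by (simp add: inner_axis')
    finally show "0 \<le> (\<integral>z\<in>A. W z \<partial>R)" .
  qed
  moreover have "AE z in R. real_cond_exp R ?F W z = s * (real_cond_exp R ?F (\<lambda>z. snd z $ i - fst z $ i) z)"
    unfolding W_def by (rule F.real_cond_exp_cmult) (intro Bochner_Integration.integrable_diff X Y)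
  moreover have "AE z in R. real_cond_exp R ?F (\<lambda>z. snd z $ i - fst z $ i) z
      = real_cond_exp R ?F (\<lambda>z. snd z $ i) z - real_cond_exp R ?F (\<lambda>z. fst z $ i) z"
    by (rule F.real_cond_exp_diff[OF Y X])
  moreover have "AE z in R. real_cond_exp R ?F (\<lambda>z. fst z $ i) z = fst z $ i"
  proof (rule F.real_cond_exp_F_meas[OF X])
    have "fst \<in> ?F \<rightarrow>\<^sub>M borel" by (rule measurable_vimage_algebra1) auto
    then show "(\<lambda>z. fst z $ i) \<in> borel_measurable ?F"
      by (rule measurable_compose) (intro borel_measurable_continuous_onI continuous_intros)
  qed
  ultimately show ?thesis
    unfolding cond_exp_coord_def by eventually_elim simp
qed

lemma cone_drift_imp_martingale_laws:
  fixes R :: "((real ^ 'n) \<times> (real ^ 'n)) measure"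
  assumes "prob_space R" "sets R = sets (borel \<Otimes>\<^sub>M borel)"
    and "integrable R fst" "integrable R snd" and drift: "cone_drift {0} R"
  shows "R \<in> martingale_laws"
proof -
  have 1: "AE z in R. 0 \<le> 1 * (cond_exp_coord R fst snd i z - fst z $ i)" for i
    by (rule cone_drift_imp_cond_exp_ge[OF assms]) auto
  have 2: "AE z in R. 0 \<le> -1 * (cond_exp_coord R fst snd i z - fst z $ i)" for i
    by (rule cone_drift_imp_cond_exp_ge[OF assms]) auto
  have "AE z in R. cond_exp_coord R fst snd i z = fst z $ i" for i
    using 1[of i] 2[of i] by eventually_elim simp
  then have "martingale_pair R fst snd"
    using assms by (simp add: martingale_pair_def AE_all_countable)
  from martingale_laws_I[OF this] show ?thesis using assms(2) by (simp add: distr_id2)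
qed

lemma cone_drift_imp_submartingale_laws:
  fixes R :: "((real ^ 'n) \<times> (real ^ 'n)) measure"
  assumes "prob_space R" "sets R = sets (borel \<Otimes>\<^sub>M borel)"
    and "integrable R fst" "integrable R snd" and drift: "cone_drift {c. 0 \<le> c} R"
  shows "R \<in> submartingale_laws"
proof -
  have 1: "AE z in R. 0 \<le> 1 * (cond_exp_coord R fst snd i z - fst z $ i)" for i
    by (rule cone_drift_imp_cond_exp_ge[OF assms]) (auto simp: less_eq_vec_def)
  then have "submartingale_pair R fst snd"
    using assms by (simp add: submartingale_pair_def AE_all_countable)
  from submartingale_laws_I[OF this] show ?thesis using assms(2) by (simp add: distr_id2)
qed

section \<open>Moves and concave envelopes\<close>

text \<open>A law of \<open>V\<close> with at most \<open>k\<close> atoms, listed as pairs of weight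
  and displacement. Encoding it as a sequence places \<open>moves C k\<close> in a second countable
  product space, the source of countable dense subsets.\<close>

definition moves :: "'a::euclidean_space set \<Rightarrow> nat \<Rightarrow> (nat \<Rightarrow> real \<times> 'a) set" where
  "moves C k = {z. (\<forall>i<k. 0 \<le> fst (z i)) \<and> (\<Sum>i<k. fst (z i)) = 1 \<and>
     (\<Sum>i<k. fst (z i) *\<^sub>R snd (z i)) \<in> C}"

definition move_mean :: "nat \<Rightarrow> (nat \<Rightarrow> real \<times> 'a::euclidean_space) \<Rightarrow> ('a \<Rightarrow> real) \<Rightarrow> 'a \<Rightarrow> real" where
  "move_mean k z f x = (\<Sum>i<k. fst (z i) * f (x + snd (z i)))"

lemma move_mean_mono:
  assumes "z \<in> moves C k" "\<And>x. f x \<le> g x"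
  shows "move_mean k z f x \<le> move_mean k z g x"
  using assms by (auto simp: move_mean_def moves_def intro!: sum_mono mult_left_mono)

lemma move_mean_const: "z \<in> moves C k \<Longrightarrow> move_mean k z (\<lambda>_. c) x = c"
  by (simp add: move_mean_def moves_def flip: sum_distrib_right)

lemma move_mean_sum: "move_mean k z (\<lambda>y. \<Sum>j\<in>J. l j * f j y) x = (\<Sum>j\<in>J. l j * move_mean k z (f j) x)"
  unfolding move_mean_def sum_distrib_left by (subst sum.swap) (simp add: mult_ac)

lemma continuous_on_move_mean:
  assumes "continuous_on UNIV f"
  shows "continuous_on UNIV (move_mean k z f)"
  unfolding move_mean_def
  by (intro continuous_intros continuous_on_compose2[OF assms]) auto

lemma stay_move: "0 \<in> C \<Longrightarrow> (\<lambda>_. (1, 0)) \<in> moves C 1" "move_mean 1 (\<lambda>_. (1, 0)) f x = f x"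
  by (auto simp: moves_def move_mean_def)

lemma sum_append:
  fixes g h :: "nat \<Rightarrow> 'b::comm_monoid_add"
  shows "(\<Sum>i<k + k'. if i < k then g i else h (i - k)) = (\<Sum>i<k. g i) + (\<Sum>i<k'. h i)"
  by (induction k') (auto simp: add.assoc)

text \<open>The reason for concavity of the envelope: with probabilities \<open>s\<close> and
  \<open>t\<close>, jump from \<open>u = s *\<^sub>R x + t *\<^sub>R y\<close> to where the moves
  from \<open>x\<close> or from \<open>y\<close> would lead. The offsets \<open>x - u\<close> and
  \<open>y - u\<close> average to 0, so the new mean is a convex combination of two elements of
  \<open>C\<close>.\<close>

lemma combine_moves:
  assumes C: "convex C" and z: "z \<in> moves C k" "z' \<in> moves C k'" and s: "0 \<le> s" "0 \<le> t" "s + t = 1"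
  obtains w where "w \<in> moves C (k + k')"
    "\<And>f. move_mean (k + k') w f (s *\<^sub>R x + t *\<^sub>R y) = s * move_mean k z f x + t * move_mean k' z' f y"
proof
  define u where "u = s *\<^sub>R x + t *\<^sub>R y"
  define w where "w i = (if i < k then (s * fst (z i), x + snd (z i) - u)
    else (t * fst (z' (i - k)), y + snd (z' (i - k)) - u))" for i
  have W: "(\<Sum>i<k + k'. F (fst (w i)) (snd (w i)))
      = (\<Sum>i<k. F (s * fst (z i)) (x + snd (z i) - u)) + (\<Sum>i<k'. F (t * fst (z' i)) (y + snd (z' i) - u))"
    for F :: "real \<Rightarrow> 'a \<Rightarrow> 'b::comm_monoid_add"
    unfolding sum_append[symmetric] by (intro sum.cong) (auto simp: w_def)
  have one: "(\<Sum>i<k. fst (z i)) = 1" "(\<Sum>i<k'. fst (z' i)) = 1" using z by (auto simp: moves_def)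
  show "w \<in> moves C (k + k')"
    unfolding moves_def
  proof (intro CollectI conjI allI impI)
    show "0 \<le> fst (w i)" if "i < k + k'" for i
      using z s that by (auto simp: w_def moves_def)
    show "(\<Sum>i<k + k'. fst (w i)) = 1"
      using W[of "\<lambda>a b. a"] s(3) one by (simp flip: sum_distrib_left)
    have 1: "(\<Sum>i<k. (s * fst (z i)) *\<^sub>R (x + snd (z i) - u))
      = s *\<^sub>R (x - u) + s *\<^sub>R (\<Sum>i<k. fst (z i) *\<^sub>R snd (z i))"
    proof -
      have "(\<Sum>i<k. (s * fst (z i)) *\<^sub>R (x + snd (z i) - u))
        = (\<Sum>i<k. fst (z i) *\<^sub>R (s *\<^sub>R (x - u)) + s *\<^sub>R (fst (z i) *\<^sub>R snd (z i)))"
        by (intro sum.cong) (auto simp: algebra_simps)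
      also have "\<dots> = (\<Sum>i<k. fst (z i)) *\<^sub>R (s *\<^sub>R (x - u)) + s *\<^sub>R (\<Sum>i<k. fst (z i) *\<^sub>R snd (z i))"
        by (simp only: sum.distrib scaleR_left.sum scaleR_right.sum)
      finally show ?thesis by (simp add: one)
    qed
    have 2: "(\<Sum>i<k'. (t * fst (z' i)) *\<^sub>R (y + snd (z' i) - u))
      = t *\<^sub>R (y - u) + t *\<^sub>R (\<Sum>i<k'. fst (z' i) *\<^sub>R snd (z' i))"
    proof -
      have "(\<Sum>i<k'. (t * fst (z' i)) *\<^sub>R (y + snd (z' i) - u))
        = (\<Sum>i<k'. fst (z' i) *\<^sub>R (t *\<^sub>R (y - u)) + t *\<^sub>R (fst (z' i) *\<^sub>R snd (z' i)))"
        by (intro sum.cong) (auto simp: algebra_simps)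
      also have "\<dots> = (\<Sum>i<k'. fst (z' i)) *\<^sub>R (t *\<^sub>R (y - u)) + t *\<^sub>R (\<Sum>i<k'. fst (z' i) *\<^sub>R snd (z' i))"
        by (simp only: sum.distrib scaleR_left.sum scaleR_right.sum)
      finally show ?thesis by (simp add: one)
    qed
    have 3: "s *\<^sub>R (x - u) + t *\<^sub>R (y - u) = 0"
    proof -
      have "s *\<^sub>R (x - u) + t *\<^sub>R (y - u) = u - (s + t) *\<^sub>R u"
        by (simp add: u_def algebra_simps)
      then show ?thesis by (simp add: s(3))
    qed
    have "(\<Sum>i<k + k'. fst (w i) *\<^sub>R snd (w i))
      = s *\<^sub>R (\<Sum>i<k. fst (z i) *\<^sub>R snd (z i)) + t *\<^sub>R (\<Sum>i<k'. fst (z' i) *\<^sub>R snd (z' i))"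
      using 3 unfolding W[of "\<lambda>a b. a *\<^sub>R b"] 1 2 by (simp add: algebra_simps)
    also have "\<dots> \<in> C" using C z s by (auto simp: convex_def moves_def)
    finally show "(\<Sum>i<k + k'. fst (w i) *\<^sub>R snd (w i)) \<in> C" .
  qed
  show "move_mean (k + k') w f (s *\<^sub>R x + t *\<^sub>R y) = s * move_mean k z f x + t * move_mean k' z' f y" for f
    using W[of "\<lambda>a b. a * f (u + b)"]
    by (simp add: move_mean_def u_def[symmetric] sum_distrib_left mult_ac)
qed

text \<open>A step \<open>c\<close> in \<open>C\<close> followed by a move is again a move; this
  makes the envelope decrease along \<open>C\<close>.\<close>

lemma shift_move:
  assumes C: "\<And>b c. b \<in> C \<Longrightarrow> c \<in> C \<Longrightarrow> b + c \<in> C" and z: "z \<in> moves C k" and c: "c \<in> C"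
  shows "(\<lambda>i. (fst (z i), c + snd (z i))) \<in> moves C k"
    and "move_mean k (\<lambda>i. (fst (z i), c + snd (z i))) f x = move_mean k z f (x + c)"
proof -
  have "(\<Sum>i<k. fst (z i) *\<^sub>R (c + snd (z i))) = (\<Sum>i<k. fst (z i)) *\<^sub>R c + (\<Sum>i<k. fst (z i) *\<^sub>R snd (z i))"
    by (simp only: scaleR_add_right sum.distrib scaleR_left.sum)
  then show "(\<lambda>i. (fst (z i), c + snd (z i))) \<in> moves C k"
    using C z c by (auto simp: moves_def)
qed (simp add: move_mean_def add.assoc)

text \<open>\<open>move_mean k z f x\<close> is continuous in \<open>z\<close>, so one list that is
  dense in every \<open>moves C k\<close> serves all continuous \<open>f\<close> and all
  \<open>x\<close> at once.\<close>

lemma countable_dense_moves: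
  fixes C :: "'a::euclidean_space set"
  assumes "0 \<in> C"
  obtains move_len :: "nat \<Rightarrow> nat" and move :: "nat \<Rightarrow> nat \<Rightarrow> real \<times> 'a"
  where "\<And>m. move m \<in> moves C (move_len m)"
    and "\<And>k z f x e. z \<in> moves C k \<Longrightarrow> continuous_on UNIV f \<Longrightarrow> 0 < e \<Longrightarrow>
           \<exists>m. move_mean k z f x - e < move_mean (move_len m) (move m) f x"
proof -
  have "\<exists>T. countable T \<and> T \<subseteq> moves C k \<and> (\<forall>U. open U \<longrightarrow> U \<inter> moves C k \<noteq> {} \<longrightarrow> U \<inter> T \<noteq> {})" for k
    using countable_dense_subset[of "moves C k"] by metis
  then obtain T where T: "\<And>k. countable (T k)" "\<And>k. T k \<subseteq> moves C k"
    "\<And>k U. open U \<Longrightarrow> U \<inter> moves C k \<noteq> {} \<Longrightarrow> U \<inter> T k \<noteq> {}" by metis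
  define Z where "Z = Sigma UNIV T"
  have dense: "\<exists>p\<in>Z. move_mean k z f x - e < move_mean (fst p) (snd p) f x"
    if z: "z \<in> moves C k" and f: "continuous_on UNIV f" and e: "0 < e" for k z f x e
  proof -
    have "continuous_on UNIV (\<lambda>w. move_mean k w f x)"
      unfolding move_mean_def
      by (intro continuous_intros continuous_on_compose2[OF f] continuous_on_compose2[OF continuous_on_fst]
          continuous_on_compose2[OF continuous_on_snd] continuous_on_product_coordinates) auto
    then have "open {w. move_mean k z f x - e < move_mean k w f x}"
      by (intro open_Collect_less continuous_intros)
    moreover have "z \<in> {w. move_mean k z f x - e < move_mean k w f x} \<inter> moves C k" using z e by simp
    ultimately have "{w. move_mean k z f x - e < move_mean k w f x} \<inter> T k \<noteq> {}"
      using T(3) by blast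
    then obtain w where "w \<in> T k" "move_mean k z f x - e < move_mean k w f x" by blast
    then show ?thesis by (intro bexI[of _ "(k, w)"]) (auto simp: Z_def)
  qed
  have "countable Z" unfolding Z_def using T(1) by auto
  have "Z \<noteq> {}" using dense[OF stay_move(1)[OF assms], of "\<lambda>_. 0" 1] by auto
  then have rZ: "range (from_nat_into Z) = Z" using \<open>countable Z\<close> by (rule range_from_nat_into)
  show thesis
  proof
    show "snd (from_nat_into Z m) \<in> moves C (fst (from_nat_into Z m))" for m
      using from_nat_into[OF \<open>Z \<noteq> {}\<close>, of m] by (auto simp: Z_def intro: subsetD[OF T(2)])
    show "\<exists>m. move_mean k z f x - e < move_mean (fst (from_nat_into Z m)) (snd (from_nat_into Z m)) f x"
      if "z \<in> moves C k" "continuous_on UNIV f" "0 < e" for k z f x e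
      using dense[OF that, of x] rZ by (metis imageE)
  qed
qed

text \<open>For \<open>C = {0}\<close> and \<open>g\<close> bounded above, the least concave
  majorant of \<open>g\<close>. Without an upper bound the real \<open>Sup\<close> would be
  meaningless, whence the constant \<open>c\<close> below.\<close>

definition envelope :: "'a::euclidean_space set \<Rightarrow> ('a \<Rightarrow> real) \<Rightarrow> 'a \<Rightarrow> real" where
  "envelope C g x = Sup {move_mean k z g x |k z. z \<in> moves C k}"

text \<open>The last three facts say that \<open>c - envelope C g\<close> is nonnegative, convex and
  increasing along \<open>C\<close>, that is, a test function of \<open>cone_le\<close>.\<close>

lemma envelope:
  fixes g :: "'a::euclidean_space \<Rightarrow> real"
  assumes C: "convex_cone C" and g: "\<And>x. g x \<le> c"
  shows "\<And>k z. z \<in> moves C k \<Longrightarrow> move_mean k z g x \<le> envelope C g x"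
    and "\<And>e. 0 < e \<Longrightarrow> \<exists>k z. z \<in> moves C k \<and> envelope C g x - e < move_mean k z g x"
    and "g x \<le> envelope C g x" and "envelope C g x \<le> c"
    and "convex_on UNIV (\<lambda>x. c - envelope C g x)"
    and "b \<in> C \<Longrightarrow> envelope C g (x + b) \<le> envelope C g x"
proof -
  have C0: "0 \<in> C" and conv: "convex C" and add: "\<And>a b. a \<in> C \<Longrightarrow> b \<in> C \<Longrightarrow> a + b \<in> C"
    using C by (auto simp: convex_cone_def convex_cone_contains_0 cone_def conic_def intro: convex_cone_add)
  have le_c: "move_mean k z g x \<le> c" if "z \<in> moves C k" for k z x
    using move_mean_mono[OF that, of g "\<lambda>_. c" x] g by (simp add: move_mean_const[OF that])
  have bdd: "bdd_above {move_mean k z g x |k z. z \<in> moves C k}" for x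
    using le_c by (auto intro!: bdd_aboveI[of _ c])
  have ne: "{move_mean k z g x |k z. z \<in> moves C k} \<noteq> {}" for x using stay_move(1)[OF C0] by blast
  show up: "move_mean k z g x \<le> envelope C g x" if "z \<in> moves C k" for k z x
    unfolding envelope_def by (rule cSup_upper) (use that bdd in auto)
  show near: "\<exists>k z. z \<in> moves C k \<and> envelope C g x - e < move_mean k z g x" if "0 < e" for e x
    using less_cSupD[OF ne, of "envelope C g x - e" x] that unfolding envelope_def by auto
  show "g x \<le> envelope C g x" using up[OF stay_move(1)[OF C0], of x] unfolding stay_move(2) .
  show "envelope C g x \<le> c" unfolding envelope_def by (rule cSup_least[OF ne]) (use le_c in auto)
  show "convex_on UNIV (\<lambda>x. c - envelope C g x)"
  proof (intro convex_onI)
    fix t :: real and x y :: 'a assume t: "0 < t" "t < 1"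
    define u where "u = (1 - t) *\<^sub>R x + t *\<^sub>R y"
    have "(1 - t) * envelope C g x + t * envelope C g y \<le> envelope C g u"
    proof (rule field_le_epsilon)
      fix e :: real assume e: "0 < e"
      obtain k z where z: "z \<in> moves C k" "envelope C g x - e < move_mean k z g x" using near[OF e] by blast
      obtain k' z' where z': "z' \<in> moves C k'" "envelope C g y - e < move_mean k' z' g y" using near[OF e] by blast
      obtain w where w: "w \<in> moves C (k + k')" "move_mean (k + k') w g u = (1 - t) * move_mean k z g x + t * move_mean k' z' g y"
        using combine_moves[OF conv z(1) z'(1), of "1 - t" t x y] t unfolding u_def by auto
      have "(1 - t) * (envelope C g x - e) + t * (envelope C g y - e) \<le> move_mean (k + k') w g u"
        unfolding w(2) using z z' t by (intro add_mono mult_left_mono) auto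
      also have "\<dots> \<le> envelope C g u" by (rule up[OF w(1)])
      finally show "(1 - t) * envelope C g x + t * envelope C g y \<le> envelope C g u + e"
        by (simp add: algebra_simps)
    qed
    then show "c - envelope C g ((1 - t) *\<^sub>R x + t *\<^sub>R y) \<le> (1 - t) * (c - envelope C g x) + t * (c - envelope C g y)"
      by (simp add: u_def algebra_simps)
  qed simp
  show "envelope C g (x + b) \<le> envelope C g x" if b: "b \<in> C"
  proof (rule field_le_epsilon)
    fix e :: real assume e: "0 < e"
    obtain k z where z: "z \<in> moves C k" "envelope C g (x + b) - e < move_mean k z g (x + b)" using near[OF e] by blast
    then show "envelope C g (x + b) \<le> envelope C g x + e"
      using up[OF shift_move(1)[OF add z(1) b], of x] shift_move(2)[OF add z(1) b, of g x] by simp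
  qed
qed

section \<open>A countable family of kernels\<close>

text \<open>Codes for the candidate kernels, countable by construction. Rational coefficients
  suffice by approximation; \<open>Average\<close> supplies the midpoints required by the
  separation.\<close>

datatype blend = Greedy "rat list" nat | Average blend blend

instance blend :: countable by countable_datatype

locale candidate_kernels =
  fixes C :: "'a::euclidean_space set"
    and move_len :: "nat \<Rightarrow> nat" and move :: "nat \<Rightarrow> nat \<Rightarrow> real \<times> 'a"
    and f :: "nat \<Rightarrow> 'a \<Rightarrow> real"
  assumes C: "convex_cone C"
    and move: "\<And>m. move m \<in> moves C (move_len m)"
    and move_dense: "\<And>k z g x e. z \<in> moves C k \<Longrightarrow> continuous_on UNIV g \<Longrightarrow> 0 < e \<Longrightarrow>
           \<exists>m. move_mean k z g x - e < move_mean (move_len m) (move m) g x"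
    and f_cont: "\<And>j. continuous_on UNIV (f j)"
    and f_0: "f 0 = norm"
    and f_range: "\<And>j x. j \<noteq> 0 \<Longrightarrow> 0 \<le> f j x \<and> f j x \<le> 1"
begin

definition move_test :: "nat \<Rightarrow> nat \<Rightarrow> 'a \<Rightarrow> real" where
  "move_test j m x = move_mean (move_len m) (move m) (f j) x"

text \<open>Ties go to the smallest index, so that exactly one move is selected at each point, by
  finitely many measurable comparisons.\<close>

definition best_move :: "rat list \<Rightarrow> nat \<Rightarrow> nat \<Rightarrow> 'a \<Rightarrow> bool" where
  "best_move l N m x \<longleftrightarrow> (let F = (\<lambda>m. \<Sum>j<length l. of_rat (l ! j) * move_test j m x) in
     m \<le> N \<and> (\<forall>m'\<le>N. F m' \<le> F m) \<and> (\<forall>m'<m. F m' < F m))"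

primrec weight :: "blend \<Rightarrow> nat \<Rightarrow> 'a \<Rightarrow> real" where
  "weight (Greedy l N) m x = of_bool (best_move l N m x)"
| "weight (Average S T) m x = (weight S m x + weight T m x) / 2"

primrec last_move :: "blend \<Rightarrow> nat" where
  "last_move (Greedy l N) = N"
| "last_move (Average S T) = max (last_move S) (last_move T)"

lemma f_nonneg: "0 \<le> f j x"
  using f_range[of j x] by (cases "j = 0") (auto simp: f_0)

lemma f_measurable [measurable]: "f j \<in> borel_measurable borel"
  by (intro borel_measurable_continuous_onI f_cont)

lemma move_test_nonneg: "0 \<le> move_test j m x"
  using move_mean_mono[OF move, of "\<lambda>_. 0" "f j" m x] by (simp add: move_test_def move_mean_const[OF move] f_nonneg)

lemma move_test_measurable [measurable]: "move_test j m \<in> borel_measurable borel"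
  unfolding move_test_def[abs_def]
  by (intro borel_measurable_continuous_onI continuous_on_move_mean f_cont)

lemma best_move_measurable [measurable]: "Measurable.pred borel (best_move l N m)"
  unfolding best_move_def[abs_def] Let_def by measurable

lemma weight_measurable [measurable]: "weight T m \<in> borel_measurable borel"
proof (induction T)
  case (Average S T)
  note Average[measurable]
  show ?case unfolding weight.simps[abs_def] by measurable
qed simp

lemma best_move_unique: "\<exists>!m. best_move l N m x"
proof -
  define F where "F m = (\<Sum>j<length l. real_of_rat (l ! j) * move_test j m x)" for m
  have best_move: "best_move l N m x \<longleftrightarrow> m \<le> N \<and> (\<forall>m'\<le>N. F m' \<le> F m) \<and> (\<forall>m'<m. F m' < F m)" for m
    by (simp add: best_move_def F_def)
  define K where "K m \<longleftrightarrow> m \<le> N \<and> (\<forall>m'\<le>N. F m' \<le> F m)" for m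
  have "Max (F ` {..N}) \<in> F ` {..N}" by (rule Max_in) auto
  then obtain m where m: "m \<le> N" "F m = Max (F ` {..N})" by (metis atMost_iff imageE)
  then have "K m" unfolding K_def by simp
  then have L: "K (LEAST m. K m)" by (rule LeastI)
  have "best_move l N (LEAST m. K m) x"
    unfolding best_move
  proof (intro conjI allI impI)
    fix m' assume m': "m' < (LEAST m. K m)"
    then have "\<not> K m'" by (rule not_less_Least)
    moreover have "m' \<le> N" using m' L by (simp add: K_def)
    ultimately obtain m'' where "m'' \<le> N" "F m' < F m''" unfolding K_def by (auto simp: not_le)
    then show "F m' < F (LEAST m. K m)" using L by (fastforce simp: K_def)
  qed (use L[unfolded K_def[of "LEAST m. K m"]] in blast)+
  moreover have "m' \<le> m" if m: "best_move l N m x" "best_move l N m' x" for m m'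
  proof (rule ccontr)
    assume "\<not> m' \<le> m"
    then have "F m < F m'" using m(2) by (simp add: best_move)
    moreover have "F m' \<le> F m" using m unfolding best_move by blast
    ultimately show False by simp
  qed
  ultimately show ?thesis by (metis order_antisym)
qed

lemma best_move_le: "best_move l N m x \<Longrightarrow> m \<le> N"
  by (simp add: best_move_def Let_def)

lemma weight_nonneg: "0 \<le> weight T m x"
  by (induction T) auto

lemma weight_0: "last_move T < m \<Longrightarrow> weight T m x = 0"
  by (induction T) (auto dest: best_move_le)

lemma weight_sum: "last_move T \<le> K \<Longrightarrow> (\<Sum>m\<le>K. weight T m x) = 1"
proof (induction T)
  case (Greedy l N)
  obtain m where m: "\<And>m'. best_move l N m' x \<longleftrightarrow> m' = m" using best_move_unique by metis
  have "m \<le> K" using best_move_le[of l N m x] m Greedy by simp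
  have "(\<Sum>m'\<le>K. weight (Greedy l N) m' x) = (\<Sum>m'\<le>K. if m' = m then 1 else 0)"
    by (intro sum.cong) (simp_all add: m)
  then show ?case using \<open>m \<le> K\<close> by simp
next
  case (Average S T)
  then show ?case by (simp add: sum.distrib flip: sum_divide_distrib)
qed

text \<open>The kernel \<open>T\<close> applied to the test function:
  \<open>E[f j (X + V) | X = x]\<close>.\<close>

definition kernel_test :: "blend \<Rightarrow> nat \<Rightarrow> 'a \<Rightarrow> real" where
  "kernel_test T j x = (\<Sum>m\<le>last_move T. weight T m x * move_test j m x)"

lemma kernel_test_eq: "last_move T \<le> K \<Longrightarrow> kernel_test T j x = (\<Sum>m\<le>K. weight T m x * move_test j m x)"
  unfolding kernel_test_def by (rule sum.mono_neutral_left) (auto simp: weight_0)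

lemma kernel_test_Average: "kernel_test (Average S T) j x = (kernel_test S j x + kernel_test T j x) / 2"
  unfolding kernel_test_eq[of S "last_move (Average S T)", simplified] kernel_test_eq[of T "last_move (Average S T)", simplified]
    kernel_test_def[of "Average S T"]
  by (simp add: sum_divide_distrib add_divide_distrib distrib_right sum.distrib)

lemma kernel_test_measurable [measurable]: "kernel_test T j \<in> borel_measurable borel"
  unfolding kernel_test_def[abs_def] by measurable

lemma move_test_le: "\<exists>B. \<forall>x. move_test j m x \<le> norm x + B"
proof (intro exI[of _ "1 + move_mean (move_len m) (move m) norm 0"] allI)
  fix x
  have f_le: "f j y \<le> norm x + (1 + norm (y - x))" for y
  proof (cases "j = 0")
    case True
    then show ?thesis using norm_triangle_sub[of y x] by (simp add: f_0)
  next
    case False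
    then show ?thesis using f_range[of j y] norm_ge_zero[of x] norm_ge_zero[of "y - x"] by linarith
  qed
  have "f j (x + v) \<le> norm x + (1 + norm v)" for v using f_le[of "x + v"] by simp
  then have "move_test j m x \<le> (\<Sum>i<move_len m. fst (move m i) * (norm x + (1 + norm (snd (move m i)))))"
    unfolding move_test_def move_mean_def using move[of m]
    by (intro sum_mono mult_left_mono) (auto simp: moves_def)
  also have "\<dots> = (\<Sum>i<move_len m. fst (move m i)) * (norm x + 1) + move_mean (move_len m) (move m) norm 0"
    by (simp add: move_mean_def sum_distrib_left sum.distrib algebra_simps)
  finally show "move_test j m x \<le> norm x + (1 + move_mean (move_len m) (move m) norm 0)"
    using move[of m] by (simp add: moves_def)
qed

lemma integrable_move_test:
  assumes "prob_space \<mu>" and [measurable_cong]: "sets \<mu> = sets borel" and "integrable \<mu> norm"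
  shows "integrable \<mu> (move_test j m)"
proof -
  interpret prob_space \<mu> by fact
  obtain B where B: "\<And>x. move_test j m x \<le> norm x + B" using move_test_le by blast
  have "norm (move_test j m x) \<le> norm (norm x + B)" for x
    using B[of x] move_test_nonneg[of j m x] by simp
  then have "AE x in \<mu>. norm (move_test j m x) \<le> norm (norm x + B)" by simp
  moreover have "integrable \<mu> (\<lambda>x. norm x + B)" using assms(3) by simp
  ultimately show ?thesis by (intro Bochner_Integration.integrable_bound[of \<mu> "\<lambda>x. norm x + B" "move_test j m"]) simp_all
qed

lemma integrable_kernel_test:
  assumes "prob_space \<mu>" and [measurable_cong]: "sets \<mu> = sets borel" and "integrable \<mu> norm"
  shows "integrable \<mu> (kernel_test T j)"
proof -
  have "integrable \<mu> (\<lambda>x. weight T m x * move_test j m x)" for m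
  proof (rule Bochner_Integration.integrable_bound[OF integrable_move_test[OF assms, of j m]])
    have "weight T m x \<le> 1" for x
    proof (cases "m \<le> last_move T")
      case True
      then have "weight T m x \<le> (\<Sum>m\<le>last_move T. weight T m x)"
        by (intro member_le_sum weight_nonneg) auto
      then show ?thesis by (simp add: weight_sum)
    qed (simp add: weight_0)
    then show "AE x in \<mu>. norm (weight T m x * move_test j m x) \<le> norm (move_test j m x)"
      by (auto simp: abs_mult weight_nonneg move_test_nonneg intro!: mult_left_le_one_le)
  qed measurable
  then show ?thesis unfolding kernel_test_def[abs_def] by (intro Bochner_Integration.integrable_sum)
qed

text \<open>The greedy kernel is optimal for the rational coefficients. Passing from the real to the
  rational ones costs at most \<open>d\<close> times the sum of all test values involved, once for
  the competitor \<open>m\<close> and once for the selected move.\<close>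

lemma kernel_test_Greedy_ge:
  fixes c :: "nat \<Rightarrow> real"
  assumes m: "m \<le> N" and close: "\<And>j. j < length l \<Longrightarrow> \<bar>c j - of_rat (l ! j)\<bar> \<le> d"
  shows "(\<Sum>j<length l. c j * move_test j m x)
    \<le> (\<Sum>j<length l. c j * kernel_test (Greedy l N) j x) + 2 * d * (\<Sum>j<length l. \<Sum>m\<le>N. move_test j m x)"
proof -
  obtain b where b: "\<And>m'. best_move l N m' x \<longleftrightarrow> m' = b" using best_move_unique by metis
  have "b \<le> N" using best_move_le[of l N b x] b by simp
  have k: "kernel_test (Greedy l N) j x = move_test j b x" for j
  proof -
    have "kernel_test (Greedy l N) j x = (\<Sum>m\<le>N. if m = b then move_test j b x else 0)"
      unfolding kernel_test_def by (intro sum.cong) (simp_all add: b)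
    then show ?thesis using \<open>b \<le> N\<close> by simp
  qed
  define H where "H = (\<Sum>j<length l. \<Sum>m\<le>N. move_test j m x)"
  have err: "\<bar>(\<Sum>j<length l. c j * move_test j m x) - (\<Sum>j<length l. of_rat (l ! j) * move_test j m x)\<bar> \<le> d * H"
    if "m \<le> N" for m
  proof -
    have "\<bar>(\<Sum>j<length l. c j * move_test j m x) - (\<Sum>j<length l. of_rat (l ! j) * move_test j m x)\<bar>
      \<le> (\<Sum>j<length l. \<bar>c j - of_rat (l ! j)\<bar> * move_test j m x)"
      unfolding sum_subtractf[symmetric] left_diff_distrib[symmetric]
      by (rule order_trans[OF sum_abs]) (simp add: abs_mult move_test_nonneg)
    also have "\<dots> \<le> (\<Sum>j<length l. d * (\<Sum>m\<le>N. move_test j m x))"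
    proof (rule sum_mono)
      fix j assume j: "j \<in> {..<length l}"
      then have "0 \<le> d" using close[of j] abs_ge_zero order_trans by blast
      moreover have "move_test j m x \<le> (\<Sum>m\<le>N. move_test j m x)"
        using that by (intro member_le_sum move_test_nonneg) auto
      ultimately show "\<bar>c j - of_rat (l ! j)\<bar> * move_test j m x \<le> d * (\<Sum>m\<le>N. move_test j m x)"
        using close[of j] j move_test_nonneg by (intro mult_mono) auto
    qed
    finally show ?thesis by (simp add: H_def sum_distrib_left)
  qed
  have "(\<Sum>j<length l. of_rat (l ! j) * move_test j m x) \<le> (\<Sum>j<length l. of_rat (l ! j) * move_test j b x)"
    using b[of b] m by (simp add: best_move_def Let_def)
  then have "(\<Sum>j<length l. c j * move_test j m x) \<le> (\<Sum>j<length l. c j * move_test j b x) + 2 * d * H"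
    using err[OF m] err[OF \<open>b \<le> N\<close>] unfolding abs_le_iff by (simp add: algebra_simps)
  then show ?thesis by (simp add: k H_def)
qed

end

section \<open>Approximation of the second marginal by duality\<close>

context candidate_kernels begin

lemma integrable_test:
  assumes "prob_space \<mu>" and [measurable_cong]: "sets \<mu> = sets borel" and "integrable \<mu> norm"
  shows "integrable \<mu> (f j)"
proof -
  interpret prob_space \<mu> by fact
  show ?thesis
  proof (cases "j = 0")
    case False
    then show ?thesis
      by (intro integrable_const_bound[where B=1]) (auto simp: f_range)
  qed (use assms(3) in \<open>simp add: f_0\<close>)
qed

lemma approximate_marginal:
  assumes mu: "prob_space \<mu>" "sets \<mu> = sets borel" "integrable \<mu> norm"
    and nu: "prob_space \<nu>" "sets \<nu> = sets borel" "integrable \<nu> norm"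
    and le: "cone_le C \<mu> \<nu>" and e: "0 < e"
  shows "\<exists>T. (\<integral>x. kernel_test T 0 x \<partial>\<mu>) < (\<integral>x. f 0 x \<partial>\<nu>) + e \<and>
    (\<forall>j. 0 < j \<and> j \<le> n \<longrightarrow> \<bar>(\<integral>x. kernel_test T j x \<partial>\<mu>) - (\<integral>x. f j x \<partial>\<nu>)\<bar> < e)"
proof (rule ccontr)
  assume contra: "\<not> ?thesis"
  note [measurable_cong] = mu(2) nu(2)
  interpret mu: prob_space \<mu> by fact
  interpret nu: prob_space \<nu> by fact
  define V where "V T j = (\<integral>x. kernel_test T j x \<partial>\<mu>)" for T j
  define q where "q j = (\<integral>x. f j x \<partial>\<nu>)" for j
  note ik = integrable_kernel_test[OF mu] and im = integrable_move_test[OF mu] and iF = integrable_test[OF nu]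
  (* X is upward closed in the coordinate of the norm: this forces l 0 <= 0 below, hence g is
     bounded above and its envelope is finite. *)
  define X where "X = {v. \<exists>T. V T 0 \<le> v 0 \<and> (\<forall>j>0. v j = V T j)}"
  have V_Average: "V (Average S T) j = (V S j + V T j) / 2" for S T j
    unfolding V_def kernel_test_Average by (simp add: ik)
  have "\<exists>l. \<forall>v\<in>X. (\<Sum>j<Suc n. l j * v j) \<le> (\<Sum>j<Suc n. l j * q j) - e\<^sup>2"
  proof (rule separate_midpoint_family[where X=X and e="e\<^sup>2" and n="Suc n" and q=q])
    show "X \<noteq> {}" unfolding X_def by (auto intro: exI[of _ "V T" for T])
    show "(\<lambda>j. (v j + w j) / 2) \<in> X" if v: "v \<in> X" and w: "w \<in> X" for v w
    proof -
      obtain S T where "V S 0 \<le> v 0" "\<And>j. 0 < j \<Longrightarrow> v j = V S j" "V T 0 \<le> w 0" "\<And>j. 0 < j \<Longrightarrow> w j = V T j"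
        using v w unfolding X_def by blast
      then show ?thesis unfolding X_def by (auto simp: V_Average intro!: exI[of _ "Average S T"])
    qed
    show "e\<^sup>2 \<le> (\<Sum>j<Suc n. (v j - q j)\<^sup>2)" if "v \<in> X" for v
    proof (rule ccontr)
      assume "\<not> ?thesis"
      then have *: "(\<Sum>j<Suc n. (v j - q j)\<^sup>2) < e\<^sup>2" by simp
      \<comment> \<open>A point of \<open>X\<close> at Euclidean distance below \<open>e\<close>
        from \<open>q\<close> would give a \<open>T\<close> as claimed: exact coordinates for
        \<open>j > 0\<close>, and for the norm only the upper estimate
        \<open>V T 0 \<le> v 0\<close>, which is all that is asked.\<close>
      have close: "\<bar>v j - q j\<bar> < e" if "j \<le> n" for j
      proof -
        have "(v j - q j)\<^sup>2 \<le> (\<Sum>j<Suc n. (v j - q j)\<^sup>2)" using that by (intro member_le_sum) auto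
        with * have "\<bar>v j - q j\<bar>\<^sup>2 < e\<^sup>2" by simp
        then show ?thesis using e by (rule power2_less_imp_less[OF _ less_imp_le])
      qed
      obtain T where T: "V T 0 \<le> v 0" "\<And>j. 0 < j \<Longrightarrow> v j = V T j"
        using \<open>v \<in> X\<close> unfolding X_def by blast
      have "V T 0 < q 0 + e" using T(1) close[of 0] by linarith
      moreover have "\<bar>V T j - q j\<bar> < e" if "0 < j" "j \<le> n" for j using T(2) close that by metis
      ultimately show False using contra unfolding V_def q_def by blast
    qed
  qed blast
  then obtain l where l: "\<And>v. v \<in> X \<Longrightarrow> (\<Sum>j<Suc n. l j * v j) \<le> (\<Sum>j<Suc n. l j * q j) - e\<^sup>2" by blast
  define b where "b = (\<Sum>j<Suc n. l j * q j) - e\<^sup>2"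
  have lV: "(\<Sum>j<Suc n. l j * V T j) \<le> b" for T
    unfolding b_def by (rule l) (auto simp: X_def)
  have l0: "l 0 \<le> 0"
  proof (rule ccontr)
    assume "\<not> l 0 \<le> 0"
    then have pos: "0 < l 0" by simp
    fix T
    \<comment> \<open>Raising the norm coordinate by \<open>r\<close> stays in \<open>X\<close>, but
      with \<open>l 0 > 0\<close> it would lift the linear functional past its bound
      \<open>b\<close> by at least 1.\<close>
    define r where "r = (\<bar>b - (\<Sum>j<Suc n. l j * V T j)\<bar> + 1) / l 0"
    define v where "v = (V T)(0 := V T 0 + r)"
    have "0 \<le> r" using pos by (simp add: r_def)
    then have "v \<in> X" unfolding X_def v_def by (auto intro!: exI[of _ T])
    then have "(\<Sum>j<Suc n. l j * v j) \<le> b" unfolding b_def by (rule l)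
    moreover have "(\<Sum>j<Suc n. l j * v j) = (\<Sum>j<Suc n. l j * V T j) + l 0 * r"
      unfolding sum.lessThan_Suc_shift by (simp add: v_def algebra_simps)
    moreover have "l 0 * r = \<bar>b - (\<Sum>j<Suc n. l j * V T j)\<bar> + 1" using pos by (simp add: r_def)
    ultimately show False by linarith
  qed
  define g where "g x = (\<Sum>j<Suc n. l j * f j x)" for x
  define c where "c = (\<Sum>j<Suc n. \<bar>l j\<bar>)"
  have g_cont: "continuous_on UNIV g" unfolding g_def by (intro continuous_intros f_cont)
  then have [measurable]: "g \<in> borel_measurable borel" by (rule borel_measurable_continuous_onI)
  have g_le: "g x \<le> c" for x
    unfolding g_def c_def
  proof (rule sum_mono)
    fix j
    show "l j * f j x \<le> \<bar>l j\<bar>"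
    proof (cases "j = 0")
      case True
      have "l 0 * f 0 x \<le> 0" using l0 f_nonneg[of 0 x] by (rule mult_nonpos_nonneg)
      also have "0 \<le> \<bar>l 0\<bar>" by simp
      finally show ?thesis using True by simp
    next
      case False
      have "l j * f j x \<le> \<bar>l j\<bar> * 1" using f_range[OF False, of x] by (intro mult_mono) auto
      then show ?thesis by simp
    qed
  qed
  note env = envelope[OF C, of g c, OF g_le]
  have move_mean_g: "move_mean (move_len m) (move m) g x = (\<Sum>j<Suc n. l j * move_test j m x)" for m x
    unfolding g_def move_test_def by (rule move_mean_sum)
  \<comment> \<open>The best value of \<open>g\<close> among the first \<open>N + 1\<close> listed
    moves: the quantity that greedy kernels nearly attain, increasing to the envelope.\<close>
  define M where "M N x = Max ((\<lambda>m. move_mean (move_len m) (move m) g x) ` {..N})" for N x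
  have M_ge: "move_mean (move_len m) (move m) g x \<le> M N x" if "m \<le> N" for m N x
    unfolding M_def using that by (intro Max_ge) auto
  have M_ex: "\<exists>m\<le>N. M N x = move_mean (move_len m) (move m) g x" for N x
    using Max_in[of "(\<lambda>m. move_mean (move_len m) (move m) g x) ` {..N}"] unfolding M_def by fastforce
  have [measurable]: "(\<lambda>x. move_mean (move_len m) (move m) g x) \<in> borel_measurable borel" for m
    by (intro borel_measurable_continuous_onI continuous_on_move_mean g_cont)
  have i_move: "integrable \<mu> (\<lambda>x. move_mean (move_len m) (move m) g x)" for m
    unfolding move_mean_g by (intro Bochner_Integration.integrable_sum integrable_mult_right im)
  have M_Suc: "M (Suc N) x = max (move_mean (move_len (Suc N)) (move (Suc N)) g x) (M N x)" for N x
    unfolding M_def atMost_Suc by (subst image_insert, subst Max_insert) auto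
  have iM: "integrable \<mu> (M N)" for N
  proof (induction N)
    case 0
    then show ?case using i_move[of 0] by (simp add: M_def[abs_def])
  next
    case (Suc N)
    then show ?case unfolding M_Suc[abs_def] by (intro integrable_max i_move)
  qed
  have M_le_b: "(\<integral>x. M N x \<partial>\<mu>) \<le> b" for N
  proof -
    define H where "H x = (\<Sum>j<Suc n. \<Sum>m\<le>N. move_test j m x)" for x
    have iH: "integrable \<mu> H" unfolding H_def by (intro Bochner_Integration.integrable_sum im)
    \<comment> \<open>Rational coefficients within \<open>d\<close> of \<open>l\<close> give a
      greedy kernel that loses at most \<open>2 * d * H\<close>, and the separation bounds what it
      attains by \<open>b\<close>. As \<open>H\<close> does not depend on \<open>d\<close>, the loss
      vanishes as \<open>d\<close> tends to 0.\<close>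
    have step: "(\<integral>x. M N x \<partial>\<mu>) \<le> b + 2 * d * (\<integral>x. H x \<partial>\<mu>)" if d: "0 < d" for d
    proof -
      have "\<exists>r. \<bar>l j - of_rat r\<bar> \<le> d" for j
      proof -
        obtain r where "l j - d < of_rat r" "of_rat r < l j"
          using of_rat_dense[of "l j - d" "l j"] d by auto
        then show ?thesis by (intro exI[of _ r]) simp
      qed
      then obtain r where r: "\<And>j. \<bar>l j - of_rat (r j)\<bar> \<le> d" by metis
      define L where "L = map r [0..<Suc n]"
      have L: "length L = Suc n" "\<And>j. j < length L \<Longrightarrow> \<bar>l j - of_rat (L ! j)\<bar> \<le> d"
        using r by (auto simp: L_def simp del: upt_Suc)
      have "M N x \<le> (\<Sum>j<Suc n. l j * kernel_test (Greedy L N) j x) + 2 * d * H x" for x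
      proof -
        obtain m where "m \<le> N" "M N x = move_mean (move_len m) (move m) g x" using M_ex by blast
        then show ?thesis
          using kernel_test_Greedy_ge[of m N L l d x] L unfolding move_mean_g L(1) H_def by simp
      qed
      then have "(\<integral>x. M N x \<partial>\<mu>) \<le> (\<integral>x. (\<Sum>j<Suc n. l j * kernel_test (Greedy L N) j x) + 2 * d * H x \<partial>\<mu>)"
        by (intro integral_mono iM Bochner_Integration.integrable_add Bochner_Integration.integrable_sum
            integrable_mult_right ik iH)
      also have "\<dots> = (\<Sum>j<Suc n. l j * V (Greedy L N) j) + 2 * d * (\<integral>x. H x \<partial>\<mu>)"
        unfolding V_def
        by (subst Bochner_Integration.integral_add)
          (auto simp del: sum.lessThan_Suc simp: Bochner_Integration.integral_sum ik iH
            intro!: Bochner_Integration.integrable_sum)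
      finally show ?thesis using lV[of "Greedy L N"] by linarith
    qed
    have "((\<lambda>d. b + 2 * d * (\<integral>x. H x \<partial>\<mu>)) \<longlongrightarrow> b + 2 * 0 * (\<integral>x. H x \<partial>\<mu>)) (at_right 0)"
      by (intro tendsto_intros)
    then have "(\<integral>x. M N x \<partial>\<mu>) \<le> b + 2 * 0 * (\<integral>x. H x \<partial>\<mu>)"
      by (rule tendsto_lowerbound) (auto simp: eventually_at_filter step)
    then show ?thesis by simp
  qed
  define G where "G = envelope C g"
  have M_le_G: "M N x \<le> G x" for N x
    using M_ex[of N x] env(1)[OF move] unfolding G_def by metis
  \<comment> \<open>One half of \<open>r\<close> is spent on approaching the supremum over all
    moves, the other on replacing that move by a listed one.\<close>
  have M_lim: "(\<lambda>N. M N x) \<longlonglongrightarrow> G x" for x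
  proof (rule LIMSEQ_I)
    fix r :: real assume r: "0 < r"
    obtain k z where z: "z \<in> moves C k" "G x - r / 2 < move_mean k z g x"
      using env(2)[of "r / 2" x] r unfolding G_def by auto
    obtain m where m: "move_mean k z g x - r / 2 < move_mean (move_len m) (move m) g x"
      using move_dense[OF z(1) g_cont, of "r / 2" x] r by auto
    have "norm (M N x - G x) < r" if "m \<le> N" for N
      using M_ge[OF that, of x] M_le_G[of N x] z(2) m by simp
    then show "\<exists>no. \<forall>N\<ge>no. norm (M N x - G x) < r" by blast
  qed
  have Gc: "G x \<le> c" and gG: "g x \<le> G x" for x unfolding G_def by (rule env)+
  have [measurable]: "M N \<in> borel_measurable borel" for N
    unfolding M_def[abs_def] by measurable
  have [measurable]: "G \<in> borel_measurable borel"
    by (rule borel_measurable_LIMSEQ_real[of _ M]) (use M_lim in auto)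
  have M0: "M 0 x \<le> M N x" for N x unfolding M_def by (intro Max_mono) auto
  \<comment> \<open>\<open>M N\<close> lies between the integrable \<open>M 0\<close> and the
    constant \<open>c\<close>, which gives domination.\<close>
  have bnd: "norm (M N x) \<le> \<bar>M 0 x\<bar> + \<bar>c\<bar>" for N x
    using M0[of x N] M_le_G[of N x] Gc[of x] by auto
  have iw: "integrable \<mu> (\<lambda>x. \<bar>M 0 x\<bar> + \<bar>c\<bar>)" using iM[of 0] by auto
  have "integrable \<mu> G"
    by (rule integrable_dominated_convergence[OF _ _ iw, where s=M]) (use M_lim bnd in auto)
  moreover have lim: "(\<lambda>N. \<integral>x. M N x \<partial>\<mu>) \<longlonglongrightarrow> (\<integral>x. G x \<partial>\<mu>)"
    by (rule integral_dominated_convergence[OF _ _ iw]) (use M_lim bnd in auto)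
  ultimately have iG: "integrable \<mu> G" and G_le: "(\<integral>x. G x \<partial>\<mu>) \<le> b"
    using LIMSEQ_le_const2[OF lim] M_le_b by blast+
  have ig: "integrable \<nu> g"
    unfolding g_def by (intro Bochner_Integration.integrable_sum integrable_mult_right iF)
  \<comment> \<open>The only use of the order: \<open>c - G\<close> is an admissible test
    function.\<close>
  have "(\<integral>\<^sup>+x. ennreal (c - G x) \<partial>\<mu>) \<le> (\<integral>\<^sup>+x. ennreal (c - G x) \<partial>\<nu>)"
    using le env(5) env(6) Gc unfolding cone_le_def G_def by fastforce
  also have "\<dots> \<le> (\<integral>\<^sup>+x. ennreal (c - g x) \<partial>\<nu>)"
    by (intro nn_integral_mono ennreal_leI) (use gG in auto)
  also have "\<dots> = ennreal (\<integral>x. c - g x \<partial>\<nu>)"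
    by (rule nn_integral_eq_integral) (use ig g_le in auto)
  also have "(\<integral>\<^sup>+x. ennreal (c - G x) \<partial>\<mu>) = ennreal (\<integral>x. c - G x \<partial>\<mu>)"
    by (rule nn_integral_eq_integral) (use iG Gc in auto)
  finally have "(\<integral>x. c - G x \<partial>\<mu>) \<le> (\<integral>x. c - g x \<partial>\<nu>)"
    by (subst (asm) ennreal_le_iff) (auto intro!: Bochner_Integration.integral_nonneg g_le)
  then have "c - (\<integral>x. G x \<partial>\<mu>) \<le> c - (\<integral>x. g x \<partial>\<nu>)"
    using iG ig by (simp add: mu.prob_space nu.prob_space)
  moreover have "(\<integral>x. g x \<partial>\<nu>) = (\<Sum>j<Suc n. l j * q j)"
    unfolding g_def q_def by (simp del: sum.lessThan_Suc add: Bochner_Integration.integral_sum iF)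
  moreover have "0 < e\<^sup>2" using e by simp
  ultimately show False using G_le unfolding b_def by linarith
qed

end

section \<open>The coupling of a kernel\<close>

context candidate_kernels begin

definition kernel_index :: "blend \<Rightarrow> (nat \<times> nat) set" where
  "kernel_index T = Sigma {..last_move T} (\<lambda>m. {..<move_len m})"

definition kernel_weight :: "blend \<Rightarrow> 'a \<times> nat \<times> nat \<Rightarrow> real" where
  "kernel_weight T p = weight T (fst (snd p)) (fst p) * fst (move (fst (snd p)) (snd (snd p)))"

definition kernel_point :: "'a \<times> nat \<times> nat \<Rightarrow> 'a \<times> 'a" where
  "kernel_point p = (fst p, fst p + snd (move (fst (snd p)) (snd (snd p))))"

text \<open>The joint law of \<open>X\<close> and \<open>X + V\<close>: a pair of a move and one of
  its atoms is drawn with the stated density relative to counting measure. Over a finite index set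
  this reduces all integrals to finite sums by Fubini.\<close>

definition kernel_coupling :: "blend \<Rightarrow> 'a measure \<Rightarrow> ('a \<times> 'a) measure" where
  "kernel_coupling T \<mu> = distr (density (\<mu> \<Otimes>\<^sub>M count_space (kernel_index T)) (\<lambda>p. ennreal (kernel_weight T p)))
     (borel \<Otimes>\<^sub>M borel) kernel_point"

lemma finite_kernel_index [simp]: "finite (kernel_index T)"
  by (simp add: kernel_index_def)

lemma sets_kernel_coupling [simp, measurable_cong]: "sets (kernel_coupling T \<mu>) = sets (borel \<Otimes>\<^sub>M borel)"
  by (simp add: kernel_coupling_def)

lemma sum_kernel_index: "(\<Sum>(m, i)\<in>kernel_index T. F m i) = (\<Sum>m\<le>last_move T. \<Sum>i<move_len m. F m i)"
  unfolding kernel_index_def by (rule sum.Sigma[symmetric]) auto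

lemma kernel_weight_nonneg: "0 \<le> weight T m x * fst (move m i)" if "(m, i) \<in> kernel_index T"
  using that move[of m] weight_nonneg by (auto simp: kernel_index_def moves_def)

lemma kernel_weight_sum: "(\<Sum>(m, i)\<in>kernel_index T. weight T m x * fst (move m i)) = 1"
proof -
  have "(\<Sum>i<move_len m. weight T m x * fst (move m i)) = weight T m x" for m
    using move[of m] by (simp add: moves_def flip: sum_distrib_left)
  then show ?thesis by (simp add: sum_kernel_index weight_sum)
qed

lemma kernel_weight_point_measurable:
  assumes [measurable_cong]: "sets \<mu> = sets borel"
  shows "kernel_weight T \<in> borel_measurable (\<mu> \<Otimes>\<^sub>M count_space (kernel_index T))"
    and "kernel_point \<in> \<mu> \<Otimes>\<^sub>M count_space (kernel_index T) \<rightarrow>\<^sub>M borel \<Otimes>\<^sub>M borel"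
proof -
  show "kernel_weight T \<in> borel_measurable (\<mu> \<Otimes>\<^sub>M count_space (kernel_index T))"
    unfolding kernel_weight_def[abs_def]
  proof (rule measurable_compose_countable'[where I="kernel_index T" and g=snd and
        f="\<lambda>q p. weight T (fst q) (fst p) * fst (move (fst q) (snd q))"])
    show "(\<lambda>p. weight T (fst q) (fst p) * fst (move (fst q) (snd q))) \<in> borel_measurable (\<mu> \<Otimes>\<^sub>M count_space (kernel_index T))" for q
      by measurable
  qed (auto simp: kernel_index_def)
  show "kernel_point \<in> \<mu> \<Otimes>\<^sub>M count_space (kernel_index T) \<rightarrow>\<^sub>M borel \<Otimes>\<^sub>M borel"
    unfolding kernel_point_def[abs_def]
  proof (rule measurable_compose_countable'[where I="kernel_index T" and g=snd and
        f="\<lambda>q p. (fst p, fst p + snd (move (fst q) (snd q)))"])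
    show "(\<lambda>p. (fst p, fst p + snd (move (fst q) (snd q)))) \<in> \<mu> \<Otimes>\<^sub>M count_space (kernel_index T) \<rightarrow>\<^sub>M borel \<Otimes>\<^sub>M borel" for q
      by measurable
  qed (auto simp: kernel_index_def)
qed

lemma nn_integral_kernel_coupling:
  assumes s: "sets \<mu> = sets borel" and g [measurable]: "g \<in> borel_measurable (borel \<Otimes>\<^sub>M borel)"
  shows "(\<integral>\<^sup>+z. g z \<partial>kernel_coupling T \<mu>)
    = (\<integral>\<^sup>+x. (\<Sum>(m, i)\<in>kernel_index T. ennreal (weight T m x * fst (move m i)) * g (x, x + snd (move m i))) \<partial>\<mu>)"
proof -
  note [measurable_cong] = s
  note [measurable] = kernel_weight_point_measurable[OF s]
  interpret K: sigma_finite_measure "count_space (kernel_index T)"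
    by (rule sigma_finite_measure_count_space_finite) simp
  have "(\<integral>\<^sup>+z. g z \<partial>kernel_coupling T \<mu>)
    = (\<integral>\<^sup>+p. g (kernel_point p) \<partial>density (\<mu> \<Otimes>\<^sub>M count_space (kernel_index T)) (\<lambda>p. ennreal (kernel_weight T p)))"
    unfolding kernel_coupling_def by (rule nn_integral_distr) measurable
  also have "\<dots> = (\<integral>\<^sup>+p. ennreal (kernel_weight T p) * g (kernel_point p) \<partial>(\<mu> \<Otimes>\<^sub>M count_space (kernel_index T)))"
    by (rule nn_integral_density) measurable
  also have "\<dots> = (\<integral>\<^sup>+x. \<integral>\<^sup>+q. ennreal (kernel_weight T (x, q)) * g (kernel_point (x, q)) \<partial>count_space (kernel_index T) \<partial>\<mu>)"
    by (rule K.nn_integral_fst[symmetric]) measurable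
  finally show ?thesis
    by (simp add: nn_integral_count_space_finite case_prod_beta' kernel_weight_def kernel_point_def)
qed

lemma kernel_coupling_fst:
  assumes s: "sets \<mu> = sets borel"
  shows "distr (kernel_coupling T \<mu>) borel fst = \<mu>"
proof (rule measure_eqI)
  note [measurable_cong] = s
  fix A assume "A \<in> sets (distr (kernel_coupling T \<mu>) borel fst)"
  then have A [measurable]: "A \<in> sets borel" by simp
  have "emeasure (distr (kernel_coupling T \<mu>) borel fst) A = (\<integral>\<^sup>+z. indicator A z \<partial>distr (kernel_coupling T \<mu>) borel fst)"
    by simp
  also have "\<dots> = (\<integral>\<^sup>+z. indicator A (fst z) \<partial>kernel_coupling T \<mu>)" by (rule nn_integral_distr) measurable
  also have "\<dots> = (\<integral>\<^sup>+x. (\<Sum>(m, i)\<in>kernel_index T. ennreal (weight T m x * fst (move m i))) * indicator A x \<partial>\<mu>)"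
    by (subst nn_integral_kernel_coupling[OF s]) (auto simp: sum_distrib_right case_prod_beta')
  also have "(\<lambda>x. \<Sum>(m, i)\<in>kernel_index T. ennreal (weight T m x * fst (move m i))) = (\<lambda>x. 1)"
  proof
    fix x
    have "(\<Sum>(m, i)\<in>kernel_index T. ennreal (weight T m x * fst (move m i)))
      = ennreal (\<Sum>(m, i)\<in>kernel_index T. weight T m x * fst (move m i))"
      unfolding case_prod_beta' by (rule sum_ennreal) (use kernel_weight_nonneg in force)
    then show "(\<Sum>(m, i)\<in>kernel_index T. ennreal (weight T m x * fst (move m i))) = 1" by (simp add: kernel_weight_sum)
  qed
  also have "(\<integral>\<^sup>+x. 1 * indicator A x \<partial>\<mu>) = emeasure \<mu> A" using A s by simp
  finally show "emeasure (distr (kernel_coupling T \<mu>) borel fst) A = emeasure \<mu> A" .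
qed (simp add: s)

lemma prob_space_kernel_coupling:
  assumes "prob_space \<mu>" and s: "sets \<mu> = sets borel"
  shows "prob_space (kernel_coupling T \<mu>)"
  by (rule prob_space_distrD[where M="kernel_coupling T \<mu>" and N=borel and f=fst])
    (use assms(1) in \<open>simp_all add: kernel_coupling_fst[OF s]\<close>)

text \<open>With \<open>T\<close> fixed, the mass of \<open>B\<close> is the integral of one Borel
  function \<open>g\<close> against \<open>P \<theta>\<close>.\<close>

lemma kernel_coupling_prob_kernel:
  assumes P: "P \<in> S \<rightarrow>\<^sub>M prob_algebra borel"
  shows "(\<lambda>\<theta>. kernel_coupling T (P \<theta>)) \<in> S \<rightarrow>\<^sub>M prob_algebra (borel \<Otimes>\<^sub>M borel)"
  unfolding prob_kernel_iff
proof (intro conjI ballI)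
  have Ps: "prob_space (P \<theta>)" "sets (P \<theta>) = sets borel" if "\<theta> \<in> space S" for \<theta>
    using measurable_space[OF P that] by (auto simp: space_prob_algebra)
  then show "prob_space (kernel_coupling T (P \<theta>))" "sets (kernel_coupling T (P \<theta>)) = sets (borel \<Otimes>\<^sub>M borel)" if "\<theta> \<in> space S" for \<theta>
    using prob_space_kernel_coupling that by auto
  fix B :: "('a \<times> 'a) set" assume B [measurable]: "B \<in> sets (borel \<Otimes>\<^sub>M borel)"
  define g where "g x = (\<Sum>(m, i)\<in>kernel_index T. ennreal (weight T m x * fst (move m i)) * indicator B (x, x + snd (move m i)))" for x
  have [measurable]: "g \<in> borel_measurable borel" unfolding g_def case_prod_beta' by measurable
  have "(\<lambda>\<theta>. \<integral>\<^sup>+x. g x \<partial>P \<theta>) \<in> borel_measurable S"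
    by (rule measurable_compose[OF measurable_prob_algebraD[OF P] nn_integral_measurable_subprob_algebra]) measurable
  also have "?this \<longleftrightarrow> (\<lambda>\<theta>. emeasure (kernel_coupling T (P \<theta>)) B) \<in> borel_measurable S"
  proof (rule measurable_cong)
    fix \<theta> assume "\<theta> \<in> space S"
    show "(\<integral>\<^sup>+x. g x \<partial>P \<theta>) = emeasure (kernel_coupling T (P \<theta>)) B"
      using nn_integral_kernel_coupling[OF Ps(2)[OF \<open>\<theta> \<in> space S\<close>], of "indicator B" T] by (simp add: g_def)
  qed
  finally show "(\<lambda>\<theta>. emeasure (kernel_coupling T (P \<theta>)) B) \<in> borel_measurable S" .
qed

text \<open>Linear growth suffices because only finitely many displacements occur, so the second
  coordinate has norm at most that of the first plus a constant.\<close>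

lemma integral_kernel_coupling:
  fixes g :: "'a \<times> 'a \<Rightarrow> real"
  assumes "prob_space \<mu>" and s: "sets \<mu> = sets borel" and i: "integrable \<mu> norm"
    and g [measurable]: "g \<in> borel_measurable (borel \<Otimes>\<^sub>M borel)"
    and growth: "\<And>x y. \<bar>g (x, y)\<bar> \<le> K * (1 + norm x + norm y)"
  shows "integrable (kernel_coupling T \<mu>) g"
    and "(\<integral>z. g z \<partial>kernel_coupling T \<mu>)
    = (\<integral>x. (\<Sum>m\<le>last_move T. weight T m x * (\<Sum>i<move_len m. fst (move m i) * g (x, x + snd (move m i)))) \<partial>\<mu>)"
proof -
  interpret prob_space \<mu> by fact
  note [measurable_cong] = s
  note [measurable] = kernel_weight_point_measurable[OF s]
  interpret K: sigma_finite_measure "count_space (kernel_index T)"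
    by (rule sigma_finite_measure_count_space_finite) simp
  interpret pair_sigma_finite \<mu> "count_space (kernel_index T)" ..
  define F where "F p = kernel_weight T p * g (kernel_point p)" for p
  have [measurable]: "F \<in> borel_measurable (\<mu> \<Otimes>\<^sub>M count_space (kernel_index T))" unfolding F_def by measurable
  have "0 \<le> K" using growth[of 0 0] by simp
  have w1: "weight T m x * fst (move m i) \<le> 1" if "(m, i) \<in> kernel_index T" for m i x
  proof -
    have "(case (m, i) of (m, i) \<Rightarrow> weight T m x * fst (move m i)) \<le> (\<Sum>(m, i)\<in>kernel_index T. weight T m x * fst (move m i))"
      by (rule member_le_sum) (use that kernel_weight_nonneg in auto)
    then show ?thesis by (simp add: kernel_weight_sum)
  qed
  have Fi: "integrable \<mu> (\<lambda>x. F (x, q))" if q: "q \<in> kernel_index T" for q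
  proof -
    obtain m i where q': "q = (m, i)" by (cases q)
    show ?thesis
    proof (rule Bochner_Integration.integrable_bound)
    show "integrable \<mu> (\<lambda>x. K * (1 + norm x + (norm x + norm (snd (move m i)))))" using i by auto
    show "(\<lambda>x. F (x, q)) \<in> borel_measurable \<mu>" unfolding F_def q' kernel_weight_def kernel_point_def fst_conv snd_conv by measurable
    have "norm (F (x, q)) \<le> norm (K * (1 + norm x + (norm x + norm (snd (move m i)))))" for x
    proof -
      have "norm (F (x, q)) = (weight T m x * fst (move m i)) * \<bar>g (x, x + snd (move m i))\<bar>"
        unfolding F_def kernel_weight_def kernel_point_def q' fst_conv snd_conv real_norm_def abs_mult[of "_ * _"]
        by (subst abs_of_nonneg) (use kernel_weight_nonneg[of m i T x] q q' in auto)
      also have "\<dots> \<le> 1 * (K * (1 + norm x + (norm x + norm (snd (move m i)))))"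
      proof (rule mult_mono)
        have "\<bar>g (x, x + snd (move m i))\<bar> \<le> K * (1 + norm x + norm (x + snd (move m i)))" by (rule growth)
        also have "\<dots> \<le> K * (1 + norm x + (norm x + norm (snd (move m i))))"
          using \<open>0 \<le> K\<close> by (intro mult_left_mono add_left_mono norm_triangle_ineq)
        finally show "\<bar>g (x, x + snd (move m i))\<bar> \<le> K * (1 + norm x + (norm x + norm (snd (move m i))))" .
      qed (use w1 q q' in auto)
      finally show ?thesis by simp
    qed
    then show "AE x in \<mu>. norm (F (x, q)) \<le> norm (K * (1 + norm x + (norm x + norm (snd (move m i)))))" by simp
    qed
  qed
  have Fint: "integrable (\<mu> \<Otimes>\<^sub>M count_space (kernel_index T)) F"
  proof (rule Fubini_integrable)
    show "integrable \<mu> (\<lambda>x. \<integral>q. norm (F (x, q)) \<partial>count_space (kernel_index T))"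
      by (simp add: lebesgue_integral_count_space_finite)
        (intro Bochner_Integration.integrable_sum integrable_abs Fi)
    show "AE x in \<mu>. integrable (count_space (kernel_index T)) (\<lambda>q. F (x, q))"
      by (simp add: integrable_count_space)
  qed measurable
  have wd: "AE p in \<mu> \<Otimes>\<^sub>M count_space (kernel_index T). 0 \<le> kernel_weight T p"
    by (rule AE_I2) (use kernel_weight_nonneg in \<open>auto simp: space_pair_measure kernel_weight_def\<close>)
  show "integrable (kernel_coupling T \<mu>) g"
  proof -
    have "integrable (density (\<mu> \<Otimes>\<^sub>M count_space (kernel_index T)) (\<lambda>p. ennreal (kernel_weight T p))) (\<lambda>p. g (kernel_point p))"
      using Fint unfolding F_def[abs_def] by (subst integrable_real_density[OF _ wd]) auto
    then show ?thesis unfolding kernel_coupling_def by (subst integrable_distr_eq) auto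
  qed
  have "(\<integral>z. g z \<partial>kernel_coupling T \<mu>) = (\<integral>p. F p \<partial>(\<mu> \<Otimes>\<^sub>M count_space (kernel_index T)))"
  proof -
    have "(\<integral>z. g z \<partial>kernel_coupling T \<mu>) = (\<integral>p. g (kernel_point p) \<partial>density (\<mu> \<Otimes>\<^sub>M count_space (kernel_index T)) (\<lambda>p. ennreal (kernel_weight T p)))"
      unfolding kernel_coupling_def by (rule integral_distr) measurable
    also have "\<dots> = (\<integral>p. F p \<partial>(\<mu> \<Otimes>\<^sub>M count_space (kernel_index T)))"
      unfolding F_def by (rule integral_real_density[OF _ wd]) measurable
    finally show ?thesis .
  qed
  also have "\<dots> = (\<integral>x. \<integral>q. F (x, q) \<partial>count_space (kernel_index T) \<partial>\<mu>)"
    by (rule integral_fst'[OF Fint, symmetric])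
  also have "\<dots> = (\<integral>x. (\<Sum>(m, i)\<in>kernel_index T. weight T m x * fst (move m i) * g (x, x + snd (move m i))) \<partial>\<mu>)"
    by (simp add: lebesgue_integral_count_space_finite F_def kernel_weight_def kernel_point_def case_prod_beta')
  also have "\<dots> = (\<integral>x. (\<Sum>m\<le>last_move T. weight T m x * (\<Sum>i<move_len m. fst (move m i) * g (x, x + snd (move m i)))) \<partial>\<mu>)"
    unfolding sum_kernel_index by (simp add: sum_distrib_left mult_ac)
  finally show "(\<integral>z. g z \<partial>kernel_coupling T \<mu>)
    = (\<integral>x. (\<Sum>m\<le>last_move T. weight T m x * (\<Sum>i<move_len m. fst (move m i) * g (x, x + snd (move m i)))) \<partial>\<mu>)" .
qed

lemma integral_kernel_coupling_test:
  assumes "prob_space \<mu>" "sets \<mu> = sets borel" "integrable \<mu> norm"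
  shows "(\<integral>z. f j (snd z) \<partial>kernel_coupling T \<mu>) = (\<integral>x. kernel_test T j x \<partial>\<mu>)"
proof -
  have "f j y \<le> 1 * (1 + norm x + norm y)" for x y
    using f_range[of j y] by (cases "j = 0") (auto simp: f_0 intro: order_trans)
  then show ?thesis
    by (subst integral_kernel_coupling(2)[OF assms, where K=1]) (auto simp: f_nonneg kernel_test_def[abs_def] move_test_def move_mean_def)
qed

text \<open>\<open>h\<close> depends on the starting point only, so it factors out of the average
  over the atoms, and the mean displacement of every move lies in \<open>C\<close>.\<close>

lemma integral_kernel_coupling_drift:
  assumes mu: "prob_space \<mu>" "sets \<mu> = sets borel" "integrable \<mu> norm"
    and [measurable]: "h \<in> borel_measurable borel" and h: "\<And>x. 0 \<le> h x \<and> h x \<le> 1"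
    and a: "\<And>c. c \<in> C \<Longrightarrow> 0 \<le> a \<bullet> c"
  shows "integrable (kernel_coupling T \<mu>) (\<lambda>z. h (fst z) * (a \<bullet> (snd z - fst z)))"
    and "0 \<le> (\<integral>z. h (fst z) * (a \<bullet> (snd z - fst z)) \<partial>kernel_coupling T \<mu>)"
proof -
  have g: "\<bar>h (fst (x, y)) * (a \<bullet> (snd (x, y) - fst (x, y)))\<bar> \<le> norm a * (1 + norm x + norm y)" for x y
  proof -
    have "\<bar>h x * (a \<bullet> (y - x))\<bar> \<le> 1 * (norm a * norm (y - x))"
      unfolding abs_mult by (intro mult_mono) (use h[of x] in \<open>auto simp: Cauchy_Schwarz_ineq2\<close>)
    also have "\<dots> \<le> norm a * (1 + norm x + norm y)"
      using norm_triangle_ineq4[of y x] by (auto intro!: mult_left_mono)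
    finally show ?thesis by simp
  qed
  have m: "(\<lambda>z. h (fst z) * (a \<bullet> (snd z - fst z))) \<in> borel_measurable (borel \<Otimes>\<^sub>M borel)" by measurable
  show "integrable (kernel_coupling T \<mu>) (\<lambda>z. h (fst z) * (a \<bullet> (snd z - fst z)))"
    by (rule integral_kernel_coupling(1)[OF mu m g])
  have "(\<Sum>i<move_len m. fst (move m i) * (h x * (a \<bullet> snd (move m i)))) = h x * (a \<bullet> (\<Sum>i<move_len m. fst (move m i) *\<^sub>R snd (move m i)))" for m x
    by (simp add: inner_sum_right sum_distrib_left mult_ac)
  moreover have "0 \<le> a \<bullet> (\<Sum>i<move_len m. fst (move m i) *\<^sub>R snd (move m i))" for m
    using a move[of m] by (auto simp: moves_def)
  ultimately have pos: "0 \<le> (\<Sum>i<move_len m. fst (move m i) * (h x * (a \<bullet> snd (move m i))))" for m x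
    using h[of x] by simp
  have "0 \<le> (\<Sum>m\<le>last_move T. weight T m x * (\<Sum>i<move_len m. fst (move m i) * (h x * (a \<bullet> snd (move m i)))))" for x
    by (rule sum_nonneg, rule mult_nonneg_nonneg, rule weight_nonneg, rule pos)
  then show "0 \<le> (\<integral>z. h (fst z) * (a \<bullet> (snd z - fst z)) \<partial>kernel_coupling T \<mu>)"
    unfolding integral_kernel_coupling(2)[OF mu m g] by (simp add: Bochner_Integration.integral_nonneg)
qed

end

section \<open>Limits of couplings\<close>

text \<open>Upgrades Fatou's inequality for \<open>g\<close> and \<open>1 - g\<close> to
  convergence: the second bound is an upper one for \<open>x\<close>.\<close>

lemma tendsto_of_liminf_bounds:
  fixes x :: "nat \<Rightarrow> real"
  assumes "0 \<le> a" "a \<le> 1" "\<And>n. 0 \<le> x n" "\<And>n. x n \<le> 1"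
    and lo: "ennreal a \<le> liminf (\<lambda>n. ennreal (x n))"
    and up: "ennreal (1 - a) \<le> liminf (\<lambda>n. ennreal (1 - x n))"
  shows "x \<longlonglongrightarrow> a"
proof (rule LIMSEQ_I)
  have ev: "eventually (\<lambda>n. b - r < y n) sequentially"
    if "0 \<le> b" "ennreal b \<le> liminf (\<lambda>n. ennreal (y n))" "\<And>n. 0 \<le> y n" "0 < r" for b y and r :: real
  proof (cases "b - r < 0")
    case True
    then show ?thesis using that(3) by (intro always_eventually allI) (rule less_le_trans)
  next
    case False
    then have "ennreal (b - r) < ennreal b" using that by (intro ennreal_lessI) auto
    then have "eventually (\<lambda>n. ennreal (b - r) < ennreal (y n)) sequentially"
      using that(2) by (simp add: le_Liminf_iff)
    then show ?thesis using False by (auto simp: ennreal_less_iff elim!: eventually_mono)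
  qed
  fix r :: real assume r: "0 < r"
  have "eventually (\<lambda>n. a - r < x n \<and> 1 - a - r < 1 - x n) sequentially"
    using ev[OF assms(1) lo assms(3) r] ev[OF _ up _ r] assms by (intro eventually_conj) auto
  then have "eventually (\<lambda>n. norm (x n - a) < r) sequentially"
    by eventually_elim auto
  then show "\<exists>no. \<forall>n\<ge>no. norm (x n - a) < r" by (simp add: eventually_sequentially)
qed

text \<open>Let \<open>N 1\<close> and \<open>N (-1)\<close> be the images under \<open>fst\<close>
  of the positive and negative parts of \<open>g\<close>. The hypothesis says
  \<open>N (-1) \<le> N 1\<close> on open sets, and outer regularity of the finite measure
  \<open>N 1\<close> extends this to Borel sets.\<close>

lemma drift_open_imp_drift_borel:
  fixes R :: "('a::euclidean_space \<times> 'a) measure"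
  assumes "prob_space R" and s [measurable_cong]: "sets R = sets (borel \<Otimes>\<^sub>M borel)"
    and ig: "integrable R (g :: 'a \<times> 'a \<Rightarrow> real)"
    and op: "\<And>U. open U \<Longrightarrow> 0 \<le> (\<integral>z. indicator U (fst z) * g z \<partial>R)"
    and A: "A \<in> sets borel"
  shows "0 \<le> (\<integral>z. indicator A (fst z) * g z \<partial>R)"
proof -
  interpret prob_space R by fact
  note [measurable] = borel_measurable_integrable[OF ig]
  define N where "N s = distr (density R (\<lambda>z. ennreal (max 0 (s * g z)))) borel fst" for s :: real
  have sN: "sets (N s) = sets borel" for s by (simp add: N_def)
  have iB: "integrable R (\<lambda>z. indicator B (fst z) * max 0 (s * g z))" if [measurable]: "B \<in> sets borel" for B s
    by (rule Bochner_Integration.integrable_bound[of R "\<lambda>z. s * g z"])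
      (use ig in \<open>measurable, auto simp: indicator_def\<close>)
  have N: "emeasure (N s) B = ennreal (\<integral>z. indicator B (fst z) * max 0 (s * g z) \<partial>R)"
    if B [measurable]: "B \<in> sets borel" for B s
  proof -
    have "emeasure (N s) B = emeasure (density R (\<lambda>z. ennreal (max 0 (s * g z)))) (fst -` B \<inter> space R)"
      unfolding N_def by (subst emeasure_distr) auto
    also have "\<dots> = (\<integral>\<^sup>+z. ennreal (max 0 (s * g z)) * indicator (fst -` B \<inter> space R) z \<partial>R)"
      by (rule emeasure_density) measurable
    also have "\<dots> = (\<integral>\<^sup>+z. ennreal (indicator B (fst z) * max 0 (s * g z)) \<partial>R)"
      by (intro nn_integral_cong) (auto simp: indicator_def)
    also have "\<dots> = ennreal (\<integral>z. indicator B (fst z) * max 0 (s * g z) \<partial>R)"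
      by (rule nn_integral_eq_integral[OF iB[OF B]]) auto
    finally show ?thesis .
  qed
  have split: "(\<integral>z. indicator B (fst z) * g z \<partial>R)
      = (\<integral>z. indicator B (fst z) * max 0 (1 * g z) \<partial>R) - (\<integral>z. indicator B (fst z) * max 0 (-1 * g z) \<partial>R)"
    if B: "B \<in> sets borel" for B
    unfolding Bochner_Integration.integral_diff[OF iB[OF B] iB[OF B], symmetric]
    by (intro Bochner_Integration.integral_cong) (auto simp: indicator_def)
  have nn: "0 \<le> (\<integral>z. indicator B (fst z) * max 0 (s * g z) \<partial>R)" for B :: "'a set" and s
    by (rule Bochner_Integration.integral_nonneg) auto
  have "emeasure (N (-1)) A \<le> (INF U\<in>{U. A \<subseteq> U \<and> open U}. emeasure (N 1) U)"
  proof (rule INF_greatest)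
    fix U assume "U \<in> {U. A \<subseteq> U \<and> open U}"
    then have U: "A \<subseteq> U" "open U" "U \<in> sets borel" by auto
    have "emeasure (N (-1)) A \<le> emeasure (N (-1)) U"
      by (rule emeasure_mono) (use U sN in auto)
    also have "\<dots> \<le> emeasure (N 1) U"
      unfolding N[OF U(3)] using op[OF U(2)] split[OF U(3)] by (intro ennreal_leI) simp
    finally show "emeasure (N (-1)) A \<le> emeasure (N 1) U" .
  qed
  also have "\<dots> = emeasure (N 1) A"
  proof (rule outer_regular[symmetric])
    have "space (N 1) = UNIV" using sets_eq_imp_space_eq[OF sN[of 1]] by simp
    then show "emeasure (N 1) (space (N 1)) \<noteq> \<infinity>" using N[of UNIV 1] by simp
  qed (use A sN in auto)
  finally show ?thesis
    unfolding N[OF A] split[OF A] using nn by (simp add: ennreal_le_iff)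
qed

text \<open>The first marginal is constant along the sequence, the second is correct in the limit on
  the determining functions. Convergence of \<open>g\<close>-integrals along \<open>r\<close> is
  part of the conclusion so that the integrals of \<open>R\<close> can be matched with limits
  prescribed beforehand.\<close>

lemma limit_coupling:
  fixes M :: "nat \<Rightarrow> ('a::euclidean_space \<times> 'a) measure" and t :: "nat \<Rightarrow> 'a \<Rightarrow> real"
  assumes M: "\<And>n. prob_space (M n)" and setsM [measurable_cong]: "\<And>n. sets (M n) = sets (borel \<Otimes>\<^sub>M borel)"
    and mu: "prob_space \<mu>" "sets \<mu> = sets borel" "integrable \<mu> norm"
    and nu: "prob_space \<nu>" "sets \<nu> = sets borel" "integrable \<nu> norm"
    and t: "\<And>l. continuous_on UNIV (t l)" "\<And>l z. 0 \<le> t l z" "\<And>l z. t l z \<le> 1"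
    and det: "\<And>M N. prob_space M \<Longrightarrow> prob_space N \<Longrightarrow> sets M = sets borel \<Longrightarrow> sets N = sets borel \<Longrightarrow>
           (\<And>l. (\<integral>z. t l z \<partial>M) = (\<integral>z. t l z \<partial>N)) \<Longrightarrow> M = N"
    and first: "\<And>n. distr (M n) borel fst = \<mu>"
    and second: "\<And>l. (\<lambda>n. \<integral>z. t l (snd z) \<partial>M n) \<longlonglongrightarrow> (\<integral>y. t l y \<partial>\<nu>)"
    and moment: "\<And>n. integrable (M n) (\<lambda>z. norm (snd z))"
      "\<And>n. (\<integral>z. norm (snd z) \<partial>M n) \<le> (\<integral>y. norm y \<partial>\<nu>) + \<epsilon> n"
    and eps: "\<epsilon> \<longlonglongrightarrow> 0" "\<And>n. \<epsilon> n \<le> 1"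
    and drift: "\<And>n a h. (\<And>c. c \<in> C \<Longrightarrow> 0 \<le> a \<bullet> c) \<Longrightarrow> continuous_on UNIV h \<Longrightarrow> (\<And>x. 0 \<le> h x \<and> h x \<le> 1) \<Longrightarrow>
       0 \<le> (\<integral>z. h (fst z) * (a \<bullet> (snd z - fst z)) \<partial>M n)"
  obtains r R where "strict_mono r" "prob_space R" "sets R = sets (borel \<Otimes>\<^sub>M borel)"
    "distr R borel fst = \<mu>" "distr R borel snd = \<nu>" "cone_drift C R"
    "\<And>g :: 'a \<times> 'a \<Rightarrow> real. continuous_on UNIV g \<Longrightarrow> (\<And>z. 0 \<le> g z \<and> g z \<le> 1) \<Longrightarrow>
       (\<lambda>n. \<integral>z. g z \<partial>M (r n)) \<longlonglongrightarrow> (\<integral>z. g z \<partial>R)"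
proof -
  define A where "A = (\<integral>x. norm x \<partial>\<mu>)"
  define m where "m = (\<integral>y. norm y \<partial>\<nu>)"
  have fst_int: "integrable L (\<lambda>z. norm (fst z))" "(\<integral>z. norm (fst z) \<partial>L) = A"
    if [measurable_cong]: "sets L = sets (borel \<Otimes>\<^sub>M borel)" and L: "distr L borel fst = \<mu>" for L :: "('a \<times> 'a) measure"
  proof -
    have "integrable (distr L borel fst) norm" using mu(3) L by simp
    then show "integrable L (\<lambda>z. norm (fst z))" by (subst (asm) integrable_distr_eq) auto
    show "(\<integral>z. norm (fst z) \<partial>L) = A"
      unfolding A_def L[symmetric] by (subst integral_distr) auto
  qed
  note Mfst = fst_int[OF setsM first]
  have nnM: "(\<integral>\<^sup>+z. ennreal (norm z) \<partial>M n) \<le> ennreal (A + (m + 1))" for n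
  proof -
    have "(\<integral>\<^sup>+z. ennreal (norm z) \<partial>M n) \<le> (\<integral>\<^sup>+z. ennreal (norm (fst z) + norm (snd z)) \<partial>M n)"
      by (intro nn_integral_mono ennreal_leI) (metis norm_Pair_le prod.collapse)
    also have "\<dots> = ennreal (\<integral>z. norm (fst z) + norm (snd z) \<partial>M n)"
      by (rule nn_integral_eq_integral) (use Mfst moment in auto)
    also have "\<dots> \<le> ennreal (A + (m + 1))"
      using Mfst moment(1)[of n] moment(2)[of n] eps(2)[of n] by (intro ennreal_leI) (simp add: m_def)
    finally show ?thesis .
  qed
  have setsM': "sets (M n) = sets borel" for n using setsM[of n] by (simp only: borel_prod)
  obtain r R where r: "strict_mono r" and R: "prob_space R" and sR: "sets R = sets borel"
    and fatou: "\<And>F. continuous_on UNIV F \<Longrightarrow> (\<And>z. 0 \<le> F z) \<Longrightarrow>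
       (\<integral>\<^sup>+z. ennreal (F z) \<partial>R) \<le> liminf (\<lambda>k. \<integral>\<^sup>+z. ennreal (F z) \<partial>M (r k))"
    using prokhorov_moment[where M=M, OF M setsM' nnM] by blast
  have sR' [measurable_cong]: "sets R = sets (borel \<Otimes>\<^sub>M borel)" using sR by (simp only: borel_prod)
  interpret R: prob_space R by fact
  have conv: "(\<lambda>n. \<integral>z. g z \<partial>M (r n)) \<longlonglongrightarrow> (\<integral>z. g z \<partial>R)"
    if g: "continuous_on UNIV g" "\<And>z. 0 \<le> g z \<and> g z \<le> 1" for g :: "'a \<times> 'a \<Rightarrow> real"
  proof -
    have gm: "g \<in> borel_measurable borel" using g(1) by (rule borel_measurable_continuous_onI)
    have gL: "integrable L g" "0 \<le> (\<integral>z. g z \<partial>L)" "(\<integral>z. g z \<partial>L) \<le> 1"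
      "(\<integral>\<^sup>+z. ennreal (g z) \<partial>L) = ennreal (\<integral>z. g z \<partial>L)"
      "(\<integral>\<^sup>+z. ennreal (1 - g z) \<partial>L) = ennreal (1 - (\<integral>z. g z \<partial>L))"
      if "prob_space L" and [measurable_cong]: "sets L = sets borel" for L
    proof -
      interpret L: prob_space L by fact
      note [measurable] = gm
      show i: "integrable L g" by (rule L.integrable_const_bound[where B=1]) (use g in auto)
      show "0 \<le> (\<integral>z. g z \<partial>L)" by (rule Bochner_Integration.integral_nonneg) (use g in auto)
      show "(\<integral>z. g z \<partial>L) \<le> 1" using L.integral_le_const[OF i, of 1] g by simp
      show "(\<integral>\<^sup>+z. ennreal (g z) \<partial>L) = ennreal (\<integral>z. g z \<partial>L)"
        by (rule nn_integral_eq_integral[OF i]) (use g in auto)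
      have "(\<integral>\<^sup>+z. ennreal (1 - g z) \<partial>L) = ennreal (\<integral>z. 1 - g z \<partial>L)"
        by (rule nn_integral_eq_integral) (use g i in auto)
      then show "(\<integral>\<^sup>+z. ennreal (1 - g z) \<partial>L) = ennreal (1 - (\<integral>z. g z \<partial>L))"
        using i by (simp add: L.prob_space)
    qed
    have "continuous_on UNIV (\<lambda>z. 1 - g z)" by (intro continuous_intros g)
    from fatou[OF this] fatou[OF g(1)] show ?thesis
      using g(2) gL[OF R sR] gL[OF M setsM'] by (intro tendsto_of_liminf_bounds) auto
  qed
  have tm [measurable]: "t l \<in> borel_measurable borel" for l
    by (rule borel_measurable_continuous_onI[OF t(1)])
  have R1: "distr R borel fst = \<mu>"
  proof (rule det)
    show "prob_space (distr R borel fst)" by (rule R.prob_space_distr) measurable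
    fix l
    have "(\<integral>z. t l (fst z) \<partial>M n) = (\<integral>x. t l x \<partial>\<mu>)" for n
      unfolding first[of n, symmetric] by (subst integral_distr) auto
    moreover have "(\<lambda>n. \<integral>z. t l (fst z) \<partial>M (r n)) \<longlonglongrightarrow> (\<integral>z. t l (fst z) \<partial>R)"
      by (rule conv) (use t in \<open>auto intro!: continuous_on_compose2[OF t(1)] continuous_intros\<close>)
    ultimately have "(\<integral>x. t l x \<partial>\<mu>) = (\<integral>z. t l (fst z) \<partial>R)" by (simp add: LIMSEQ_const_iff)
    then show "(\<integral>z. t l z \<partial>distr R borel fst) = (\<integral>z. t l z \<partial>\<mu>)" by (subst integral_distr) auto
  qed (use mu in auto)
  have R2: "distr R borel snd = \<nu>"
  proof (rule det)
    show "prob_space (distr R borel snd)" by (rule R.prob_space_distr) measurable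
    fix l
    have "(\<lambda>n. \<integral>z. t l (snd z) \<partial>M (r n)) \<longlonglongrightarrow> (\<integral>y. t l y \<partial>\<nu>)"
      using LIMSEQ_subseq_LIMSEQ[OF second r] by (simp add: comp_def)
    moreover have "(\<lambda>n. \<integral>z. t l (snd z) \<partial>M (r n)) \<longlonglongrightarrow> (\<integral>z. t l (snd z) \<partial>R)"
      by (rule conv) (use t in \<open>auto intro!: continuous_on_compose2[OF t(1)] continuous_intros\<close>)
    ultimately have "(\<integral>y. t l y \<partial>\<nu>) = (\<integral>z. t l (snd z) \<partial>R)" by (rule LIMSEQ_unique)
    then show "(\<integral>z. t l z \<partial>distr R borel snd) = (\<integral>z. t l z \<partial>\<nu>)" by (subst integral_distr) auto
  qed (use nu in auto)
  note Rfst = fst_int[OF sR' R1]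
  have "integrable (distr R borel snd) norm" using nu(3) R2 by simp
  then have Rsnd: "integrable R (\<lambda>z. norm (snd z))" "(\<integral>z. norm (snd z) \<partial>R) = m"
    unfolding m_def R2[symmetric] by (subst (asm) integrable_distr_eq, auto, subst integral_distr, auto)
  have bound: "\<bar>h (fst z) * (a \<bullet> (snd z - fst z))\<bar> \<le> norm a * (norm (fst z) + norm (snd z))"
    if "\<And>x. 0 \<le> h x \<and> h x \<le> 1" for h :: "'a \<Rightarrow> real" and a and z :: "'a \<times> 'a"
  proof -
    have "\<bar>h (fst z) * (a \<bullet> (snd z - fst z))\<bar> \<le> 1 * (norm a * norm (snd z - fst z))"
      unfolding abs_mult by (intro mult_mono) (use that[of "fst z"] in \<open>auto simp: Cauchy_Schwarz_ineq2\<close>)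
    also have "\<dots> \<le> norm a * (norm (fst z) + norm (snd z))"
      using norm_triangle_ineq4[of "snd z" "fst z"] by (auto intro!: mult_left_mono)
    finally show ?thesis .
  qed
  have int: "integrable L (\<lambda>z. h (fst z) * (a \<bullet> (snd z - fst z)))"
    if "\<And>x. 0 \<le> h x \<and> h x \<le> 1" and [measurable]: "h \<in> borel_measurable borel"
      and [measurable_cong]: "sets L = sets (borel \<Otimes>\<^sub>M borel)"
      and "integrable L (\<lambda>z. norm (fst z))" "integrable L (\<lambda>z. norm (snd z))"
    for h :: "'a \<Rightarrow> real" and a and L :: "('a \<times> 'a) measure"
  proof (rule Bochner_Integration.integrable_bound)
    show "integrable L (\<lambda>z. norm a * (norm (fst z) + norm (snd z)))" using that by auto
    show "AE z in L. norm (h (fst z) * (a \<bullet> (snd z - fst z))) \<le> norm (norm a * (norm (fst z) + norm (snd z)))"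
      using bound[of h _ a, OF that(1)] by (auto simp del: abs_mult)
  qed measurable
  have drift_cont: "0 \<le> (\<integral>z. h (fst z) * (a \<bullet> (snd z - fst z)) \<partial>R)"
    if a: "\<And>c. c \<in> C \<Longrightarrow> 0 \<le> a \<bullet> c" and h: "continuous_on UNIV h" "\<And>x. 0 \<le> h x \<and> h x \<le> 1"
    for h :: "'a \<Rightarrow> real" and a
  proof -
    (* Fatou's lemma for F >= 0 is enough because the moments of the first summand converge. *)
    define F where "F z = norm a * (norm (fst z) + norm (snd z)) - h (fst z) * (a \<bullet> (snd z - fst z))" for z
    have hm: "h \<in> borel_measurable borel" by (rule borel_measurable_continuous_onI[OF h(1)])
    have F0: "0 \<le> F z" for z using bound[of h z a, OF h(2)] by (auto simp: F_def)
    have Fc: "continuous_on UNIV F"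
      unfolding F_def by (intro continuous_intros continuous_on_compose2[OF h(1)]) auto
    have FL: "(\<integral>\<^sup>+z. ennreal (F z) \<partial>L) = ennreal (norm a * ((\<integral>z. norm (fst z) \<partial>L) + (\<integral>z. norm (snd z) \<partial>L)) - (\<integral>z. h (fst z) * (a \<bullet> (snd z - fst z)) \<partial>L))"
      "0 \<le> norm a * ((\<integral>z. norm (fst z) \<partial>L) + (\<integral>z. norm (snd z) \<partial>L)) - (\<integral>z. h (fst z) * (a \<bullet> (snd z - fst z)) \<partial>L)"
      if s: "sets L = sets (borel \<Otimes>\<^sub>M borel)" and i: "integrable L (\<lambda>z. norm (fst z))" "integrable L (\<lambda>z. norm (snd z))" for L
    proof -
      note i' = int[of h L a, OF h(2) hm s i]
      have eq: "(\<integral>z. F z \<partial>L) = norm a * ((\<integral>z. norm (fst z) \<partial>L) + (\<integral>z. norm (snd z) \<partial>L)) - (\<integral>z. h (fst z) * (a \<bullet> (snd z - fst z)) \<partial>L)"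
        unfolding F_def using i i' by simp
      have "(\<integral>\<^sup>+z. ennreal (F z) \<partial>L) = ennreal (\<integral>z. F z \<partial>L)"
        by (rule nn_integral_eq_integral) (use F0 i i' in \<open>auto simp: F_def[abs_def]\<close>)
      then show "(\<integral>\<^sup>+z. ennreal (F z) \<partial>L) = ennreal (norm a * ((\<integral>z. norm (fst z) \<partial>L) + (\<integral>z. norm (snd z) \<partial>L)) - (\<integral>z. h (fst z) * (a \<bullet> (snd z - fst z)) \<partial>L))"
        unfolding eq .
      show "0 \<le> norm a * ((\<integral>z. norm (fst z) \<partial>L) + (\<integral>z. norm (snd z) \<partial>L)) - (\<integral>z. h (fst z) * (a \<bullet> (snd z - fst z)) \<partial>L)"
        unfolding eq[symmetric] by (rule Bochner_Integration.integral_nonneg) (rule F0)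
    qed
    have "(\<integral>\<^sup>+z. ennreal (F z) \<partial>M n) \<le> ennreal (norm a * (A + (m + \<epsilon> n)))" for n
    proof -
      have "norm a * (A + (\<integral>z. norm (snd z) \<partial>M n)) \<le> norm a * (A + (m + \<epsilon> n))"
        using moment(2)[of n] by (intro mult_left_mono) (auto simp: m_def)
      then show ?thesis
        unfolding FL(1)[OF setsM Mfst(1) moment(1)] Mfst(2)
        using drift[of a h n, OF a h] by (intro ennreal_leI) auto
    qed
    then have "liminf (\<lambda>n. \<integral>\<^sup>+z. ennreal (F z) \<partial>M (r n)) \<le> liminf (\<lambda>n. ennreal (norm a * (A + (m + \<epsilon> (r n)))))"
      by (intro Liminf_mono always_eventually) auto
    also have "\<dots> = ennreal (norm a * (A + (m + 0)))"
    proof (rule lim_imp_Liminf)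
      have "(\<lambda>n. \<epsilon> (r n)) \<longlonglongrightarrow> 0" using LIMSEQ_subseq_LIMSEQ[OF eps(1) r] by (simp add: comp_def)
      then show "(\<lambda>n. ennreal (norm a * (A + (m + \<epsilon> (r n))))) \<longlonglongrightarrow> ennreal (norm a * (A + (m + 0)))"
        by (intro tendsto_ennrealI tendsto_intros)
    qed simp
    \<comment> \<open>The moments of \<open>R\<close> are exactly \<open>A\<close> and
      \<open>m\<close>, so they cancel from the integral of \<open>F\<close> and leave the sign of
      the drift of \<open>R\<close>.\<close>
    finally have "(\<integral>\<^sup>+z. ennreal (F z) \<partial>R) \<le> ennreal (norm a * (A + m))"
      using fatou[OF Fc F0] by (simp add: order_trans)
    moreover have "0 \<le> norm a * (A + m)" unfolding A_def m_def by simp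
    ultimately show ?thesis
      using FL(2)[OF sR' Rfst(1) Rsnd(1)]
      unfolding FL(1)[OF sR' Rfst(1) Rsnd(1)] Rfst(2) Rsnd(2) by (simp add: ennreal_le_iff)
  qed
  have dR: "cone_drift C R"
    unfolding cone_drift_def
  proof (intro allI impI ballI)
    fix a :: 'a and B :: "'a set" assume a: "\<forall>c\<in>C. 0 \<le> a \<bullet> c" and B: "B \<in> sets borel"
    define g where "g z = a \<bullet> (snd z - fst z)" for z :: "'a \<times> 'a"
    have ig: "integrable R g"
      using int[of "\<lambda>_. 1" R a] sR' Rfst(1) Rsnd(1) by (simp add: g_def[abs_def])
    have [measurable]: "g \<in> borel_measurable R" using ig by auto
    \<comment> \<open>Continuous \<open>h\<close> reach indicators of open sets; Borel sets then
      follow by regularity.\<close>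
    have op: "0 \<le> (\<integral>z. indicator U (fst z) * g z \<partial>R)" if U: "open U" for U :: "'a set"
    proof -
      have [measurable]: "U \<in> sets borel" using U by auto
      have "(\<lambda>k. \<integral>z. bump U k (fst z) * g z \<partial>R) \<longlonglongrightarrow> (\<integral>z. indicator U (fst z) * g z \<partial>R)"
      proof (rule integral_dominated_convergence)
        show "integrable R (\<lambda>z. \<bar>g z\<bar>)" using ig by auto
        show "AE z in R. (\<lambda>k. bump U k (fst z) * g z) \<longlonglongrightarrow> indicator U (fst z) * g z"
          by (intro AE_I2 tendsto_intros tendsto_bump U)
        show "AE z in R. norm (bump U k (fst z) * g z) \<le> \<bar>g z\<bar>" for k
          by (intro AE_I2) (simp add: abs_mult bump_range mult_left_le_one_le)
      qed measurable
      then show ?thesis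
        by (rule LIMSEQ_le_const)
          (use drift_cont[of a "bump U _"] a in \<open>auto simp: g_def bump_range continuous_intros\<close>)
    qed
    show "0 \<le> (\<integral>z. indicator B (fst z) * (a \<bullet> (snd z - fst z)) \<partial>R)"
      using drift_open_imp_drift_borel[OF R sR' ig op B] by (simp add: g_def)
  qed
  show thesis
    by (rule that[OF r R sR' R1 R2 dR]) (rule conv)
qed

section \<open>The theorem\<close>

theorem cone_strassen_kernel:
  fixes P Q :: "'s \<Rightarrow> 'a::euclidean_space measure"
  assumes P: "P \<in> S \<rightarrow>\<^sub>M prob_algebra borel" and Q: "Q \<in> S \<rightarrow>\<^sub>M prob_algebra borel"
    and Pm: "\<And>\<theta>. \<theta> \<in> space S \<Longrightarrow> (\<integral>\<^sup>+ x. ennreal (norm x) \<partial>P \<theta>) < \<infinity>"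
    and Qm: "\<And>\<theta>. \<theta> \<in> space S \<Longrightarrow> (\<integral>\<^sup>+ x. ennreal (norm x) \<partial>Q \<theta>) < \<infinity>"
    and C: "convex_cone C" and le: "\<And>\<theta>. \<theta> \<in> space S \<Longrightarrow> cone_le C (P \<theta>) (Q \<theta>)"
  shows "\<exists>R \<in> S \<rightarrow>\<^sub>M prob_algebra (borel \<Otimes>\<^sub>M borel). \<forall>\<theta>\<in>space S.
    distr (R \<theta>) borel fst = P \<theta> \<and> distr (R \<theta>) borel snd = Q \<theta> \<and> cone_drift C (R \<theta>)"
proof -
  obtain t :: "nat \<Rightarrow> 'a \<Rightarrow> real"
    where t: "\<And>l. continuous_on UNIV (t l)" "\<And>l z. 0 \<le> t l z" "\<And>l z. t l z \<le> 1"
    and det: "\<forall>M N. prob_space M \<longrightarrow> prob_space N \<longrightarrow> sets M = sets borel \<longrightarrow> sets N = sets borel \<longrightarrow>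
           (\<forall>l. (\<integral>z. t l z \<partial>M) = (\<integral>z. t l z \<partial>N)) \<longrightarrow> M = N"
    using test_functions[where 'a='a] by metis
  \<comment> \<open>A second family, on the product space: the functions \<open>t\<close> pin down
    marginals, the functions \<open>s\<close> the coupling.\<close>
  obtain s :: "nat \<Rightarrow> 'a \<times> 'a \<Rightarrow> real"
    where s: "\<And>l. continuous_on UNIV (s l)" "\<And>l z. 0 \<le> s l z" "\<And>l z. s l z \<le> 1"
    and kernelI: "\<forall>(S :: 's measure) K. (\<forall>\<theta>\<in>space S. prob_space (K \<theta>) \<and> sets (K \<theta>) = sets borel) \<longrightarrow>
           (\<forall>l. (\<lambda>\<theta>. \<integral>z. s l z \<partial>K \<theta>) \<in> borel_measurable S) \<longrightarrow> K \<in> S \<rightarrow>\<^sub>M prob_algebra borel"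
    using test_functions[where 'a="'a \<times> 'a" and 's='s] by metis
  have "0 \<in> C" using C convex_cone_contains_0 by blast
  then obtain move_len :: "nat \<Rightarrow> nat" and move :: "nat \<Rightarrow> nat \<Rightarrow> real \<times> 'a"
    where move: "\<And>m. move m \<in> moves C (move_len m)"
    and move_dense: "\<And>k z f x e. z \<in> moves C k \<Longrightarrow> continuous_on UNIV f \<Longrightarrow> 0 < e \<Longrightarrow>
           \<exists>m. move_mean k z f x - e < move_mean (move_len m) (move m) f x"
    using countable_dense_moves by metis
  define f where "f j = (case j of 0 \<Rightarrow> norm | Suc l \<Rightarrow> t l)" for j
  interpret candidate_kernels C move_len move f
  proof
    show "continuous_on UNIV (f j)" for j
      by (cases j) (auto simp: f_def t intro: continuous_intros)
    show "0 \<le> f j x \<and> f j x \<le> 1" if "j \<noteq> 0" for j x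
      using that by (cases j) (auto simp: f_def t)
  qed (use C move move_dense in \<open>auto simp: f_def\<close>)
  have prob: "prob_space (K \<theta>)" "sets (K \<theta>) = sets borel" "integrable (K \<theta>) norm"
    if K: "K \<in> S \<rightarrow>\<^sub>M prob_algebra borel" and m: "(\<integral>\<^sup>+ x. ennreal (norm x) \<partial>K \<theta>) < \<infinity>"
      and \<theta>: "\<theta> \<in> space S" for K :: "'s \<Rightarrow> 'a measure" and \<theta>
  proof -
    show "prob_space (K \<theta>)" and s: "sets (K \<theta>) = sets borel"
      using measurable_space[OF K \<theta>] by (auto simp: space_prob_algebra)
    note [measurable_cong] = s
    show "integrable (K \<theta>) norm" using m by (intro integrableI_bounded) auto
  qed
  note pP = prob[OF P Pm] and pQ = prob[OF Q Qm]
  have mP [measurable]: "(\<lambda>\<theta>. \<integral>x. g x \<partial>P \<theta>) \<in> borel_measurable S" if "g \<in> borel_measurable borel" for g :: "'a \<Rightarrow> real"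
    by (rule measurable_compose[OF measurable_prob_algebraD[OF P] integral_measurable_subprob_algebra[OF that]])
  have mQ [measurable]: "(\<lambda>\<theta>. \<integral>x. g x \<partial>Q \<theta>) \<in> borel_measurable S" if "g \<in> borel_measurable borel" for g :: "'a \<Rightarrow> real"
    by (rule measurable_compose[OF measurable_prob_algebraD[OF Q] integral_measurable_subprob_algebra[OF that]])
  \<comment> \<open>Accuracy \<open>1 / Suc n\<close> on the first \<open>n\<close> bounded test
    functions, and the one-sided bound for the norm at index 0.\<close>
  define good where "good n T \<theta> \<longleftrightarrow>
    (\<integral>x. kernel_test T 0 x \<partial>P \<theta>) < (\<integral>x. f 0 x \<partial>Q \<theta>) + 1 / real (Suc n) \<and>
    (\<forall>j. 0 < j \<and> j \<le> n \<longrightarrow> \<bar>(\<integral>x. kernel_test T j x \<partial>P \<theta>) - (\<integral>x. f j x \<partial>Q \<theta>)\<bar> < 1 / real (Suc n))" for n T \<theta>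
  define idx where "idx n \<theta> = (LEAST i. good n (from_nat i) \<theta>)" for n \<theta>
  define M where "M n \<theta> = kernel_coupling (from_nat (idx n \<theta>)) (P \<theta>)" for n \<theta>
  have [measurable]: "Measurable.pred S (good n T)" for n T
    unfolding good_def[abs_def] by measurable
  have idx [measurable]: "idx n \<in> S \<rightarrow>\<^sub>M count_space UNIV" for n
    unfolding idx_def[abs_def] by measurable
  have good: "good n (from_nat (idx n \<theta>)) \<theta>" if \<theta>: "\<theta> \<in> space S" for n \<theta>
  proof -
    obtain T where "good n T \<theta>"
      using approximate_marginal[OF pP[OF \<theta> \<theta>] pQ[OF \<theta> \<theta>] le[OF \<theta>], of "1 / real (Suc n)" n]
      unfolding good_def by auto
    then have "good n (from_nat (to_nat T)) \<theta>" by simp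
    then show ?thesis unfolding idx_def by (rule LeastI)
  qed
  have sm [measurable]: "s l \<in> borel_measurable (borel \<Otimes>\<^sub>M borel)" for l
    unfolding borel_prod by (rule borel_measurable_continuous_onI[OF s(1)])
  have xm: "(\<lambda>\<theta>. \<integral>z. s l z \<partial>M n \<theta>) \<in> borel_measurable S" for l n
    unfolding M_def
  proof (rule measurable_compose_countable[OF _ idx])
    show "(\<lambda>\<theta>. \<integral>z. s l z \<partial>kernel_coupling (from_nat i) (P \<theta>)) \<in> borel_measurable S" for i
      by (rule measurable_compose[OF measurable_prob_algebraD[OF kernel_coupling_prob_kernel[OF P]] integral_measurable_subprob_algebra[OF sm]])
  qed
  have pM: "prob_space (M n \<theta>)" "sets (M n \<theta>) = sets (borel \<Otimes>\<^sub>M borel)" if "\<theta> \<in> space S" for n \<theta>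
    using prob_space_kernel_coupling[OF pP(1,2)[OF that that]] by (auto simp: M_def)
  have x01: "0 \<le> (\<integral>z. s l z \<partial>M n \<theta>) \<and> (\<integral>z. s l z \<partial>M n \<theta>) \<le> 1" if \<theta>: "\<theta> \<in> space S" for l n \<theta>
  proof -
    interpret prob_space "M n \<theta>" by (rule pM[OF \<theta>])
    note [measurable_cong] = pM(2)[OF \<theta>]
    have i: "integrable (M n \<theta>) (s l)" by (rule integrable_const_bound[where B=1]) (use s in auto)
    show ?thesis using s integral_le_const[OF i, of 1] by (auto intro!: Bochner_Integration.integral_nonneg)
  qed
  obtain \<xi> where \<xi>: "\<And>l::nat. \<xi> l \<in> borel_measurable S"
    and cluster: "\<And>\<theta>. \<theta> \<in> space S \<Longrightarrow> \<exists>r. strict_mono r \<and> (\<forall>l. (\<lambda>k. \<integral>z. s l z \<partial>M (r k) \<theta>) \<longlonglongrightarrow> \<xi> l \<theta>)"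
    using measurable_cluster_point[of "\<lambda>l n \<theta>. \<integral>z. s l z \<partial>M n \<theta>" S, OF xm x01] by blast
  have "\<exists>R. prob_space R \<and> sets R = sets (borel \<Otimes>\<^sub>M borel) \<and> distr R borel fst = P \<theta> \<and>
      distr R borel snd = Q \<theta> \<and> cone_drift C R \<and> (\<forall>l. (\<integral>z. s l z \<partial>R) = \<xi> l \<theta>)" if \<theta>: "\<theta> \<in> space S" for \<theta>
  proof -
    obtain r where r: "strict_mono r" and lim: "\<And>l. (\<lambda>k. \<integral>z. s l z \<partial>M (r k) \<theta>) \<longlonglongrightarrow> \<xi> l \<theta>"
      using cluster[OF \<theta>] by blast
    note pP = pP[OF \<theta> \<theta>] and pQ = pQ[OF \<theta> \<theta>] and pM = pM[OF \<theta>]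
    have rk: "k \<le> r k" for k by (rule seq_suble[OF r])
    have Mf: "(\<integral>z. f j (snd z) \<partial>M n \<theta>) = (\<integral>x. kernel_test (from_nat (idx n \<theta>)) j x \<partial>P \<theta>)" for j n
      unfolding M_def by (rule integral_kernel_coupling_test[OF pP])
    have second: "(\<lambda>k. \<integral>z. t l (snd z) \<partial>M (r k) \<theta>) \<longlonglongrightarrow> (\<integral>y. t l y \<partial>Q \<theta>)" for l
    proof -
      have "(\<lambda>k. (\<integral>z. f (Suc l) (snd z) \<partial>M (r k) \<theta>) - (\<integral>y. f (Suc l) y \<partial>Q \<theta>)) \<longlonglongrightarrow> 0"
      proof (rule Lim_null_comparison)
        show "(\<lambda>k. 1 / real (Suc k)) \<longlonglongrightarrow> 0" by (fact LIMSEQ_Suc[OF lim_1_over_n])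
        show "\<forall>\<^sub>F k in sequentially. norm ((\<integral>z. f (Suc l) (snd z) \<partial>M (r k) \<theta>) - (\<integral>y. f (Suc l) y \<partial>Q \<theta>)) \<le> 1 / real (Suc k)"
          unfolding eventually_sequentially
        proof (intro exI allI impI)
          fix k assume "Suc l \<le> k"
          then have "Suc l \<le> r k" using rk[of k] by simp
          then have "\<bar>(\<integral>z. f (Suc l) (snd z) \<partial>M (r k) \<theta>) - (\<integral>y. f (Suc l) y \<partial>Q \<theta>)\<bar> < 1 / real (Suc (r k))"
            using good[OF \<theta>, of "r k"] unfolding good_def Mf by blast
          also have "\<dots> \<le> 1 / real (Suc k)" using rk[of k] by (simp add: frac_le)
          finally show "norm ((\<integral>z. f (Suc l) (snd z) \<partial>M (r k) \<theta>) - (\<integral>y. f (Suc l) y \<partial>Q \<theta>)) \<le> 1 / real (Suc k)"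
            by simp
        qed
      qed
      then show ?thesis unfolding f_def by (simp add: LIM_zero_iff)
    qed
    have normi: "integrable (M (r k) \<theta>) (\<lambda>z. norm (snd z))" for k
      unfolding M_def by (rule integral_kernel_coupling(1)[OF pP, where K=1]) auto
    have moment: "(\<integral>z. norm (snd z) \<partial>M (r k) \<theta>) \<le> (\<integral>y. norm y \<partial>Q \<theta>) + 1 / real (Suc k)" for k
    proof -
      have "(\<integral>z. norm (snd z) \<partial>M (r k) \<theta>) = (\<integral>x. kernel_test (from_nat (idx (r k) \<theta>)) 0 x \<partial>P \<theta>)"
        using Mf[where j=0 and n="r k"] by (simp add: f_0)
      also have "\<dots> < (\<integral>y. norm y \<partial>Q \<theta>) + 1 / real (Suc (r k))"
        using good[OF \<theta>, of "r k"] unfolding good_def f_0 by blast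
      also have "\<dots> \<le> (\<integral>y. norm y \<partial>Q \<theta>) + 1 / real (Suc k)" using rk[of k] by (simp add: frac_le)
      finally show ?thesis by simp
    qed
    have first: "distr (M (r k) \<theta>) borel fst = P \<theta>" for k
      unfolding M_def by (rule kernel_coupling_fst[OF pP(2)])
    have drift: "0 \<le> (\<integral>z. h (fst z) * (a \<bullet> (snd z - fst z)) \<partial>M (r k) \<theta>)"
      if "\<And>c. c \<in> C \<Longrightarrow> 0 \<le> a \<bullet> c" "continuous_on UNIV h" "\<And>x. 0 \<le> h x \<and> h x \<le> 1" for k a h
      unfolding M_def
      by (rule integral_kernel_coupling_drift(2)[OF pP borel_measurable_continuous_onI[OF that(2)] that(3) that(1)])
    have eps: "(\<lambda>k. 1 / real (Suc k)) \<longlonglongrightarrow> 0" "\<And>k. 1 / real (Suc k) \<le> 1"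
      by (fact LIMSEQ_Suc[OF lim_1_over_n], simp)
    obtain r' R where r': "strict_mono r'" and R: "prob_space R" "sets R = sets (borel \<Otimes>\<^sub>M borel)"
      "distr R borel fst = P \<theta>" "distr R borel snd = Q \<theta>" "cone_drift C R"
      and conv: "\<And>g :: 'a \<times> 'a \<Rightarrow> real. continuous_on UNIV g \<Longrightarrow> (\<And>z. 0 \<le> g z \<and> g z \<le> 1) \<Longrightarrow>
       (\<lambda>n. \<integral>z. g z \<partial>M (r (r' n)) \<theta>) \<longlonglongrightarrow> (\<integral>z. g z \<partial>R)"
      using limit_coupling[where M="\<lambda>k. M (r k) \<theta>" and t=t and \<mu>="P \<theta>" and \<nu>="Q \<theta>" and C=C and \<epsilon>="\<lambda>k. 1 / real (Suc k)",
        OF pM pP pQ t det[rule_format] first second normi moment eps drift] by blast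
    \<comment> \<open>The subsequence \<open>r'\<close> depends on \<theta> in no controlled way,
      but the integrals of \<open>s l\<close> already converge along \<open>r\<close>, so they
      cannot depend on \<open>r'\<close>.\<close>
    have "(\<integral>z. s l z \<partial>R) = \<xi> l \<theta>" for l
    proof (rule LIMSEQ_unique)
      show "(\<lambda>n. \<integral>z. s l z \<partial>M (r (r' n)) \<theta>) \<longlonglongrightarrow> (\<integral>z. s l z \<partial>R)"
        by (rule conv) (use s in auto)
      show "(\<lambda>n. \<integral>z. s l z \<partial>M (r (r' n)) \<theta>) \<longlonglongrightarrow> \<xi> l \<theta>"
        using LIMSEQ_subseq_LIMSEQ[OF lim r'] by (simp add: comp_def)
    qed
    with R show ?thesis by blast
  qed
  then obtain R where R: "\<And>\<theta>. \<theta> \<in> space S \<Longrightarrow> prob_space (R \<theta>) \<and> sets (R \<theta>) = sets (borel \<Otimes>\<^sub>M borel) \<and>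
      distr (R \<theta>) borel fst = P \<theta> \<and> distr (R \<theta>) borel snd = Q \<theta> \<and> cone_drift C (R \<theta>) \<and>
      (\<forall>l. (\<integral>z. s l z \<partial>R \<theta>) = \<xi> l \<theta>)"
    by metis
  \<comment> \<open>\<open>R\<close> was chosen separately at each \<theta>; its measurability comes
    from that of \<open>\<xi>\<close> alone.\<close>
  have "R \<in> S \<rightarrow>\<^sub>M prob_algebra borel"
  proof (rule kernelI[rule_format])
    show "prob_space (R \<theta>) \<and> sets (R \<theta>) = sets borel" if "\<theta> \<in> space S" for \<theta>
      using R[OF that] by (simp only: borel_prod)
    show "(\<lambda>\<theta>. \<integral>z. s l z \<partial>R \<theta>) \<in> borel_measurable S" for l
      by (rule measurable_cong[THEN iffD1, OF _ \<xi>[of l]]) (use R in auto)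
  qed
  then show ?thesis using R by (intro bexI[of _ R]) (auto simp: borel_prod)
qed

section \<open>From cones back to the convex and the increasing convex order\<close>

lemma cx_le_iff_cone_le: "cx_le \<mu> \<nu> \<longleftrightarrow> cone_le {0} \<mu> \<nu>"
  by (simp add: cx_le_def cone_le_def)

lemma icx_le_iff_cone_le:
  fixes \<mu> \<nu> :: "(real ^ 'n) measure"
  shows "icx_le \<mu> \<nu> \<longleftrightarrow> cone_le {c. 0 \<le> c} \<mu> \<nu>"
proof -
  have "mono \<phi> \<longleftrightarrow> (\<forall>x. \<forall>c\<in>{c. 0 \<le> c}. \<phi> x \<le> \<phi> (x + c))" for \<phi> :: "real ^ 'n \<Rightarrow> real"
  proof
    assume shift: "\<forall>x. \<forall>c\<in>{c. 0 \<le> c}. \<phi> x \<le> \<phi> (x + c)"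
    show "mono \<phi>"
    proof (rule monoI)
      fix x y :: "real ^ 'n" assume "x \<le> y"
      then show "\<phi> x \<le> \<phi> y" using shift[rule_format, of "y - x" x] by simp
    qed
  qed (simp add: mono_def)
  then show ?thesis unfolding icx_le_def cone_le_def by simp
qed

lemma convex_cone_nonneg_orthant: "convex_cone {c :: real ^ 'n. 0 \<le> c}"
  by (auto simp: convex_cone_iff less_eq_vec_def)

lemma cone_le_of_drift_coupling:
  fixes \<mu> \<nu> :: "(real ^ 'n) measure"
  assumes "convex_cone C" "coupling \<mu> \<nu> R" "cone_drift C R" "integrable R fst" "integrable R snd"
  shows "cone_le C \<mu> \<nu>"
  using cone_drift_imp_cone_le[of R C] assms by (auto simp: coupling_def)

lemma martingale_laws_D:
  assumes "R \<in> martingale_laws"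
  shows "cone_drift {0} R" "integrable R fst" "integrable R snd"
  using assms martingale_pair_imp_cone_drift integrable_coordinates_law(2,3)
  unfolding martingale_laws_def martingale_pair_def by blast+

lemma submartingale_laws_D:
  assumes "R \<in> submartingale_laws"
  shows "cone_drift {c. 0 \<le> c} R" "integrable R fst" "integrable R snd"
  using assms submartingale_pair_imp_cone_drift integrable_coordinates_law(2,3)
  unfolding submartingale_laws_def submartingale_pair_def by blast+

lemma ex_drift_coupling:
  fixes P Q :: "'s \<Rightarrow> (real ^ 'n) measure"
  assumes P: "P \<in> S \<rightarrow>\<^sub>M prob_algebra borel" and Q: "Q \<in> S \<rightarrow>\<^sub>M prob_algebra borel"
    and Pm: "finite_first_moments S P" and Qm: "finite_first_moments S Q"
    and C: "convex_cone C" and le: "\<And>\<theta>. \<theta> \<in> space S \<Longrightarrow> cone_le C (P \<theta>) (Q \<theta>)"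
  obtains R where "pointwise_coupling S P Q R"
    "\<And>\<theta>. \<theta> \<in> space S \<Longrightarrow> prob_space (R \<theta>) \<and> sets (R \<theta>) = sets (borel \<Otimes>\<^sub>M borel) \<and>
       integrable (R \<theta>) fst \<and> integrable (R \<theta>) snd \<and> cone_drift C (R \<theta>)"
proof -
  have "\<exists>R \<in> S \<rightarrow>\<^sub>M prob_algebra (borel \<Otimes>\<^sub>M borel). \<forall>\<theta>\<in>space S.
    distr (R \<theta>) borel fst = P \<theta> \<and> distr (R \<theta>) borel snd = Q \<theta> \<and> cone_drift C (R \<theta>)"
    by (rule cone_strassen_kernel[OF P Q _ _ C le]) (use Pm Qm in \<open>auto simp: finite_first_moments_def\<close>)
  then obtain R where R: "R \<in> S \<rightarrow>\<^sub>M prob_algebra (borel \<Otimes>\<^sub>M borel)"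
    and Rd: "\<And>\<theta>. \<theta> \<in> space S \<Longrightarrow> distr (R \<theta>) borel fst = P \<theta>" "\<And>\<theta>. \<theta> \<in> space S \<Longrightarrow> distr (R \<theta>) borel snd = Q \<theta>"
      "\<And>\<theta>. \<theta> \<in> space S \<Longrightarrow> cone_drift C (R \<theta>)"
    by blast
  have Rp: "prob_space (R \<theta>)" "sets (R \<theta>) = sets (borel \<Otimes>\<^sub>M borel)" if "\<theta> \<in> space S" for \<theta>
    using measurable_space[OF R that] by (auto simp: space_prob_algebra)
  have "integrable (R \<theta>) fst" "integrable (R \<theta>) snd" if \<theta>: "\<theta> \<in> space S" for \<theta>
  proof -
    note [measurable_cong] = Rp(2)[OF \<theta>]
    have K: "integrable (K \<theta>) (\<lambda>x. x)" if "K \<in> S \<rightarrow>\<^sub>M prob_algebra borel" "finite_first_moments S K"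
      for K :: "'s \<Rightarrow> (real ^ 'n) measure"
    proof (rule integrableI_bounded)
      have [measurable_cong]: "sets (K \<theta>) = sets borel"
        using measurable_space[OF that(1) \<theta>] by (simp add: space_prob_algebra)
      show "(\<lambda>x. x) \<in> borel_measurable (K \<theta>)" by measurable
      show "(\<integral>\<^sup>+ x. ennreal (norm x) \<partial>K \<theta>) < \<infinity>" using that(2) \<theta> by (simp add: finite_first_moments_def)
    qed
    show "integrable (R \<theta>) fst"
      using K[OF P Pm] unfolding Rd(1)[OF \<theta>, symmetric] by (subst (asm) integrable_distr_eq) auto
    show "integrable (R \<theta>) snd"
      using K[OF Q Qm] unfolding Rd(2)[OF \<theta>, symmetric] by (subst (asm) integrable_distr_eq) auto
  qed
  moreover have "pointwise_coupling S P Q R"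
    unfolding pointwise_coupling_def coupling_def using R Rd(1,2) Rp by blast
  ultimately show thesis using that Rp Rd(3) by blast
qed

theorem theorem1p3:
  fixes S :: "'s measure"
    and P Q :: "'s \<Rightarrow> (real ^ 'n) measure"
  assumes "P \<in> S \<rightarrow>\<^sub>M prob_algebra borel"
    and "Q \<in> S \<rightarrow>\<^sub>M prob_algebra borel"
    and "finite_first_moments S P"
    and "finite_first_moments S Q"
  shows "((\<forall>\<theta>\<in>space S. cx_le (P \<theta>) (Q \<theta>)) \<longleftrightarrow>
           (\<exists>R. pointwise_coupling S P Q R \<and> (\<forall>\<theta>\<in>space S. R \<theta> \<in> martingale_laws))) \<and>
         ((\<forall>\<theta>\<in>space S. icx_le (P \<theta>) (Q \<theta>)) \<longleftrightarrow>
           (\<exists>R. pointwise_coupling S P Q R \<and> (\<forall>\<theta>\<in>space S. R \<theta> \<in> submartingale_laws)))"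
proof (intro conjI iffI)
  assume "\<forall>\<theta>\<in>space S. cx_le (P \<theta>) (Q \<theta>)"
  then have le: "\<And>\<theta>. \<theta> \<in> space S \<Longrightarrow> cone_le {0} (P \<theta>) (Q \<theta>)" by (simp add: cx_le_iff_cone_le)
  obtain R where "pointwise_coupling S P Q R"
    "\<And>\<theta>. \<theta> \<in> space S \<Longrightarrow> prob_space (R \<theta>) \<and> sets (R \<theta>) = sets (borel \<Otimes>\<^sub>M borel) \<and>
       integrable (R \<theta>) fst \<and> integrable (R \<theta>) snd \<and> cone_drift {0} (R \<theta>)"
    using ex_drift_coupling[OF assms convex_cone_singleton le] by metis
  then show "\<exists>R. pointwise_coupling S P Q R \<and> (\<forall>\<theta>\<in>space S. R \<theta> \<in> martingale_laws)"
    by (intro exI[of _ R]) (simp add: cone_drift_imp_martingale_laws)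
next
  assume "\<forall>\<theta>\<in>space S. icx_le (P \<theta>) (Q \<theta>)"
  then have le: "\<And>\<theta>. \<theta> \<in> space S \<Longrightarrow> cone_le {c. 0 \<le> c} (P \<theta>) (Q \<theta>)" by (simp add: icx_le_iff_cone_le)
  obtain R where "pointwise_coupling S P Q R"
    "\<And>\<theta>. \<theta> \<in> space S \<Longrightarrow> prob_space (R \<theta>) \<and> sets (R \<theta>) = sets (borel \<Otimes>\<^sub>M borel) \<and>
       integrable (R \<theta>) fst \<and> integrable (R \<theta>) snd \<and> cone_drift {c. 0 \<le> c} (R \<theta>)"
    using ex_drift_coupling[OF assms convex_cone_nonneg_orthant le] by metis
  then show "\<exists>R. pointwise_coupling S P Q R \<and> (\<forall>\<theta>\<in>space S. R \<theta> \<in> submartingale_laws)"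
    by (intro exI[of _ R]) (simp add: cone_drift_imp_submartingale_laws)
next
  assume "\<exists>R. pointwise_coupling S P Q R \<and> (\<forall>\<theta>\<in>space S. R \<theta> \<in> martingale_laws)"
  then show "\<forall>\<theta>\<in>space S. cx_le (P \<theta>) (Q \<theta>)"
    unfolding cx_le_iff_cone_le pointwise_coupling_def
    using cone_le_of_drift_coupling[OF convex_cone_singleton] martingale_laws_D by blast
next
  assume "\<exists>R. pointwise_coupling S P Q R \<and> (\<forall>\<theta>\<in>space S. R \<theta> \<in> submartingale_laws)"
  then show "\<forall>\<theta>\<in>space S. icx_le (P \<theta>) (Q \<theta>)"
    unfolding icx_le_iff_cone_le pointwise_coupling_def
    using cone_le_of_drift_coupling[OF convex_cone_nonneg_orthant] submartingale_laws_D by blast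
qed

end
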